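(* Let $R$ be a commutative unital ring. Let $G$ and $H$ be finite groups, $X$ be a finite $G$-set and $Y$ be a finite $H$-set. Suppose that as a $G$-set, $X$ decomposes in orbits as $\bigsqcup_{i=1}^nO_i$, with the stabilizer of an element in $O_i$ being $G_i$, and as an $H$-set, $Y$ decomposes in orbits as $\bigsqcup_{j=1}^mT_j$, with the stabilizer of an element in $T_j$ being $H_j$. If $X/G$ is isomorphic to $Y/H$ in $\mathscr{C}_R$, then $n=m$ and there exists a permutation $\sigma\in S_n$ such that $G_i\cong H_{\sigma(i)}$ as groups for all $i$.
   Context: All groups and sets with group action are finite; actions are left actions unless stated otherwise. For a finite group $\Gamma$ and a finite $\Gamma$-set $Z$, $B(Z)$ denotes the Grothendieck group, for the relations given by disjoint union, of the category of finite $\Gamma$-sets over $Z$ (pairs $(S,\varphi)$ with $\varphi:S\to Z$ a morphism of $\Gamma$-sets; isomorphisms are $\Gamma$-isomorphisms commuting with the maps to $Z$). The category $\mathscr{C}_R$: Objects are pairs $(G,X)$ with $G$ a finite group and $X$ a finite $G$-set, written $\frac{X}{G}$ or $X/G$. Morphisms: given $X/G$ and $Y/H$, regard $X$ and $Y$ as $(H\times G)$-sets through the projections ($H$ acts trivially on $X$, $G$ acts trivially on $Y$), and set $\mathrm{Hom}_{\mathscr{C}_R}(X/G,Y/H)=RB^{H,G}(Y,X):=R\otimes_{\mathbb Z}B(Y\times X)$, with $Y\times X$ viewed as an $(H\times G)$-set. It is generated by the classes $\langle U,\beta,\alpha\rangle$ of spans $Y\xleftarrow{\beta}U\xrightarrow{\alpha}X$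 of $(H\times G)$-sets. An $(H\times G)$-set is identified with an $(H,G)$-biset through $(h,g)u=hug^{-1}$; so $\beta(hug)=h\beta(u)$ and $\alpha(hug)=g^{-1}\alpha(u)$. Composition: for $\langle U,\beta,\alpha\rangle\in RB^{H,G}(Y,X)$ and $\langle V,\delta,\gamma\rangle\in RB^{K,H}(Z,Y)$, $\langle V,\delta,\gamma\rangle\circ\langle U,\beta,\alpha\rangle=\langle V\hat\times_HU,\hat\delta,\hat\alpha\rangle$, where $V\times_HU$ is the set of orbits $[v,u]$ of $V\times U$ under the right $H$-action $(v,u)\cdot h=(vh,h^{-1}u)$, $V\hat\times_HU=\{[v,u]\in V\times_HU\mid\gamma(v)=\beta(u)\}$ with the natural $(K\times G)$-action, $\hat\delta[v,u]=\delta(v)$, $\hat\alpha[v,u]=\alpha(u)$; this is extended $R$-bilinearly. Identity of $X/G$: $\langle G\times X,\underline1,\overline1\rangle$, with $(a,b)(g,x)=(agb^{-1},ax)$, $\underline1(g,x)=x$, $\overline1(g,x)=g^{-1}x$. *)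

theory Defs
  imports "HOL-Algebra.Algebra" "HOL-Library.Disjoint_Sets" "HOL-Combinatorics.Permutations"
begin

subsection \<open>Abelian groups by generators and relations, and tensor products\<close>

definition presented_group ::
    "'a set \<Rightarrow> ('a \<Rightarrow>\<^sub>0 int) set \<Rightarrow> ('a \<Rightarrow>\<^sub>0 int) set monoid" where
  "presented_group S Q = free_Abelian_group S Mod generate (free_Abelian_group S) Q"

definition presented_class ::
    "'a set \<Rightarrow> ('a \<Rightarrow>\<^sub>0 int) set \<Rightarrow> ('a \<Rightarrow>\<^sub>0 int) \<Rightarrow> ('a \<Rightarrow>\<^sub>0 int) set" where
  "presented_class S Q x =
     generate (free_Abelian_group S) Q #>\<^bsub>free_Abelian_group S\<^esub> x"

definition biextend ::
    "('a \<Rightarrow> 'b \<Rightarrow> 'c \<Rightarrow>\<^sub>0 int) \<Rightarrow> ('a \<Rightarrow>\<^sub>0 int) \<Rightarrow> ('b \<Rightarrow>\<^sub>0 int) \<Rightarrow> ('c \<Rightarrow>\<^sub>0 int)" where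
  "biextend f x y = frag_extend (\<lambda>a. frag_extend (f a) y) x"

text \<open>
  The tensor product over the integers of the additive group of the ring \<open>'r\<close> with an abelian
  group \<open>A\<close> (written multiplicatively). Biadditivity implies that integers can be moved across
  the tensor sign.
\<close>

definition tensor_gens :: "('a, 'm) monoid_scheme \<Rightarrow> ('r \<times> 'a) set" where
  "tensor_gens A = UNIV \<times> carrier A"

definition tensor_rels :: "('a, 'm) monoid_scheme \<Rightarrow> ('r::comm_ring_1 \<times> 'a \<Rightarrow>\<^sub>0 int) set" where
  "tensor_rels A =
     {frag_of (r + s, a) - frag_of (r, a) - frag_of (s, a) | r s a. a \<in> carrier A} \<union>
     {frag_of (r, a \<otimes>\<^bsub>A\<^esub> b) - frag_of (r, a) - frag_of (r, b) | r a b.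
        a \<in> carrier A \<and> b \<in> carrier A}"

definition tensor_group ::
    "('a, 'm) monoid_scheme \<Rightarrow> ('r::comm_ring_1 \<times> 'a \<Rightarrow>\<^sub>0 int) set monoid" where
  "tensor_group A = presented_group (tensor_gens A) (tensor_rels A)"

definition tensor_class ::
    "('a, 'm) monoid_scheme \<Rightarrow> ('r::comm_ring_1 \<times> 'a \<Rightarrow>\<^sub>0 int) \<Rightarrow> ('r \<times> 'a \<Rightarrow>\<^sub>0 int) set" where
  "tensor_class A = presented_class (tensor_gens A) (tensor_rels A)"


subsection \<open>Finite sets with a group action, and their Burnside groups\<close>

record ('g, 'x) gset =
  grp :: "'g monoid"
  pts :: "'x set"
  act :: "'g \<Rightarrow> 'x \<Rightarrow> 'x"

definition finite_gset :: "('g, 'x) gset \<Rightarrow> bool" where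
  "finite_gset A \<longleftrightarrow> finite (carrier (grp A)) \<and> finite (pts A) \<and>
     group_action (grp A) (pts A) (act A)"

definition gset_hom :: "('g, 'x) gset \<Rightarrow> ('g, 'y) gset \<Rightarrow> ('x \<Rightarrow> 'y) set" where
  "gset_hom A B = {f. f \<in> pts A \<rightarrow> pts B \<and>
     (\<forall>g\<in>carrier (grp A). \<forall>x\<in>pts A. f (act A g x) = act B g (f x))}"

text \<open>A pair \<open>(S, p)\<close> of a finite set with action of \<open>grp Z\<close> and an equivariant map to \<open>Z\<close>.\<close>

type_synonym ('g, 's, 'z) gset_over = "('g, 's) gset \<times> ('s \<Rightarrow> 'z)"

definition gset_over :: "('g, 'z) gset \<Rightarrow> ('g, 's, 'z) gset_over \<Rightarrow> bool" where
  "gset_over Z S \<longleftrightarrow>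
     finite_gset (fst S) \<and> grp (fst S) = grp Z \<and> snd S \<in> gset_hom (fst S) Z"

definition iso_over :: "('g, 's, 'z) gset_over \<Rightarrow> ('g, 't, 'z) gset_over \<Rightarrow> bool" where
  "iso_over S T \<longleftrightarrow> (\<exists>f\<in>gset_hom (fst S) (fst T).
     bij_betw f (pts (fst S)) (pts (fst T)) \<and> (\<forall>s\<in>pts (fst S). snd T (f s) = snd S s))"

text \<open>
  Every finite set is in bijection with a finite set of natural numbers, so objects whose
  underlying set is contained in \<open>nat\<close> represent all isomorphism classes. The isomorphism class
  of an object over any type is the set of its copies on sets of natural numbers.
\<close>

definition over_class ::
    "('g, 'z) gset \<Rightarrow> ('g, 's, 'z) gset_over \<Rightarrow> ('g, nat, 'z) gset_over set" where
  "over_class Z S = {T. gset_over Z T \<and> iso_over S T}"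

definition over_classes :: "('g, 'z) gset \<Rightarrow> ('g, nat, 'z) gset_over set set" where
  "over_classes Z = over_class Z ` {S :: ('g, nat, 'z) gset_over. gset_over Z S}"

definition over_sum ::
    "('g, 's, 'z) gset_over \<Rightarrow> ('g, 't, 'z) gset_over \<Rightarrow> ('g, 's + 't, 'z) gset_over" where
  "over_sum S T =
     (\<lparr>grp = grp (fst S),
       pts = pts (fst S) <+> pts (fst T),
       act = (\<lambda>g. restrict (map_sum (act (fst S) g) (act (fst T) g))
                    (pts (fst S) <+> pts (fst T)))\<rparr>,
      case_sum (snd S) (snd T))"

definition burnside_rels :: "('g, 'z) gset \<Rightarrow> (('g, nat, 'z) gset_over set \<Rightarrow>\<^sub>0 int) set" where
  "burnside_rels Z =
     {frag_of (over_class Z (over_sum S T)) - frag_of (over_class Z S) - frag_of (over_class Z T) |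
        (S :: ('g, nat, 'z) gset_over) (T :: ('g, nat, 'z) gset_over).
        gset_over Z S \<and> gset_over Z T}"

definition burnside_group ::
    "('g, 'z) gset \<Rightarrow> (('g, nat, 'z) gset_over set \<Rightarrow>\<^sub>0 int) set monoid" where
  "burnside_group Z = presented_group (over_classes Z) (burnside_rels Z)"

definition burnside_class ::
    "('g, 'z) gset \<Rightarrow> (('g, nat, 'z) gset_over set \<Rightarrow>\<^sub>0 int) \<Rightarrow>
     (('g, nat, 'z) gset_over set \<Rightarrow>\<^sub>0 int) set" where
  "burnside_class Z = presented_class (over_classes Z) (burnside_rels Z)"


subsection \<open>The category: objects and morphisms\<close>

text \<open>Objects are pairs \<open>A\<close> with \<open>finite_gset A\<close>, standing for \<open>pts A / grp A\<close>.\<close>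

definition prod_gset :: "('h, 'y) gset \<Rightarrow> ('g, 'x) gset \<Rightarrow> ('h \<times> 'g, 'y \<times> 'x) gset" where
  "prod_gset B A =
     \<lparr>grp = grp B \<times>\<times> grp A,
      pts = pts B \<times> pts A,
      act = (\<lambda>(h, g). \<lambda>(y, x)\<in>pts B \<times> pts A. (act B h y, act A g x))\<rparr>"

text \<open>
  A span from \<open>A\<close> to \<open>B\<close> is an object over \<open>prod_gset B A\<close>: the span with legs \<open>\<beta>\<close> (to \<open>B\<close>)
  and \<open>\<alpha>\<close> (to \<open>A\<close>) has structure map \<open>\<lambda>u. (\<beta> u, \<alpha> u)\<close>.
\<close>

type_synonym ('h, 'g, 'u, 'y, 'x) span = "('h \<times> 'g, 'u, 'y \<times> 'x) gset_over"

type_synonym ('h, 'g, 'y, 'x) span_class = "('h, 'g, nat, 'y, 'x) span set"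

type_synonym ('h, 'g, 'y, 'x) burnside_elt = "(('h, 'g, 'y, 'x) span_class \<Rightarrow>\<^sub>0 int) set"

type_synonym ('r, 'h, 'g, 'y, 'x) mor = "('r \<times> ('h, 'g, 'y, 'x) burnside_elt \<Rightarrow>\<^sub>0 int) set"

definition Hom_CR :: "('g, 'x) gset \<Rightarrow> ('h, 'y) gset \<Rightarrow> ('r::comm_ring_1, 'h, 'g, 'y, 'x) mor set"
  where "Hom_CR A B = carrier (tensor_group (burnside_group (prod_gset B A)))"


subsection \<open>Composition\<close>

text \<open>
  An element \<open>(h, g)\<close> acts on a span as \<open>u \<mapsto> h u g\<^sup>-\<^sup>1\<close>. Hence, for \<open>V\<close> from \<open>B\<close> to \<open>D\<close> and
  \<open>U\<close> from \<open>A\<close> to \<open>B\<close>, the right action \<open>(v, u) h = (v h, h\<^sup>-\<^sup>1 u)\<close> is given by \<open>(1, h\<^sup>-\<^sup>1)\<close>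
  on \<open>v\<close> and by \<open>(h\<^sup>-\<^sup>1, 1)\<close> on \<open>u\<close>.
\<close>

definition span_orbit ::
    "('k, 'z) gset \<Rightarrow> ('h, 'y) gset \<Rightarrow> ('g, 'x) gset \<Rightarrow>
     ('k, 'h, 'v, 'z, 'y) span \<Rightarrow> ('h, 'g, 'u, 'y, 'x) span \<Rightarrow> 'v \<times> 'u \<Rightarrow> ('v \<times> 'u) set" where
  "span_orbit D B A V U = (\<lambda>(v, u).
     {(act (fst V) (\<one>\<^bsub>grp D\<^esub>, inv\<^bsub>grp B\<^esub> h) v, act (fst U) (inv\<^bsub>grp B\<^esub> h, \<one>\<^bsub>grp A\<^esub>) u) | h.
        h \<in> carrier (grp B)})"

definition span_comp_pts ::
    "('k, 'z) gset \<Rightarrow> ('h, 'y) gset \<Rightarrow> ('g, 'x) gset \<Rightarrow>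
     ('k, 'h, 'v, 'z, 'y) span \<Rightarrow> ('h, 'g, 'u, 'y, 'x) span \<Rightarrow> ('v \<times> 'u) set set" where
  "span_comp_pts D B A V U = {span_orbit D B A V U (v, u) | v u.
     v \<in> pts (fst V) \<and> u \<in> pts (fst U) \<and> snd (snd V v) = fst (snd U u)}"

text \<open>
  The group acts on an orbit by acting on all of its elements, and the legs are constant on each
  orbit.
\<close>

definition span_comp ::
    "('k, 'z) gset \<Rightarrow> ('h, 'y) gset \<Rightarrow> ('g, 'x) gset \<Rightarrow>
     ('k, 'h, 'v, 'z, 'y) span \<Rightarrow> ('h, 'g, 'u, 'y, 'x) span \<Rightarrow>
     ('k, 'g, ('v \<times> 'u) set, 'z, 'x) span" where
  "span_comp D B A V U =
     (\<lparr>grp = grp D \<times>\<times> grp A,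
       pts = span_comp_pts D B A V U,
       act = (\<lambda>(k, g). \<lambda>w\<in>span_comp_pts D B A V U.
                (\<lambda>(v, u). (act (fst V) (k, \<one>\<^bsub>grp B\<^esub>) v, act (fst U) (\<one>\<^bsub>grp B\<^esub>, g) u)) ` w)\<rparr>,
      (\<lambda>w. the_elem ((\<lambda>(v, u). (fst (snd V v), snd (snd U u))) ` w)))"

text \<open>
  The operations induced by \<open>span_comp\<close> on isomorphism classes, on Burnside groups (biadditive
  extension) and on tensor products (\<open>(r \<otimes> b) (s \<otimes> c) = r s \<otimes> b c\<close>). Each is given on
  equivalence classes as the union, over all representatives, of the class of the result.
\<close>

definition span_class_comp ::
    "('k, 'z) gset \<Rightarrow> ('h, 'y) gset \<Rightarrow> ('g, 'x) gset \<Rightarrow>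
     ('k, 'h, 'z, 'y) span_class \<Rightarrow> ('h, 'g, 'y, 'x) span_class \<Rightarrow> ('k, 'g, 'z, 'x) span_class" where
  "span_class_comp D B A C C' =
     (\<Union>V\<in>C. \<Union>U\<in>C'. over_class (prod_gset D A) (span_comp D B A V U))"

definition burnside_comp ::
    "('k, 'z) gset \<Rightarrow> ('h, 'y) gset \<Rightarrow> ('g, 'x) gset \<Rightarrow>
     ('k, 'h, 'z, 'y) burnside_elt \<Rightarrow> ('h, 'g, 'y, 'x) burnside_elt \<Rightarrow>
     ('k, 'g, 'z, 'x) burnside_elt" where
  "burnside_comp D B A b c =
     (\<Union>p\<in>b. \<Union>q\<in>c. burnside_class (prod_gset D A)
        (biextend (\<lambda>C C'. frag_of (span_class_comp D B A C C')) p q))"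

definition comp_CR ::
    "('k, 'z) gset \<Rightarrow> ('h, 'y) gset \<Rightarrow> ('g, 'x) gset \<Rightarrow>
     ('r::comm_ring_1, 'k, 'h, 'z, 'y) mor \<Rightarrow> ('r, 'h, 'g, 'y, 'x) mor \<Rightarrow>
     ('r, 'k, 'g, 'z, 'x) mor" where
  "comp_CR D B A \<psi> \<phi> =
     (\<Union>p\<in>\<psi>. \<Union>q\<in>\<phi>. tensor_class (burnside_group (prod_gset D A))
        (biextend (\<lambda>(r, b) (s, c). frag_of (r * s, burnside_comp D B A b c)) p q))"


subsection \<open>Identities and isomorphism\<close>

definition id_span :: "('g, 'x) gset \<Rightarrow> ('g, 'g, 'g \<times> 'x, 'x, 'x) span" where
  "id_span A =
     (\<lparr>grp = grp A \<times>\<times> grp A,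
       pts = carrier (grp A) \<times> pts A,
       act = (\<lambda>(a, b). \<lambda>(g, x)\<in>carrier (grp A) \<times> pts A.
                (a \<otimes>\<^bsub>grp A\<^esub> g \<otimes>\<^bsub>grp A\<^esub> inv\<^bsub>grp A\<^esub> b, act A a x))\<rparr>,
      (\<lambda>(g, x). (x, act A (inv\<^bsub>grp A\<^esub> g) x)))"

definition id_CR :: "('g, 'x) gset \<Rightarrow> ('r::comm_ring_1, 'g, 'g, 'x, 'x) mor" where
  "id_CR A = tensor_class (burnside_group (prod_gset A A))
     (frag_of (1, burnside_class (prod_gset A A)
        (frag_of (over_class (prod_gset A A) (id_span A)))))"

definition isomorphic_CR ::
    "'r::comm_ring_1 itself \<Rightarrow> ('g, 'x) gset \<Rightarrow> ('h, 'y) gset \<Rightarrow> bool" where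
  "isomorphic_CR R A B \<longleftrightarrow>
     (\<exists>\<phi> \<in> (Hom_CR A B :: ('r, 'h, 'g, 'y, 'x) mor set).
      \<exists>\<psi> \<in> (Hom_CR B A :: ('r, 'g, 'h, 'x, 'y) mor set).
        comp_CR A B A \<psi> \<phi> = id_CR A \<and> comp_CR B A B \<phi> \<psi> = id_CR B)"

end

theory Submission
  imports Defs "Jordan_Normal_Form.Determinant"
begin

text \<open>
  For a finite group \<open>K\<close>, consider the sections \<open>(x, S, N)\<close> of \<open>X/G\<close> with quotient \<open>K\<close>: points \<open>x\<close>,
  subgroups \<open>S\<close> of the stabilizer of \<open>x\<close> and normal subgroups \<open>N\<close> of \<open>S\<close> with \<open>S/N\<close>
  isomorphic to \<open>K\<close>. A span \<open>U\<close> acts on the free module on the \<open>G\<close>-classes of sections: it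
  decomposes \<open>U/N\<close> over \<open>x\<close> into \<open>H\<close>-orbits and keeps the orbits of those \<open>u N\<close> for which \<open>S/N\<close>
  acts freely and preserves \<open>H u N\<close>; such an orbit is again a section \<open>(y, T, M)\<close> with
  \<open>T/M\<close> isomorphic to \<open>S/N\<close>. This is the quotient of the functor \<open>Hom(1/K, -)\<close> by the morphisms
  that factor through smaller groups, made coinvariant under the automorphisms of \<open>K\<close>. The
  action has integral matrix coefficients, so it is defined over every \<open>R\<close>, and isomorphic objects
  have the same number of classes of sections for each \<open>K\<close>. This number is additive over the
  orbits of \<open>X\<close>. A group \<open>L\<close> with at most \<open>|K|\<close> elements has a section with quotient \<open>K\<close> only if
  it is isomorphic to \<open>K\<close>, so taking for \<open>K\<close> a stabilizer of maximal order one can match and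
  cancel the stabilizers one at a time.
\<close>

subsection \<open>Invertible matrices over a commutative ring are square\<close>

text \<open>Subgroups S alone would not be closed under transport. Even for N = 1, a point u with
  stabilizer D in H x G sends S to a subgroup T of H together with the normal subgroup M of all h
  with (h, 1) in D, and M is nontrivial as soon as H does not act freely at u. This is why sections
  (S, N) occur and why orbits are taken in U/N. The two conditions on u N say that nothing of S/N
  gets lost: without freeness only a proper quotient of S/N would reach H, and if S moved u N out of
  its H-orbit only a proper subgroup would. A loss in one span cannot be repaired by the next one,
  so leaving out such orbits is compatible with composition. Therefore orbits are counted without
  weights, and all that is asked of R is that an invertible matrix over it is square. The test group
  K is taken from the stabilizers on either side. These live over two different types, so the counts
  are compared for K over both.\<close>

lemma card_le_of_right_inverse:
  fixes P Q :: "_ \<Rightarrow> _ \<Rightarrow> 'r::comm_ring_1"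
  assumes "finite I" "finite J"
    and PQ: "\<And>i k. i \<in> I \<Longrightarrow> k \<in> I \<Longrightarrow> (\<Sum>j\<in>J. P i j * Q j k) = (if i = k then 1 else 0)"
  shows "card I \<le> card J"
proof (rule ccontr)
  define n where "n = card I"
  define m where "m = card J"
  assume "\<not> card I \<le> card J"
  then have mn: "m < n" by (simp add: n_def m_def)
  obtain e where e: "bij_betw e {0..<n} I"
    using ex_bij_betw_nat_finite[OF \<open>finite I\<close>] n_def by auto
  obtain d where d: "bij_betw d {0..<m} J"
    using ex_bij_betw_nat_finite[OF \<open>finite J\<close>] m_def by auto
  \<comment> \<open>If J were smaller than I, then P padded with zero columns and Q padded with zero
    rows would be square matrices of size n whose product is still the identity, although the padded
    Q has determinant zero. Determinants work over every commutative ring, and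
    \<open>0 \<noteq> 1\<close> gives the contradiction.\<close>
  define A where "A = mat n n (\<lambda>(i, j). if j < m then P (e i) (d j) else 0)"
  define B where "B = mat n n (\<lambda>(j, k). if j < m then Q (d j) (e k) else 0)"
  have AB: "A \<in> carrier_mat n n" "B \<in> carrier_mat n n"
    by (auto simp: A_def B_def)
  have "A * B = 1\<^sub>m n"
  proof (rule eq_matI)
    fix i k assume "i < dim_row (1\<^sub>m n)" "k < dim_col (1\<^sub>m n)"
    then have ik: "i < n" "k < n" by auto
    have "(A * B) $$ (i, k) = (\<Sum>j = 0..<n. (if j < m then P (e i) (d j) else 0) *
        (if j < m then Q (d j) (e k) else 0))"
      using ik by (simp add: A_def B_def scalar_prod_def)
    also have "\<dots> = (\<Sum>j = 0..<m. P (e i) (d j) * Q (d j) (e k))"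
      using mn by (intro sum.mono_neutral_cong_right) auto
    also have "\<dots> = (\<Sum>j\<in>J. P (e i) j * Q j (e k))"
      by (rule sum.reindex_bij_betw[OF d])
    also have "\<dots> = (if e i = e k then 1 else 0)"
      using PQ[of "e i" "e k"] e ik unfolding bij_betw_def by auto
    also have "\<dots> = 1\<^sub>m n $$ (i, k)"
      using e ik by (auto simp: bij_betw_def inj_on_def)
    finally show "(A * B) $$ (i, k) = 1\<^sub>m n $$ (i, k)" .
  qed (use AB in auto)
  then have "det A * det B = 1"
    using det_mult[OF AB] by simp
  moreover have "det B = 0"
  proof -
    \<comment> \<open>Row m is the first padding row; it exists because m < n.\<close>
    have "B = mat\<^sub>r n n (\<lambda>i. if i = m then 0\<^sub>v n else row B i)"
      using AB(2) mn by (intro eq_matI) (auto simp: B_def)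
    moreover have "det (mat\<^sub>r n n (\<lambda>i. if i = m then 0\<^sub>v n else row B i)) = 0"
      using mn AB(2) by (intro det_row_0) auto
    ultimately show ?thesis by argo
  qed
  ultimately show False by simp
qed

lemma card_eq_of_inverse_matrices:
  fixes P Q :: "_ \<Rightarrow> _ \<Rightarrow> 'r::comm_ring_1"
  assumes "finite I" "finite J"
    and "\<And>i k. i \<in> I \<Longrightarrow> k \<in> I \<Longrightarrow> (\<Sum>j\<in>J. P i j * Q j k) = (if i = k then 1 else 0)"
    and "\<And>i k. i \<in> J \<Longrightarrow> k \<in> J \<Longrightarrow> (\<Sum>j\<in>I. Q i j * P j k) = (if i = k then 1 else 0)"
  shows "card I = card J"
  using card_le_of_right_inverse[of I J P Q] card_le_of_right_inverse[of J I Q P] assms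
  by (simp add: le_antisym)

subsection \<open>Groups given by generators and relations\<close>

text \<open>The additive map from the free abelian group to R with prescribed values on the
  generators. It lands in R and not in the integers, so integral combinations of spans are evaluated
  directly in the ring of coefficients.\<close>

definition frag_eval :: "('a \<Rightarrow> 'r::comm_ring_1) \<Rightarrow> ('a \<Rightarrow>\<^sub>0 int) \<Rightarrow> 'r" where
  "frag_eval f x = (\<Sum>k\<in>Poly_Mapping.keys x. of_int (poly_mapping.lookup x k) * f k)"

lemma frag_eval_superset:
  assumes "finite K" "Poly_Mapping.keys x \<subseteq> K"
  shows "frag_eval f x = (\<Sum>k\<in>K. of_int (poly_mapping.lookup x k) * f k)"
  unfolding frag_eval_def using assms
  by (intro sum.mono_neutral_left) (auto simp: in_keys_iff)

lemma frag_eval_0 [simp]: "frag_eval f 0 = 0"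
  by (simp add: frag_eval_def)

lemma frag_eval_frag_of [simp]: "frag_eval f (frag_of a) = f a"
  by (simp add: frag_eval_def keys_frag_of)

lemma frag_eval_diff [simp]: "frag_eval f (x - y) = frag_eval f x - frag_eval f y"
proof -
  let ?K = "Poly_Mapping.keys x \<union> Poly_Mapping.keys y"
  have "Poly_Mapping.keys (x - y) \<subseteq> ?K"
    by (simp add: keys_diff)
  then show ?thesis
    by (simp add: frag_eval_superset[of ?K] lookup_minus left_diff_distrib sum_subtractf)
qed

lemma frag_eval_minus [simp]: "frag_eval f (- x) = - frag_eval f x"
  using frag_eval_diff[of f 0 x] by simp

lemma frag_eval_add [simp]: "frag_eval f (x + y) = frag_eval f x + frag_eval f y"
  using frag_eval_diff[of f x "- y"] by simp

text \<open>Bilinearity reduces a formula of matrix product type to pairs of generators. It serves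
  twice: for composites in Burnside groups and for composites in tensor products.\<close>

lemma frag_eval_biextend:
  assumes "Poly_Mapping.keys x \<subseteq> S" "Poly_Mapping.keys y \<subseteq> T"
    and "\<And>a b. a \<in> S \<Longrightarrow> b \<in> T \<Longrightarrow> frag_eval f (F a b) = (\<Sum>j\<in>J. g j a * h j b)"
  shows "frag_eval f (biextend F x y) = (\<Sum>j\<in>J. frag_eval (g j) x * frag_eval (h j) y)"
proof -
  have "frag_eval f (frag_extend (F a) y) = (\<Sum>j\<in>J. g j a * frag_eval (h j) y)" if "a \<in> S" for a
    using assms(2) by (induction y rule: frag_induction)
      (auto simp: frag_extend_diff assms(3) that right_diff_distrib sum_subtractf)
  with assms(1) show ?thesis
    unfolding biextend_def
    by (induction x rule: frag_induction)
      (auto simp: frag_extend_diff left_diff_distrib sum_subtractf)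
qed

locale presentation =
  fixes S :: "'a set" and Q :: "('a \<Rightarrow>\<^sub>0 int) set"
  assumes rels: "Q \<subseteq> carrier (free_Abelian_group S)"
begin

abbreviation "relations_span \<equiv> generate (free_Abelian_group S) Q"

lemma relations_normal: "relations_span \<lhd> free_Abelian_group S"
  using comm_group.normal_iff_subgroup[OF abelian_free_Abelian_group]
    group.generate_is_subgroup[OF group_free_Abelian_group rels] by blast

lemma relations_subgroup: "subgroup relations_span (free_Abelian_group S)"
  using group.generate_is_subgroup[OF group_free_Abelian_group rels] .

lemma group_presented: "group (presented_group S Q)"
  unfolding presented_group_def by (rule normal.factorgroup_is_group[OF relations_normal])

lemma presented_class_self:
  "x \<in> presented_class S Q x"
  using subgroup.one_closed[OF relations_subgroup]
  by (force simp: presented_class_def r_coset_def)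

lemma carrier_presented:
  "carrier (presented_group S Q) = presented_class S Q ` {x. Poly_Mapping.keys x \<subseteq> S}"
  by (auto simp: presented_group_def presented_class_def FactGroup_def RCOSETS_def)

lemma in_presented_class_keys:
  assumes "y \<in> presented_class S Q x" "Poly_Mapping.keys x \<subseteq> S"
  shows "Poly_Mapping.keys y \<subseteq> S"
proof -
  obtain z where "z \<in> relations_span" "y = z + x"
    using assms(1) by (auto simp: presented_class_def r_coset_def)
  then show ?thesis
    using assms(2) subgroup.mem_carrier[OF relations_subgroup \<open>z \<in> relations_span\<close>] Poly_Mapping.keys_add[of z x] by auto
qed

text \<open>Elements of a presented group are cosets, that is, sets of formal sums. An additive map
  that kills the relators kills the subgroup they generate, hence is constant on cosets; this is how
  coefficients descend to morphisms.\<close>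

lemma frag_eval_presented_class:
  assumes "\<And>q. q \<in> Q \<Longrightarrow> frag_eval f q = 0" and "y \<in> presented_class S Q x"
  shows "frag_eval f y = frag_eval f x"
proof -
  obtain z where z: "z \<in> relations_span" "y = z + x"
    using assms(2) by (auto simp: presented_class_def r_coset_def)
  have "frag_eval f z = 0"
    using z(1)
  proof (induction rule: generate.induct)
    \<comment> \<open>Group inverses are negatives on elements supported in S, which is where the
      relators lie.\<close>
    case (inv h)
    then have "h \<in> carrier (free_Abelian_group S)"
      using rels by blast
    then have "Poly_Mapping.keys h \<subseteq> S"
      by simp
    with inv show ?case by (simp add: assms(1))
  qed (auto simp: assms(1))
  with z show ?thesis by simp
qed

lemma carrier_presented_keys:
  assumes "c \<in> carrier (presented_group S Q)" "y \<in> c"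
  shows "Poly_Mapping.keys y \<subseteq> S"
  using assms in_presented_class_keys by (auto simp: carrier_presented)

lemma carrier_presented_nonempty:
  "c \<in> carrier (presented_group S Q) \<Longrightarrow> c \<noteq> {}"
  using presented_class_self by (auto simp: carrier_presented)

lemma frag_eval_carrier_presented:
  assumes "\<And>q. q \<in> Q \<Longrightarrow> frag_eval f q = 0"
    and "c \<in> carrier (presented_group S Q)" "x \<in> c" "y \<in> c"
  shows "frag_eval f x = frag_eval f y"
  using assms frag_eval_presented_class[of f, OF assms(1)] by (auto simp: carrier_presented)

lemma in_mult_presented:
  assumes "z \<in> b \<otimes>\<^bsub>presented_group S Q\<^esub> c"
  obtains x y where "x \<in> b" "y \<in> c" "z = x + y"
  using assms by (auto simp: presented_group_def FactGroup_def set_mult_def)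

end

subsection \<open>Counting equivalence classes\<close>

text \<open>A map that preserves and reflects the relations and meets every class induces a
  bijection of the quotients; it may itself be neither injective nor surjective. The bijection is
  taken as preimage of classes, which involves no choice.\<close>

lemma card_quotient_eq:
  assumes r: "equiv P r" and s: "equiv Q s" and f: "f \<in> P \<rightarrow> Q"
    and rs: "\<And>x y. x \<in> P \<Longrightarrow> y \<in> P \<Longrightarrow> (x, y) \<in> r \<longleftrightarrow> (f x, f y) \<in> s"
    and surj: "\<And>q. q \<in> Q \<Longrightarrow> \<exists>p\<in>P. (f p, q) \<in> s"
  shows "card (P // r) = card (Q // s)"
proof -
  have cls: "f -` (s `` {f p}) \<inter> P = r `` {p}" if "p \<in> P" for p
    using that rs[OF that] equiv_type[OF r] by auto
  have Q: "\<exists>p\<in>P. C = s `` {f p}" if C: "C \<in> Q // s" for C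
  proof -
    obtain q where "q \<in> Q" "C = s `` {q}" using C by (auto elim!: quotientE)
    with surj show ?thesis using equiv_class_eq[OF s] by blast
  qed
  have "bij_betw (\<lambda>C. f -` C \<inter> P) (Q // s) (P // r)"
  proof (rule bij_betwI')
    fix C D assume "C \<in> Q // s" "D \<in> Q // s"
    then obtain p q where pq: "p \<in> P" "q \<in> P" "C = s `` {f p}" "D = s `` {f q}"
      using Q by metis
    then show "(f -` C \<inter> P = f -` D \<inter> P) \<longleftrightarrow> C = D"
      using cls rs eq_equiv_class_iff[OF r] eq_equiv_class_iff[OF s] f by (auto simp: Pi_iff)
  next
    fix C assume "C \<in> Q // s"
    then show "f -` C \<inter> P \<in> P // r"
      using Q[of C] cls by (auto intro: quotientI)
  next
    fix D assume "D \<in> P // r"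
    then obtain p where "p \<in> P" "D = r `` {p}" by (auto elim!: quotientE)
    then show "\<exists>C\<in>Q // s. D = f -` C \<inter> P"
      using cls f by (intro bexI[of _ "s `` {f p}"]) (auto intro: quotientI)
  qed
  then show ?thesis
    by (simp add: bij_betw_same_card)
qed

text \<open>Compatibility with the relations puts each class of r over exactly one class of s, so
  the classes can be counted over each class of s separately. This one count gives the splitting of
  a disjoint union, both halves of the composition formula and the sum over orbits.\<close>

lemma card_quotient_fibers:
  assumes fin: "finite P" "finite Q" and r: "equiv P r" and s: "equiv Q s" and f: "f \<in> P \<rightarrow> Q"
    and rs: "\<And>x y. (x, y) \<in> r \<Longrightarrow> (f x, f y) \<in> s"
  shows "card (P // r) = (\<Sum>C\<in>Q // s. card ({x\<in>P. f x \<in> C} // Restr r {x\<in>P. f x \<in> C}))"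
proof -
  let ?F = "\<lambda>C. {x\<in>P. f x \<in> C}"
  have sub: "?F C // Restr r (?F C) = {D\<in>P // r. D \<subseteq> ?F C}" if C: "C \<in> Q // s" for C
  proof -
    \<comment> \<open>The part of P over a class is a union of classes of r, so restricting r to it
      cuts no class apart.\<close>
    have closed: "y \<in> ?F C" if "x \<in> ?F C" "(x, y) \<in> r" for x y
      using in_quotient_imp_closed[OF s C _ rs[OF that(2)]] that equiv_type[OF r] by auto
    have eq: "Restr r (?F C) `` {x} = r `` {x}" if "x \<in> ?F C" for x
      using closed[OF that] that by auto
    have "?F C // Restr r (?F C) = (\<lambda>x. r `` {x}) ` ?F C"
      using eq by (auto simp: quotient_def)
    also have "\<dots> = {D\<in>P // r. D \<subseteq> ?F C}"
    proof (intro equalityI subsetI)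
      fix D assume "D \<in> (\<lambda>x. r `` {x}) ` ?F C"
      then obtain x where "x \<in> ?F C" "D = r `` {x}" by blast
      then show "D \<in> {D\<in>P // r. D \<subseteq> ?F C}"
        using closed[of x] by (auto intro: quotientI)
    next
      fix D assume D: "D \<in> {D\<in>P // r. D \<subseteq> ?F C}"
      then obtain p where p: "p \<in> P" "D = r `` {p}" by (auto elim!: quotientE)
      then have "p \<in> ?F C"
        using D equiv_class_self[OF r] by blast
      with p show "D \<in> (\<lambda>x. r `` {x}) ` ?F C" by blast
    qed
    finally show ?thesis .
  qed
  have "P // r = (\<Union>C\<in>Q // s. {D\<in>P // r. D \<subseteq> ?F C})"
  proof (intro equalityI subsetI)
    fix D assume D: "D \<in> P // r"
    then obtain p where p: "p \<in> P" "D = r `` {p}" by (auto elim!: quotientE)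
    have "D \<subseteq> ?F (s `` {f p})"
      using p rs equiv_type[OF r] by auto
    moreover have "s `` {f p} \<in> Q // s"
      using p f by (auto intro: quotientI)
    ultimately show "D \<in> (\<Union>C\<in>Q // s. {D\<in>P // r. D \<subseteq> ?F C})"
      using D by blast
  qed auto
  also have "card \<dots> = (\<Sum>C\<in>Q // s. card {D\<in>P // r. D \<subseteq> ?F C})"
  proof (rule card_UN_disjoint)
    show "finite (Q // s)"
      using fin s by (simp add: equiv_type finite_quotient)
    have fP: "finite (P // r)"
      using fin r by (simp add: equiv_type finite_quotient)
    then show "\<forall>C\<in>Q // s. finite {D\<in>P // r. D \<subseteq> ?F C}" by simp
    show "\<forall>C\<in>Q // s. \<forall>C'\<in>Q // s. C \<noteq> C' \<longrightarrow>
        {D\<in>P // r. D \<subseteq> ?F C} \<inter> {D\<in>P // r. D \<subseteq> ?F C'} = {}"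
    proof (intro ballI impI)
      fix C C' assume "C \<in> Q // s" "C' \<in> Q // s" "C \<noteq> C'"
      then have "C \<inter> C' = {}"
        using quotient_disj[OF s] by blast
      then show "{D\<in>P // r. D \<subseteq> ?F C} \<inter> {D\<in>P // r. D \<subseteq> ?F C'} = {}"
        using in_quotient_imp_non_empty[OF r] by blast
    qed
  qed
  also have "\<dots> = (\<Sum>C\<in>Q // s. card (?F C // Restr r (?F C)))"
    using sub by simp
  finally show ?thesis .
qed

subsection \<open>Actions and sections\<close>

text \<open>P may be any set of points and need not be stable under C: points of P are related when
  an element of C moves one to the other, wherever the rest of the orbit lies. Passing to a subset
  then only means replacing P.\<close>

definition act_rel :: "'c set \<Rightarrow> ('c \<Rightarrow> 'p \<Rightarrow> 'p) \<Rightarrow> 'p set \<Rightarrow> ('p \<times> 'p) set" where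
  "act_rel C f P = {(x, y). x \<in> P \<and> y \<in> P \<and> (\<exists>c\<in>C. y = f c x)}"

lemma act_relI: "x \<in> P \<Longrightarrow> y \<in> P \<Longrightarrow> c \<in> C \<Longrightarrow> y = f c x \<Longrightarrow> (x, y) \<in> act_rel C f P"
  by (auto simp: act_rel_def)

lemma act_relE:
  assumes "(x, y) \<in> act_rel C f P"
  obtains c where "x \<in> P" "y \<in> P" "c \<in> C" "y = f c x"
  using assms by (auto simp: act_rel_def)

lemma equiv_act_rel:
  assumes "group \<Gamma>" "subgroup C \<Gamma>"
    and one: "\<And>x. x \<in> P \<Longrightarrow> f \<one>\<^bsub>\<Gamma>\<^esub> x = x"
    and mult: "\<And>c d x. c \<in> C \<Longrightarrow> d \<in> C \<Longrightarrow> x \<in> P \<Longrightarrow> f (c \<otimes>\<^bsub>\<Gamma>\<^esub> d) x = f c (f d x)"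
  shows "equiv P (act_rel C f P)"
proof (intro equivI)
  interpret group \<Gamma> by fact
  interpret C: subgroup C \<Gamma> by fact
  show "act_rel C f P \<subseteq> P \<times> P"
    by (auto simp: act_rel_def)
  show "refl_on P (act_rel C f P)"
    using one by (auto simp: refl_on_def intro!: act_relI[OF _ _ C.one_closed])
  show "sym (act_rel C f P)"
  proof (rule symI)
    fix x y assume "(x, y) \<in> act_rel C f P"
    then obtain c where c: "x \<in> P" "y \<in> P" "c \<in> C" "y = f c x"
      by (rule act_relE)
    then have "f (inv\<^bsub>\<Gamma>\<^esub> c) y = f (inv\<^bsub>\<Gamma>\<^esub> c \<otimes>\<^bsub>\<Gamma>\<^esub> c) x"
      using mult[of "inv\<^bsub>\<Gamma>\<^esub> c" c x] by simp
    also have "\<dots> = x"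
      using c one by simp
    finally show "(y, x) \<in> act_rel C f P"
      using c by (intro act_relI[of _ _ _ "inv\<^bsub>\<Gamma>\<^esub> c"]) auto
  qed
  show "trans (act_rel C f P)"
  proof (rule transI)
    fix x y z assume "(x, y) \<in> act_rel C f P" "(y, z) \<in> act_rel C f P"
    then obtain c d where "x \<in> P" "z \<in> P" "c \<in> C" "d \<in> C" "y = f c x" "z = f d y"
      by (meson act_relE)
    then show "(x, z) \<in> act_rel C f P"
      using mult by (intro act_relI[of _ _ _ "d \<otimes>\<^bsub>\<Gamma>\<^esub> c"]) auto
  qed
qed

lemma Restr_act_rel: "P' \<subseteq> P \<Longrightarrow> Restr (act_rel C f P) P' = act_rel C f P'"
  by (auto simp: act_rel_def)

locale fin_gset =
  fixes A :: "('g, 'x) gset"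
  assumes finite_gset: "finite_gset A"
begin

sublocale group_action "grp A" "pts A" "act A"
  using finite_gset by (simp add: finite_gset_def)

sublocale grp: group "grp A"
  using group_hom by (simp add: group_hom_def)

lemma finite_carrier: "finite (carrier (grp A))" and finite_pts: "finite (pts A)"
  using finite_gset by (auto simp: finite_gset_def)

lemma act_closed [simp]: "g \<in> carrier (grp A) \<Longrightarrow> x \<in> pts A \<Longrightarrow> act A g x \<in> pts A"
  using element_image by blast

lemma act_one [simp]: "x \<in> pts A \<Longrightarrow> act A \<one>\<^bsub>grp A\<^esub> x = x"
  using id_eq_one by (metis restrict_apply')

lemmas act_mult = composition_rule

lemma act_inv_act [simp]:
  "g \<in> carrier (grp A) \<Longrightarrow> x \<in> pts A \<Longrightarrow> act A (inv\<^bsub>grp A\<^esub> g) (act A g x) = x"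
  using act_mult[of x "inv\<^bsub>grp A\<^esub> g" g] by simp

lemma act_act_inv [simp]:
  "g \<in> carrier (grp A) \<Longrightarrow> x \<in> pts A \<Longrightarrow> act A g (act A (inv\<^bsub>grp A\<^esub> g) x) = x"
  using act_mult[of x g "inv\<^bsub>grp A\<^esub> g"] by simp

end

text \<open>Actions are homomorphisms into the group of extensional bijections of the point set.
  This adds to the usual axioms that \<open>act A g\<close> be undefined off the points.\<close>

lemma fin_gsetI:
  assumes "group (grp A)" "finite (carrier (grp A))" "finite (pts A)"
    and closed: "\<And>g x. g \<in> carrier (grp A) \<Longrightarrow> x \<in> pts A \<Longrightarrow> act A g x \<in> pts A"
    and one: "\<And>x. x \<in> pts A \<Longrightarrow> act A \<one>\<^bsub>grp A\<^esub> x = x"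
    and mult: "\<And>g h x. g \<in> carrier (grp A) \<Longrightarrow> h \<in> carrier (grp A) \<Longrightarrow> x \<in> pts A \<Longrightarrow>
      act A (g \<otimes>\<^bsub>grp A\<^esub> h) x = act A g (act A h x)"
    and ext: "\<And>g. g \<in> carrier (grp A) \<Longrightarrow> act A g \<in> extensional (pts A)"
  shows "finite_gset A"
proof -
  interpret group "grp A" by fact
  have Bij: "act A g \<in> Bij (pts A)" if g: "g \<in> carrier (grp A)" for g
  proof -
    have "bij_betw (act A g) (pts A) (pts A)"
    proof (rule bij_betw_byWitness[where f' = "act A (inv\<^bsub>grp A\<^esub> g)"])
      show "\<forall>x\<in>pts A. act A (inv\<^bsub>grp A\<^esub> g) (act A g x) = x"
        using mult[of "inv\<^bsub>grp A\<^esub> g" g] g one by simp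
      show "\<forall>x\<in>pts A. act A g (act A (inv\<^bsub>grp A\<^esub> g) x) = x"
        using mult[of g "inv\<^bsub>grp A\<^esub> g"] g one by simp
    qed (use g closed in auto)
    with ext[OF g] show ?thesis by (simp add: Bij_def)
  qed
  have "act A \<in> hom (grp A) (BijGroup (pts A))"
  proof (rule homI)
    fix g h assume g: "g \<in> carrier (grp A)" and h: "h \<in> carrier (grp A)"
    have "act A (g \<otimes>\<^bsub>grp A\<^esub> h) = compose (pts A) (act A g) (act A h)"
    proof
      fix x
      show "act A (g \<otimes>\<^bsub>grp A\<^esub> h) x = compose (pts A) (act A g) (act A h) x"
        using mult[OF g h, of x] extensional_arb[OF ext[of "g \<otimes>\<^bsub>grp A\<^esub> h"], of x] g h
        by (cases "x \<in> pts A") (simp_all add: compose_def)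
    qed
    then show "act A (g \<otimes>\<^bsub>grp A\<^esub> h) = act A g \<otimes>\<^bsub>BijGroup (pts A)\<^esub> act A h"
      using Bij g h by (simp add: BijGroup_def)
  qed (use Bij in \<open>auto simp: BijGroup_def\<close>)
  then show ?thesis
    using assms(2,3) group_BijGroup
    by (auto simp: finite_gset_def group_action_def group_hom_def group_hom_axioms_def is_group)
qed

section \<open>Sections and their conjugates\<close>

definition conj_by :: "('g, 'm) monoid_scheme \<Rightarrow> 'g \<Rightarrow> 'g \<Rightarrow> 'g" where
  "conj_by G g x = g \<otimes>\<^bsub>G\<^esub> x \<otimes>\<^bsub>G\<^esub> inv\<^bsub>G\<^esub> g"

text \<open>Giving N as the kernel of a surjection onto K makes its normality automatic and avoids
  forming quotient groups. The surjection itself is not recorded: this is the passage to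
  coinvariants under the automorphisms of K.\<close>

definition sections :: "('k, 'm) monoid_scheme \<Rightarrow> ('g, 'x) gset \<Rightarrow> ('x \<times> 'g set \<times> 'g set) set" where
  "sections K A = {(x, S, N). x \<in> pts A \<and> subgroup S (grp A) \<and>
     S \<subseteq> stabilizer (grp A) (act A) x \<and>
     (\<exists>\<theta>\<in>hom (grp A\<lparr>carrier := S\<rparr>) K. \<theta> ` S = carrier K \<and> N = {s\<in>S. \<theta> s = \<one>\<^bsub>K\<^esub>})}"

definition conj_section ::
    "('g, 'x) gset \<Rightarrow> 'g \<Rightarrow> 'x \<times> 'g set \<times> 'g set \<Rightarrow> 'x \<times> 'g set \<times> 'g set" where
  "conj_section A g = (\<lambda>(x, S, N). (act A g x, conj_by (grp A) g ` S, conj_by (grp A) g ` N))"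

abbreviation section_rel where
  "section_rel K A \<equiv> act_rel (carrier (grp A)) (conj_section A) (sections K A)"

lemma (in group) conj_by_one [simp]: "x \<in> carrier G \<Longrightarrow> conj_by G \<one> x = x"
  by (simp add: conj_by_def)

lemma (in group) conj_by_mult:
  "g \<in> carrier G \<Longrightarrow> h \<in> carrier G \<Longrightarrow> x \<in> carrier G \<Longrightarrow>
    conj_by G (g \<otimes> h) x = conj_by G g (conj_by G h x)"
  by (simp add: conj_by_def inv_mult_group m_assoc)

lemma (in group) conj_by_closed [simp]:
  "g \<in> carrier G \<Longrightarrow> x \<in> carrier G \<Longrightarrow> conj_by G g x \<in> carrier G"
  by (simp add: conj_by_def)

lemma (in group) conj_by_inv [simp]:
  assumes "g \<in> carrier G" "x \<in> carrier G"
  shows "conj_by G (inv g) (conj_by G g x) = x" "conj_by G g (conj_by G (inv g) x) = x"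
  using assms conj_by_mult[of "inv g" g x] conj_by_mult[of g "inv g" x] by auto

lemma (in group) conj_by_hom:
  assumes "g \<in> carrier G" "x \<in> carrier G" "y \<in> carrier G"
  shows "conj_by G g (x \<otimes> y) = conj_by G g x \<otimes> conj_by G g y"
proof -
  have "inv g \<otimes> (g \<otimes> z) = z" if "z \<in> carrier G" for z
    using assms(1) that by (simp flip: m_assoc)
  with assms show ?thesis by (simp add: conj_by_def m_assoc)
qed

lemma (in group) conj_by_subgroup:
  assumes "subgroup S G" "g \<in> S"
  shows "conj_by G g ` S = S"
proof -
  interpret S: subgroup S G by fact
  have "conj_by G h s \<in> S" if "h \<in> S" "s \<in> S" for h s
    using that by (simp add: conj_by_def)
  moreover have "s \<in> conj_by G g ` S" if "s \<in> S" for s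
    using that assms(2) calculation[of "inv g" s] by (intro image_eqI[where x = "conj_by G (inv g) s"]) auto
  ultimately show ?thesis
    using assms(2) by blast
qed

lemma (in fin_gset) sectionsD:
  assumes "(x, S, N) \<in> sections K A"
  shows "x \<in> pts A" "subgroup S (grp A)" "N \<subseteq> S"
    and "s \<in> S \<Longrightarrow> act A s x = x"
    and "s \<in> S \<Longrightarrow> s \<in> carrier (grp A)"
  using assms subgroup.subset by (fastforce simp: sections_def stabilizer_def)+

lemma (in fin_gset) sections_kernel:
  assumes "group K" and "(x, S, N) \<in> sections K A"
  shows "subgroup N (grp A)" and "g \<in> S \<Longrightarrow> conj_by (grp A) g ` N = N"
proof -
  note D = sectionsD[OF assms(2)]
  interpret S: subgroup S "grp A" by (rule D)
  obtain \<theta> where \<theta>: "\<theta> \<in> hom (grp A\<lparr>carrier := S\<rparr>) K" "N = {s\<in>S. \<theta> s = \<one>\<^bsub>K\<^esub>}"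
    using assms by (auto simp: sections_def)
  interpret \<theta>: group_hom "grp A\<lparr>carrier := S\<rparr>" K \<theta>
    using assms \<theta> grp.subgroup_imp_group[OF D(2)]
    by (simp add: group_hom_def group_hom_axioms_def)
  have mult: "\<theta> (s \<otimes>\<^bsub>grp A\<^esub> t) = \<theta> s \<otimes>\<^bsub>K\<^esub> \<theta> t" if "s \<in> S" "t \<in> S" for s t
    using \<theta>.hom_mult that by simp
  have inv: "\<theta> (inv\<^bsub>grp A\<^esub> s) = inv\<^bsub>K\<^esub> (\<theta> s)" if "s \<in> S" for s
    using \<theta>.hom_inv[of s] that grp.m_inv_consistent[OF D(2)] by simp
  have one: "\<theta> \<one>\<^bsub>grp A\<^esub> = \<one>\<^bsub>K\<^esub>"
    using \<theta>.hom_one by simp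
  have closed: "\<theta> s \<in> carrier K" if "s \<in> S" for s
    using \<theta>.hom_closed that by simp
  show "subgroup N (grp A)"
    by (rule grp.subgroupI) (auto simp: \<theta>(2) mult inv one intro!: exI[of _ "\<one>\<^bsub>grp A\<^esub>"])
  have *: "conj_by (grp A) g s \<in> N" if "g \<in> S" "s \<in> N" for g s
    using that by (auto simp: \<theta>(2) conj_by_def mult inv closed)
  show "conj_by (grp A) g ` N = N" if g: "g \<in> S"
  proof
    show "conj_by (grp A) g ` N \<subseteq> N" using * g by blast
    show "N \<subseteq> conj_by (grp A) g ` N"
    proof
      fix s assume "s \<in> N"
      then show "s \<in> conj_by (grp A) g ` N"
        using g *[of "inv\<^bsub>grp A\<^esub> g" s] D(3)
        by (intro image_eqI[where x = "conj_by (grp A) (inv\<^bsub>grp A\<^esub> g) s"]) auto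
    qed
  qed
qed

text \<open>S fixes x and normalizes itself and N. For this reason the section transported along a
  point of a span does not change when the point is moved by N.\<close>

lemma (in fin_gset) conj_section_fixed:
  assumes "group K" and "(x, S, N) \<in> sections K A" and "g \<in> S"
  shows "conj_section A g (x, S, N) = (x, S, N)"
  using sections_kernel(2)[OF assms] sectionsD[OF assms(2)] assms(3) grp.conj_by_subgroup
  by (simp add: conj_section_def)

lemma (in fin_gset) conj_section_one:
  assumes "s \<in> sections K A"
  shows "conj_section A \<one>\<^bsub>grp A\<^esub> s = s"
proof -
  obtain x S N where s: "s = (x, S, N)" by (cases s)
  note D = sectionsD[OF assms[unfolded s]]
  have "conj_by (grp A) \<one>\<^bsub>grp A\<^esub> ` M = M" if "M \<subseteq> S" for M
    using D(5) that by (subst image_cong[where g = id]) auto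
  with D(1,3) show ?thesis by (simp add: s conj_section_def)
qed

lemma (in fin_gset) conj_section_mult:
  assumes "s \<in> sections K A" "g \<in> carrier (grp A)" "h \<in> carrier (grp A)"
  shows "conj_section A (g \<otimes>\<^bsub>grp A\<^esub> h) s = conj_section A g (conj_section A h s)"
proof -
  obtain x S N where s: "s = (x, S, N)" by (cases s)
  note D = sectionsD[OF assms(1)[unfolded s]]
  have "conj_by (grp A) (g \<otimes>\<^bsub>grp A\<^esub> h) ` M = conj_by (grp A) g ` conj_by (grp A) h ` M"
    if "M \<subseteq> S" for M
    unfolding image_image using D(5) that assms(2,3)
    by (intro image_cong) (auto simp: grp.conj_by_mult subset_iff)
  with D(1,3) assms(2,3) show ?thesis by (simp add: s conj_section_def act_mult)
qed

lemma (in fin_gset) equiv_section_rel: "equiv (sections K A) (section_rel K A)"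
  by (rule equiv_act_rel[OF grp.is_group grp.subgroup_self])
    (auto simp: conj_section_one conj_section_mult)

lemma (in fin_gset) finite_sections: "finite (sections K A)"
proof (rule finite_subset)
  show "sections K A \<subseteq> pts A \<times> Pow (carrier (grp A)) \<times> Pow (carrier (grp A))"
    using sectionsD subgroup.subset by fastforce
  show "finite (pts A \<times> Pow (carrier (grp A)) \<times> Pow (carrier (grp A)))"
    using finite_pts finite_carrier by simp
qed

subsection \<open>Transport of sections along spans\<close>

text \<open>For the stabilizer \<open>D\<close> of a point \<open>u\<close> of an \<open>(H, G)\<close>-biset this says that the
  \<open>H\<close>-orbit of \<open>u N\<close> in \<open>U/N\<close> contains the whole of \<open>u S\<close> and that \<open>S/N\<close> acts freely on it.
  Such points are the ones that transport the section \<open>(S, N)\<close> of \<open>G\<close> to a section of \<open>H\<close> with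
  the same quotient.\<close>

definition transports ::
    "('h, 'm) monoid_scheme \<Rightarrow> ('g, 'n) monoid_scheme \<Rightarrow> ('h \<times> 'g) set \<Rightarrow> 'g set \<Rightarrow> 'g set \<Rightarrow> bool" where
  "transports H G D S N \<longleftrightarrow>
     (\<forall>g\<in>S. \<exists>h. \<exists>n\<in>N. (h, g \<otimes>\<^bsub>G\<^esub> n) \<in> D) \<and> (\<forall>g\<in>S. (\<one>\<^bsub>H\<^esub>, g) \<in> D \<longrightarrow> g \<in> N)"

text \<open>A subgroup of the product, such as the stabilizer of a point of a biset, is read as a
  relation between H and G. Transport of subgroups is then the image under the converse relation,
  and composition of bisets becomes \<open>O\<close> on stabilizers.\<close>

locale group_rel = H: group H + G: group G
  for H :: "('h, 'm) monoid_scheme" and G :: "('g, 'n) monoid_scheme" +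
  fixes D :: "('h \<times> 'g) set"
  assumes subgroup_rel: "subgroup D (H \<times>\<times> G)"
begin

lemma rel_closed: "(h, g) \<in> D \<Longrightarrow> h \<in> carrier H" "(h, g) \<in> D \<Longrightarrow> g \<in> carrier G"
  using subgroup.subset[OF subgroup_rel] by auto

lemma rel_one: "(\<one>\<^bsub>H\<^esub>, \<one>\<^bsub>G\<^esub>) \<in> D"
  using subgroup.one_closed[OF subgroup_rel] by simp

lemma rel_mult: "(h, g) \<in> D \<Longrightarrow> (h', g') \<in> D \<Longrightarrow> (h \<otimes>\<^bsub>H\<^esub> h', g \<otimes>\<^bsub>G\<^esub> g') \<in> D"
  using subgroup.m_closed[OF subgroup_rel] by fastforce

lemma rel_inv: "(h, g) \<in> D \<Longrightarrow> (inv\<^bsub>H\<^esub> h, inv\<^bsub>G\<^esub> g) \<in> D"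
  using subgroup.m_inv_closed[OF subgroup_rel, of "(h, g)"] rel_closed[of h g]
  by (simp add: H.is_group G.is_group)

lemma rel_inv_mult:
  "(h, g) \<in> D \<Longrightarrow> (h', g') \<in> D \<Longrightarrow> (inv\<^bsub>H\<^esub> h \<otimes>\<^bsub>H\<^esub> h', inv\<^bsub>G\<^esub> g \<otimes>\<^bsub>G\<^esub> g') \<in> D"
  by (intro rel_mult rel_inv)

lemma subgroup_preimage:
  assumes "subgroup S G"
  shows "subgroup (D\<inverse> `` S) H"
proof (rule H.subgroupI)
  interpret S: subgroup S G by fact
  show "D\<inverse> `` S \<subseteq> carrier H" using rel_closed by auto
  show "D\<inverse> `` S \<noteq> {}" using rel_one S.one_closed by blast
  show "inv\<^bsub>H\<^esub> h \<in> D\<inverse> `` S" if "h \<in> D\<inverse> `` S" for h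
    using that rel_inv S.m_inv_closed by blast
  show "h \<otimes>\<^bsub>H\<^esub> h' \<in> D\<inverse> `` S" if "h \<in> D\<inverse> `` S" "h' \<in> D\<inverse> `` S" for h h'
    using that rel_mult S.m_closed by blast
qed

text \<open>Send h to the value of \<theta> at any partner g of h in S. Two partners of the same h
  differ by an element of S related to 1, which freeness puts into N; the map is onto because every
  coset g N contains a partner of some h.\<close>

lemma preimage_quotient:
  assumes S: "subgroup S G" and K: "group K"
    and \<theta>: "\<theta> \<in> hom (G\<lparr>carrier := S\<rparr>) K" "\<theta> ` S = carrier K" "N = {s\<in>S. \<theta> s = \<one>\<^bsub>K\<^esub>}"
    and tr: "transports H G D S N"
  shows "\<exists>\<theta>'\<in>hom (H\<lparr>carrier := D\<inverse> `` S\<rparr>) K. \<theta>' ` (D\<inverse> `` S) = carrier K \<and>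
    D\<inverse> `` N = {h\<in>D\<inverse> `` S. \<theta>' h = \<one>\<^bsub>K\<^esub>}"
proof -
  interpret K: group K by fact
  interpret S: subgroup S G by fact
  interpret \<theta>: group_hom "G\<lparr>carrier := S\<rparr>" K \<theta>
    using \<theta> G.subgroup_imp_group[OF S] K by (simp add: group_hom_def group_hom_axioms_def)
  have mult: "\<theta> (s \<otimes>\<^bsub>G\<^esub> t) = \<theta> s \<otimes>\<^bsub>K\<^esub> \<theta> t" if "s \<in> S" "t \<in> S" for s t
    using \<theta>.hom_mult that by simp
  have inv: "\<theta> (inv\<^bsub>G\<^esub> s) = inv\<^bsub>K\<^esub> (\<theta> s)" if "s \<in> S" for s
    using \<theta>.hom_inv[of s] that G.m_inv_consistent[OF S] by simp
  have closed: "\<theta> s \<in> carrier K" if "s \<in> S" for s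
    using \<theta>.hom_closed that by simp
  have eq: "\<theta> g = \<theta> g'" if g: "(h, g) \<in> D" "(h, g') \<in> D" "g \<in> S" "g' \<in> S" for h g g'
  proof -
    have "(\<one>\<^bsub>H\<^esub>, inv\<^bsub>G\<^esub> g \<otimes>\<^bsub>G\<^esub> g') \<in> D"
      using rel_inv_mult[OF g(1,2)] rel_closed[OF g(1)] by simp
    then have "inv\<^bsub>G\<^esub> g \<otimes>\<^bsub>G\<^esub> g' \<in> N"
      using tr g unfolding transports_def by blast
    then have "inv\<^bsub>K\<^esub> (\<theta> g) \<otimes>\<^bsub>K\<^esub> \<theta> g' = \<one>\<^bsub>K\<^esub>"
      using g by (simp add: \<theta>(3) mult inv)
    then show ?thesis
      using closed g K.inv_equality K.inv_inv K.inv_closed by metis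
  qed
  define \<theta>' where "\<theta>' h = \<theta> (SOME g. g \<in> S \<and> (h, g) \<in> D)" for h
  have \<theta>': "\<theta>' h = \<theta> g" if "(h, g) \<in> D" "g \<in> S" for h g
  proof -
    have "(SOME g. g \<in> S \<and> (h, g) \<in> D) \<in> S \<and> (h, SOME g. g \<in> S \<and> (h, g) \<in> D) \<in> D"
      using that by (intro someI[of "\<lambda>g. g \<in> S \<and> (h, g) \<in> D"]) blast
    then show ?thesis
      unfolding \<theta>'_def using that by (intro eq) auto
  qed
  show ?thesis
  proof (intro bexI[of _ \<theta>'] conjI)
    show "\<theta>' \<in> hom (H\<lparr>carrier := D\<inverse> `` S\<rparr>) K"
    proof (rule homI)
      show "\<theta>' h \<in> carrier K" if "h \<in> carrier (H\<lparr>carrier := D\<inverse> `` S\<rparr>)" for h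
        using that closed \<theta>' by auto
      show "\<theta>' (h \<otimes>\<^bsub>H\<lparr>carrier := D\<inverse> `` S\<rparr>\<^esub> h') = \<theta>' h \<otimes>\<^bsub>K\<^esub> \<theta>' h'"
        if "h \<in> carrier (H\<lparr>carrier := D\<inverse> `` S\<rparr>)" "h' \<in> carrier (H\<lparr>carrier := D\<inverse> `` S\<rparr>)" for h h'
      proof -
        obtain g g' where "g \<in> S" "(h, g) \<in> D" "g' \<in> S" "(h', g') \<in> D"
          using \<open>h \<in> _\<close> \<open>h' \<in> _\<close> by auto
        then show ?thesis
          using \<theta>'[OF rel_mult[of h g h' g']] by (simp add: \<theta>' mult)
      qed
    qed
    show "\<theta>' ` (D\<inverse> `` S) = carrier K"
    proof
      show "\<theta>' ` (D\<inverse> `` S) \<subseteq> carrier K"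
        using closed \<theta>' by auto
      show "carrier K \<subseteq> \<theta>' ` (D\<inverse> `` S)"
      proof
        fix k assume "k \<in> carrier K"
        then obtain g where g: "g \<in> S" "k = \<theta> g" using \<theta>(2) by auto
        then obtain h n where n: "n \<in> N" "(h, g \<otimes>\<^bsub>G\<^esub> n) \<in> D"
          using tr unfolding transports_def by blast
        then have "\<theta>' h = k"
          using g \<theta>'[OF n(2)] by (simp add: \<theta>(3) mult closed)
        then show "k \<in> \<theta>' ` (D\<inverse> `` S)"
          using n g \<theta>(3) by blast
      qed
    qed
    show "D\<inverse> `` N = {h\<in>D\<inverse> `` S. \<theta>' h = \<one>\<^bsub>K\<^esub>}"
      using \<theta>' by (auto simp: \<theta>(3))
  qed
qed

text \<open>What collapses or is cut down at the first step is not restored at the second, and what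
  the second step loses is lost for the composite. This equivalence is the reason why the matrices
  of spans are multiplicative.\<close>

lemma transports_relcomp_iff:
  assumes "group_rel L H E" and S: "subgroup S G" and N: "subgroup N G" "N \<subseteq> S"
  shows "transports L G (E O D) S N \<longleftrightarrow>
    transports H G D S N \<and> transports L H E (D\<inverse> `` S) (D\<inverse> `` N)"
    (is "?comp \<longleftrightarrow> ?D \<and> ?E")
proof -
  interpret E: group_rel L H E by fact
  interpret S: subgroup S G by fact
  interpret N: subgroup N G by fact
  \<comment> \<open>Partners of two elements of one coset g N differ by an element of the
    transported normal subgroup.\<close>
  have cancel: "inv\<^bsub>H\<^esub> h \<otimes>\<^bsub>H\<^esub> h' \<in> D\<inverse> `` N"
    if "(h, g) \<in> D" "(h', g \<otimes>\<^bsub>G\<^esub> n) \<in> D" "n \<in> N" for h h' g n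
  proof -
    have "inv\<^bsub>G\<^esub> g \<otimes>\<^bsub>G\<^esub> (g \<otimes>\<^bsub>G\<^esub> n) = n"
      using rel_closed[OF that(1)] that(3) by (simp flip: G.m_assoc)
    then show ?thesis
      using rel_inv_mult[OF that(1,2)] that(3) by auto
  qed
  show ?thesis
  proof (intro iffI conjI)
    assume comp: ?comp
    show ?D
      \<comment> \<open>Since (1, 1) lies in E, every pair (1, g) of D stays in the composite, so D
        inherits freeness from it.\<close>
      using comp E.rel_one unfolding transports_def by blast
    show ?E
      unfolding transports_def
    proof (intro conjI ballI impI)
      fix h assume "h \<in> D\<inverse> `` S"
      then obtain g where g: "g \<in> S" "(h, g) \<in> D" by auto
      then obtain k n h' where *: "n \<in> N" "(k, h') \<in> E" "(h', g \<otimes>\<^bsub>G\<^esub> n) \<in> D"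
        using comp unfolding transports_def by blast
      then have "h \<otimes>\<^bsub>H\<^esub> (inv\<^bsub>H\<^esub> h \<otimes>\<^bsub>H\<^esub> h') = h'"
        using rel_closed g by (simp flip: H.m_assoc)
      then show "\<exists>k. \<exists>n\<in>D\<inverse> `` N. (k, h \<otimes>\<^bsub>H\<^esub> n) \<in> E"
        using cancel[OF g(2) *(3,1)] *(2) by metis
    next
      fix h assume "h \<in> D\<inverse> `` S" and h: "(\<one>\<^bsub>L\<^esub>, h) \<in> E"
      then obtain g where g: "g \<in> S" "(h, g) \<in> D" by auto
      then have "g \<in> N"
        using comp h unfolding transports_def by blast
      with g show "h \<in> D\<inverse> `` N" by blast
    qed
  next
    assume DE: "?D \<and> ?E"
    show ?comp
      unfolding transports_def
    proof (intro conjI ballI impI)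
      fix g assume g: "g \<in> S"
      then obtain h n where h: "n \<in> N" "(h, g \<otimes>\<^bsub>G\<^esub> n) \<in> D"
        using DE unfolding transports_def by blast
      then have "h \<in> D\<inverse> `` S"
        using g N by blast
      then obtain k m where k: "m \<in> D\<inverse> `` N" "(k, h \<otimes>\<^bsub>H\<^esub> m) \<in> E"
        using DE unfolding transports_def by blast
      then obtain n' where n': "n' \<in> N" "(m, n') \<in> D" by auto
      have "(h \<otimes>\<^bsub>H\<^esub> m, g \<otimes>\<^bsub>G\<^esub> (n \<otimes>\<^bsub>G\<^esub> n')) \<in> D"
        using rel_mult[OF h(2) n'(2)] g h n' by (simp add: G.m_assoc)
      then show "\<exists>k. \<exists>n\<in>N. (k, g \<otimes>\<^bsub>G\<^esub> n) \<in> E O D"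
        using k h n' N.m_closed by blast
    next
      fix g assume g: "g \<in> S" "(\<one>\<^bsub>L\<^esub>, g) \<in> E O D"
      then obtain h where h: "(\<one>\<^bsub>L\<^esub>, h) \<in> E" "(h, g) \<in> D" by auto
      then have "h \<in> D\<inverse> `` N"
        using DE g unfolding transports_def by blast
      then obtain n where n: "n \<in> N" "(h, n) \<in> D" by auto
      have "(\<one>\<^bsub>H\<^esub>, inv\<^bsub>G\<^esub> n \<otimes>\<^bsub>G\<^esub> g) \<in> D"
        using rel_inv_mult[OF n(2) h(2)] rel_closed[OF h(2)] by simp
      then have "inv\<^bsub>G\<^esub> n \<otimes>\<^bsub>G\<^esub> g \<in> N"
        using DE g n N unfolding transports_def by blast
      then have "n \<otimes>\<^bsub>G\<^esub> (inv\<^bsub>G\<^esub> n \<otimes>\<^bsub>G\<^esub> g) \<in> N"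
        using n by blast
      then show "g \<in> N"
        using n g by (simp flip: G.m_assoc)
    qed
  qed
qed

lemma preimage_conj:
  assumes "h \<in> carrier H" "g \<in> carrier G" "S \<subseteq> carrier G"
  shows "(map_prod (conj_by H h) (conj_by G g) ` D)\<inverse> `` (conj_by G g ` S) =
    conj_by H h ` (D\<inverse> `` S)"
proof -
  have key: "q = s" if "conj_by G g q = conj_by G g s" "(p, q) \<in> D" "s \<in> S" for p q s
    using that assms G.conj_by_inv(1)[of g] rel_closed(2)[of p q] by (metis subsetD)
  show ?thesis
  proof (intro equalityI subsetI)
    fix p' assume "p' \<in> (map_prod (conj_by H h) (conj_by G g) ` D)\<inverse> `` (conj_by G g ` S)"
    then obtain p q s where "(p, q) \<in> D" "p' = conj_by H h p" "s \<in> S" "conj_by G g q = conj_by G g s"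
      by auto
    then show "p' \<in> conj_by H h ` (D\<inverse> `` S)"
      using key by blast
  next
    fix p' assume "p' \<in> conj_by H h ` (D\<inverse> `` S)"
    then obtain p s where *: "(p, s) \<in> D" "s \<in> S" "p' = conj_by H h p" by auto
    then have "(p', conj_by G g s) \<in> map_prod (conj_by H h) (conj_by G g) ` D"
      by (auto intro: image_eqI[where x = "(p, s)"])
    with * show "p' \<in> (map_prod (conj_by H h) (conj_by G g) ` D)\<inverse> `` (conj_by G g ` S)"
      by blast
  qed
qed

lemma transports_conj:
  assumes hg: "h \<in> carrier H" "g \<in> carrier G" and "S \<subseteq> carrier G" "N \<subseteq> carrier G"
    and tr: "transports H G D S N"
  shows "transports H G (map_prod (conj_by H h) (conj_by G g) ` D)
    (conj_by G g ` S) (conj_by G g ` N)"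
  unfolding transports_def
proof (intro conjI ballI impI)
  fix t assume "t \<in> conj_by G g ` S"
  then obtain s where s: "s \<in> S" "t = conj_by G g s" by auto
  then obtain p n where n: "n \<in> N" "(p, s \<otimes>\<^bsub>G\<^esub> n) \<in> D"
    using tr unfolding transports_def by blast
  have "t \<otimes>\<^bsub>G\<^esub> conj_by G g n = conj_by G g (s \<otimes>\<^bsub>G\<^esub> n)"
    using s n assms by (auto simp: G.conj_by_hom subset_iff)
  then show "\<exists>p. \<exists>n\<in>conj_by G g ` N.
      (p, t \<otimes>\<^bsub>G\<^esub> n) \<in> map_prod (conj_by H h) (conj_by G g) ` D"
    using n by (intro exI[of _ "conj_by H h p"] bexI[of _ "conj_by G g n"])
      (auto intro: image_eqI[where x = "(p, s \<otimes>\<^bsub>G\<^esub> n)"])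
next
  fix t assume "t \<in> conj_by G g ` S"
    and t: "(\<one>\<^bsub>H\<^esub>, t) \<in> map_prod (conj_by H h) (conj_by G g) ` D"
  then obtain s where s: "s \<in> S" "t = conj_by G g s" by auto
  obtain p q where pq: "(p, q) \<in> D" "\<one>\<^bsub>H\<^esub> = conj_by H h p" "t = conj_by G g q"
    using t by auto
  have "p = \<one>\<^bsub>H\<^esub>"
    using H.conj_by_inv(1)[OF hg(1), of p] rel_closed(1)[OF pq(1)] pq(2)[symmetric] hg
    by (simp add: conj_by_def)
  moreover have "q = s"
    using G.conj_by_inv(1)[OF hg(2)] rel_closed(2)[OF pq(1)] pq(3) s assms by (metis subsetD)
  ultimately show "t \<in> conj_by G g ` N"
    using tr s pq unfolding transports_def by blast
qed

end

section \<open>Transported sections and the coefficients of a span\<close>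

definition stab :: "('c, 's, 'z) gset_over \<Rightarrow> 's \<Rightarrow> 'c set" where
  "stab V = stabilizer (grp (fst V)) (act (fst V))"

definition transport_section ::
    "('h, 'g, 'u, 'y, 'x) span \<Rightarrow> 'u \<Rightarrow> 'x \<times> 'g set \<times> 'g set \<Rightarrow> 'y \<times> 'h set \<times> 'h set" where
  "transport_section V u = (\<lambda>(x, S, N). (fst (snd V u), (stab V u)\<inverse> `` S, (stab V u)\<inverse> `` N))"

text \<open>\<open>O'\<close> is usually a class of sections. The full set
  \<open>sections K B\<close> is allowed as well and imposes nothing when the given triple is a
  section with quotient K.\<close>

definition transport_pts ::
    "('h, 'y) gset \<Rightarrow> ('g, 'x) gset \<Rightarrow> ('h, 'g, 'u, 'y, 'x) span \<Rightarrow> 'x \<times> 'g set \<times> 'g set \<Rightarrow>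
     ('y \<times> 'h set \<times> 'h set) set \<Rightarrow> 'u set" where
  "transport_pts B A V = (\<lambda>(x, S, N) O'. {u\<in>pts (fst V). snd (snd V u) = x \<and>
     transports (grp B) (grp A) (stab V u) S N \<and> transport_section V u (x, S, N) \<in> O'})"

text \<open>Orbits under the group of B times N are the orbits of the group of B on the quotient of
  the span by the right action of N.\<close>

definition transport_rel ::
    "('h, 'y) gset \<Rightarrow> ('g, 'x) gset \<Rightarrow> ('h, 'g, 'u, 'y, 'x) span \<Rightarrow> 'x \<times> 'g set \<times> 'g set \<Rightarrow>
     ('y \<times> 'h set \<times> 'h set) set \<Rightarrow> ('u \<times> 'u) set" where
  "transport_rel B A V s O' =
     act_rel (carrier (grp B) \<times> snd (snd s)) (act (fst V)) (transport_pts B A V s O')"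

text \<open>A matrix entry. The row is given by a section and the column by a class; by
  \<open>coef_conj\<close> only the class of the section matters.\<close>

definition coef ::
    "('h, 'y) gset \<Rightarrow> ('g, 'x) gset \<Rightarrow> ('h, 'g, 'u, 'y, 'x) span \<Rightarrow> 'x \<times> 'g set \<times> 'g set \<Rightarrow>
     ('y \<times> 'h set \<times> 'h set) set \<Rightarrow> nat" where
  "coef B A V s O' = card (transport_pts B A V s O' // transport_rel B A V s O')"

locale span = B: fin_gset B + A: fin_gset A
  for B :: "('h, 'y) gset" and A :: "('g, 'x) gset" +
  fixes V :: "('h, 'g, 'u, 'y, 'x) span"
  assumes gset_over: "gset_over (prod_gset B A) V"
begin

sublocale V: fin_gset "fst V"
  using gset_over by unfold_locales (simp add: gset_over_def)

lemma grp_V: "grp (fst V) = grp B \<times>\<times> grp A"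
  using gset_over by (simp add: gset_over_def prod_gset_def)

lemma legs_closed:
  assumes "u \<in> pts (fst V)"
  shows "fst (snd V u) \<in> pts B" "snd (snd V u) \<in> pts A"
  using gset_over assms by (auto simp: gset_over_def gset_hom_def prod_gset_def Pi_iff mem_Times_iff)

lemma leg_act:
  assumes "u \<in> pts (fst V)" "h \<in> carrier (grp B)" "g \<in> carrier (grp A)"
  shows "snd V (act (fst V) (h, g) u) = (act B h (fst (snd V u)), act A g (snd (snd V u)))"
proof -
  have "snd V (act (fst V) (h, g) u) = act (prod_gset B A) (h, g) (snd V u)"
    using gset_over assms grp_V by (auto simp: gset_over_def gset_hom_def)
  also have "\<dots> = (act B h (fst (snd V u)), act A g (snd (snd V u)))"
    using legs_closed[OF assms(1)] by (simp add: prod_gset_def case_prod_beta mem_Times_iff)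
  finally show ?thesis .
qed

lemma act_one' [simp]:
  "u \<in> pts (fst V) \<Longrightarrow> act (fst V) (\<one>\<^bsub>grp B\<^esub>, \<one>\<^bsub>grp A\<^esub>) u = u"
  using V.act_one by (simp add: grp_V)

lemma act_closed' [simp]:
  "u \<in> pts (fst V) \<Longrightarrow> h \<in> carrier (grp B) \<Longrightarrow> g \<in> carrier (grp A) \<Longrightarrow>
    act (fst V) (h, g) u \<in> pts (fst V)"
  using V.act_closed by (simp add: grp_V)

lemma act_mult':
  assumes "u \<in> pts (fst V)" "h \<in> carrier (grp B)" "g \<in> carrier (grp A)"
    "h' \<in> carrier (grp B)" "g' \<in> carrier (grp A)"
  shows "act (fst V) (h, g) (act (fst V) (h', g') u) =
    act (fst V) (h \<otimes>\<^bsub>grp B\<^esub> h', g \<otimes>\<^bsub>grp A\<^esub> g') u"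
  using V.act_mult[of u "(h, g)" "(h', g')"] assms by (simp add: grp_V)

lemma stab_iff:
  "(h, g) \<in> stab V u \<longleftrightarrow>
    h \<in> carrier (grp B) \<and> g \<in> carrier (grp A) \<and> act (fst V) (h, g) u = u"
  by (auto simp: stab_def stabilizer_def grp_V)

lemma group_rel_stab:
  assumes "u \<in> pts (fst V)"
  shows "group_rel (grp B) (grp A) (stab V u)"
  using V.stabilizer_subgroup[OF assms] grp_V B.grp.is_group A.grp.is_group
  by (simp add: group_rel_def group_rel_axioms_def stab_def)

lemma transport_section_in_sections:
  assumes K: "group K" and s: "(x, S, N) \<in> sections K A"
    and u: "u \<in> pts (fst V)" "transports (grp B) (grp A) (stab V u) S N"
  shows "transport_section V u (x, S, N) \<in> sections K B"
proof -
  interpret D: group_rel "grp B" "grp A" "stab V u"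
    by (rule group_rel_stab) fact
  note sD = A.sectionsD[OF s]
  have "act B h (fst (snd V u)) = fst (snd V u)" if "(h, g) \<in> stab V u" for h g
    using leg_act[OF u(1), of h g] that fst_conv unfolding stab_iff by metis
  then have "(stab V u)\<inverse> `` S \<subseteq> stabilizer (grp B) (act B) (fst (snd V u))"
    by (auto simp: stabilizer_def stab_iff)
  moreover have "\<exists>\<theta>'\<in>hom (grp B\<lparr>carrier := (stab V u)\<inverse> `` S\<rparr>) K.
      \<theta>' ` ((stab V u)\<inverse> `` S) = carrier K \<and>
      (stab V u)\<inverse> `` N = {h\<in>(stab V u)\<inverse> `` S. \<theta>' h = \<one>\<^bsub>K\<^esub>}"
    using s D.preimage_quotient[OF sD(2) K _ _ _ u(2)] by (auto simp: sections_def)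
  ultimately show ?thesis
    using legs_closed[OF u(1)] D.subgroup_preimage[OF sD(2)]
    by (simp add: transport_section_def sections_def)
qed

lemma stab_act:
  assumes u: "u \<in> pts (fst V)" and hg: "h \<in> carrier (grp B)" "g \<in> carrier (grp A)"
  shows "stab V (act (fst V) (h, g) u) =
    map_prod (conj_by (grp B) h) (conj_by (grp A) g) ` stab V u"
proof -
  \<comment> \<open>Stated for all points and group elements, because the opposite inclusion is this
    one for the moved point and the inverse elements.\<close>
  have sub: "map_prod (conj_by (grp B) h) (conj_by (grp A) g) ` stab V u \<subseteq>
      stab V (act (fst V) (h, g) u)"
    if u: "u \<in> pts (fst V)" and hg: "h \<in> carrier (grp B)" "g \<in> carrier (grp A)" for u h g
  proof
    fix c assume "c \<in> map_prod (conj_by (grp B) h) (conj_by (grp A) g) ` stab V u"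
    then obtain p q where pq: "c = (conj_by (grp B) h p, conj_by (grp A) g q)"
        "p \<in> carrier (grp B)" "q \<in> carrier (grp A)" "act (fst V) (p, q) u = u"
      by (auto simp: stab_iff)
    have "act (fst V) c (act (fst V) (h, g) u) = act (fst V) (h \<otimes>\<^bsub>grp B\<^esub> p, g \<otimes>\<^bsub>grp A\<^esub> q) u"
      using pq(2,3) u hg by (simp add: pq(1) act_mult' conj_by_def B.grp.m_assoc A.grp.m_assoc)
    also have "\<dots> = act (fst V) (h, g) (act (fst V) (p, q) u)"
      using pq u hg by (subst act_mult') auto
    finally show "c \<in> stab V (act (fst V) (h, g) u)"
      using pq hg by (simp add: stab_iff)
  qed
  show ?thesis
  proof
    show "stab V (act (fst V) (h, g) u) \<subseteq>
        map_prod (conj_by (grp B) h) (conj_by (grp A) g) ` stab V u"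
    proof (rule subrelI)
      fix p q assume pq: "(p, q) \<in> stab V (act (fst V) (h, g) u)"
      let ?h = "inv\<^bsub>grp B\<^esub> h" and ?g = "inv\<^bsub>grp A\<^esub> g"
      have "act (fst V) (?h, ?g) (act (fst V) (h, g) u) = u"
        using u hg by (simp add: act_mult')
      then have "(conj_by (grp B) ?h p, conj_by (grp A) ?g q) \<in> stab V u"
        using sub[of "act (fst V) (h, g) u" ?h ?g] pq u hg by force
      moreover have "conj_by (grp B) h (conj_by (grp B) ?h p) = p"
          "conj_by (grp A) g (conj_by (grp A) ?g q) = q"
        using pq hg by (auto simp: stab_iff)
      ultimately show "(p, q) \<in> map_prod (conj_by (grp B) h) (conj_by (grp A) g) ` stab V u"
        by (metis image_eqI map_prod_simp)
    qed
  qed (rule sub[OF u hg])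
qed

text \<open>The right action is absorbed by conjugating the given section, and the left action
  reappears as a conjugation of the result. Hence the class of the transported section depends only
  on the orbit of the point.\<close>

lemma transport_section_act:
  assumes K: "group K" and s: "(x, S, N) \<in> sections K A" and u: "u \<in> pts (fst V)"
    and hg: "h \<in> carrier (grp B)" "g \<in> carrier (grp A)"
  shows "transport_section V (act (fst V) (h, g) u) (conj_section A g (x, S, N)) =
      conj_section B h (transport_section V u (x, S, N))"
proof -
  interpret D: group_rel "grp B" "grp A" "stab V u"
    by (rule group_rel_stab) fact
  note sD = A.sectionsD[OF s]
  have "S \<subseteq> carrier (grp A)" "N \<subseteq> carrier (grp A)"
    using sD by blast+
  then show ?thesis
    using D.preimage_conj[OF hg] leg_act[OF u hg]
    by (simp add: transport_section_def conj_section_def stab_act u hg)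
qed

lemma transport_pts_act:
  assumes K: "group K" and s: "s \<in> sections K A"
    and u: "u \<in> transport_pts B A V s O'"
    and hg: "h \<in> carrier (grp B)" "g \<in> carrier (grp A)" "conj_section A g s \<in> sections K A"
    and O': "O' \<in> sections K B // section_rel K B"
  shows "act (fst V) (h, g) u \<in> transport_pts B A V (conj_section A g s) O'"
proof -
  obtain x S N where s': "s = (x, S, N)" by (cases s)
  have uV: "u \<in> pts (fst V)" "snd (snd V u) = x"
      "transports (grp B) (grp A) (stab V u) S N" "transport_section V u s \<in> O'"
    using u by (auto simp: s' transport_pts_def)
  interpret D: group_rel "grp B" "grp A" "stab V u"
    by (rule group_rel_stab) fact
  note sD = A.sectionsD[OF s[unfolded s']]
  have sub: "S \<subseteq> carrier (grp A)" "N \<subseteq> carrier (grp A)"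
    using sD by blast+
  have tr: "transports (grp B) (grp A) (stab V (act (fst V) (h, g) u))
      (conj_by (grp A) g ` S) (conj_by (grp A) g ` N)"
    using D.transports_conj[OF hg(1,2) sub uV(3)] by (simp add: stab_act uV(1) hg)
  note ts = transport_section_act[OF K s[unfolded s'] uV(1) hg(1,2), folded s']
  have "transport_section V u s \<in> sections K B"
    using transport_section_in_sections[OF K s[unfolded s'] uV(1,3)] s' by simp
  moreover have "transport_section V (act (fst V) (h, g) u) (conj_section A g s) \<in> sections K B"
    using hg(3) tr uV leg_act[OF uV(1) hg(1,2)] hg(1,2)
    by (auto simp: s' conj_section_def intro!: transport_section_in_sections[OF K])
  ultimately have "(transport_section V u s,
      transport_section V (act (fst V) (h, g) u) (conj_section A g s)) \<in> section_rel K B"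
    using ts hg by (intro act_relI[of _ _ _ h]) auto
  then have "transport_section V (act (fst V) (h, g) u) (conj_section A g s) \<in> O'"
    using in_quotient_imp_closed[OF B.equiv_section_rel O' uV(4)] by blast
  then show ?thesis
    using uV tr hg leg_act[OF uV(1) hg(1,2)]
    by (simp add: s' transport_pts_def conj_section_def)
qed

end

lemma transport_pts_subset: "transport_pts B A V s O' \<subseteq> pts (fst V)"
  by (cases s) (auto simp: transport_pts_def)

context span
begin

lemma equiv_transport_rel:
  assumes "group K" and "s \<in> sections K A"
  shows "equiv (transport_pts B A V s O') (transport_rel B A V s O')"
proof -
  obtain x S N where s: "s = (x, S, N)" by (cases s)
  have "subgroup (carrier (grp B) \<times> N) (grp B \<times>\<times> grp A)"
    using A.sections_kernel(1)[OF assms[unfolded s]] B.grp.is_group A.grp.is_group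
      B.grp.subgroup_self by (intro DirProd_subgroups)
  moreover have "N \<subseteq> carrier (grp A)"
    using A.sectionsD[OF assms(2)[unfolded s]] by blast
  ultimately show ?thesis
    unfolding transport_rel_def s
    by (intro equiv_act_rel[of "grp B \<times>\<times> grp A"])
      (auto simp: transport_pts_def act_mult' subset_iff DirProd_group B.grp.is_group A.grp.is_group)
qed

lemma finite_transport_pts: "finite (transport_pts B A V s O')"
  using V.finite_pts by (simp add: transport_pts_def case_prod_beta)

text \<open>Acting by (1, g) moves points over x to points over g x and turns N into its conjugate,
  so it matches the orbits counted for a section with those counted for its conjugate.\<close>

lemma coef_conj:
  assumes K: "group K" and ss': "(s, s') \<in> section_rel K A"
    and O': "O' \<in> sections K B // section_rel K B"
  shows "coef B A V s O' = coef B A V s' O'"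
proof -
  obtain g where g: "s \<in> sections K A" "s' \<in> sections K A" "g \<in> carrier (grp A)"
      "s' = conj_section A g s"
    using ss' by (rule act_relE)
  obtain x S N where s: "s = (x, S, N)" by (cases s)
  have N: "N \<subseteq> carrier (grp A)"
    using A.sectionsD[OF g(1)[unfolded s]] by blast
  let ?g = "inv\<^bsub>grp A\<^esub> g"
  let ?f = "act (fst V) (\<one>\<^bsub>grp B\<^esub>, g)"
  have conj_back: "conj_section A ?g s' = s"
    using A.conj_section_mult[OF g(1), of ?g g] A.conj_section_one[OF g(1)] g(3,4) by simp
  have P: "u \<in> pts (fst V)" if "u \<in> transport_pts B A V t O'" for u t
    using that transport_pts_subset by (rule subsetD[rotated])
  show ?thesis
    unfolding coef_def
  proof (rule card_quotient_eq[OF equiv_transport_rel[OF K g(1)] equiv_transport_rel[OF K g(2)], of ?f])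
    show f: "?f \<in> transport_pts B A V s O' \<rightarrow> transport_pts B A V s' O'"
      using transport_pts_act[OF K g(1) _ _ g(3) _ O'] g by simp
    show "(u, u') \<in> transport_rel B A V s O' \<longleftrightarrow> (?f u, ?f u') \<in> transport_rel B A V s' O'"
      if u: "u \<in> transport_pts B A V s O'" "u' \<in> transport_pts B A V s O'" for u u'
    proof -
      have inj: "inj_on ?f (pts (fst V))"
        using V.inj_prop g(3) by (simp add: grp_V)
      \<comment> \<open>Moving by (h, n) before \<open>?f\<close> amounts to moving by (h, g n g^-1)
        after it.\<close>
      have "?f u' = act (fst V) (h, conj_by (grp A) g n) (?f u) \<longleftrightarrow> u' = act (fst V) (h, n) u"
        if h: "h \<in> carrier (grp B)" and n: "n \<in> carrier (grp A)" for h n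
      proof -
        have "act (fst V) (h, conj_by (grp A) g n) (?f u) = ?f (act (fst V) (h, n) u)"
          using P[OF u(1)] h n g(3) by (simp add: act_mult' conj_by_def A.grp.m_assoc)
        then show ?thesis
          using inj_on_eq_iff[OF inj P[OF u(2)] act_closed'[OF P[OF u(1)] h n]] by simp
      qed
      then have "(\<exists>h\<in>carrier (grp B). \<exists>n\<in>N. ?f u' = act (fst V) (h, conj_by (grp A) g n) (?f u)) \<longleftrightarrow>
          (\<exists>h\<in>carrier (grp B). \<exists>n\<in>N. u' = act (fst V) (h, n) u)"
        using N by blast
      then show ?thesis
        using u f by (auto simp: transport_rel_def act_rel_def s g(4) conj_section_def Pi_iff)
    qed
    show "\<exists>u\<in>transport_pts B A V s O'. (?f u, u') \<in> transport_rel B A V s' O'"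
      if u': "u' \<in> transport_pts B A V s' O'" for u'
    proof (rule bexI)
      show "act (fst V) (\<one>\<^bsub>grp B\<^esub>, ?g) u' \<in> transport_pts B A V s O'"
        using transport_pts_act[OF K g(2) u' _ _ _ O', of "\<one>\<^bsub>grp B\<^esub>" ?g] conj_back g by simp
      have "?f (act (fst V) (\<one>\<^bsub>grp B\<^esub>, ?g) u') = u'"
        using P[OF u'] g(3) by (simp add: act_mult')
      then show "(?f (act (fst V) (\<one>\<^bsub>grp B\<^esub>, ?g) u'), u') \<in> transport_rel B A V s' O'"
        using equiv_transport_rel[OF K g(2)] u' by (simp add: equiv_def refl_on_def)
    qed
  qed
qed

text \<open>N fixes the given section and the group of B only conjugates the result. This permits
  sorting the orbits of points by the class of the transported section.\<close>

lemma transport_section_rel: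
  assumes K: "group K" and s: "s \<in> sections K A"
    and uu': "(u, u') \<in> transport_rel B A V s O'"
  shows "(transport_section V u s, transport_section V u' s) \<in> section_rel K B"
proof -
  obtain x S N where s': "s = (x, S, N)" by (cases s)
  note sD = A.sectionsD[OF s[unfolded s']]
  obtain c where c: "u \<in> transport_pts B A V s O'" "u' \<in> transport_pts B A V s O'"
      "c \<in> carrier (grp B) \<times> N" "u' = act (fst V) c u"
    using uu' unfolding transport_rel_def by (auto simp: s' elim: act_relE)
  then obtain h n where hn: "c = (h, n)" "h \<in> carrier (grp B)" "n \<in> N" by auto
  have n: "n \<in> S" "n \<in> carrier (grp A)"
    using hn(3) sD by blast+
  have "transport_section V u' s = conj_section B h (transport_section V u s)"
    using transport_section_act[OF K s[unfolded s'] _ hn(2) n(2), of u] c(1,4) hn(1)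
      A.conj_section_fixed[OF K s[unfolded s'] n(1)] by (simp add: s' transport_pts_def)
  moreover have "transport_section V w s \<in> sections K B" if "w \<in> transport_pts B A V s O'" for w
    using that s s' transport_section_in_sections[OF K] by (auto simp: transport_pts_def)
  ultimately show ?thesis
    using c(1,2) hn(2) by (intro act_relI[of _ _ _ h]) blast+
qed

end

lemma equiv_Restr:
  assumes "equiv P r" "Q \<subseteq> P"
  shows "equiv Q (Restr r Q)"
proof (rule equivI)
  show "refl_on Q (Restr r Q)"
    using assms by (auto simp: equiv_def refl_on_def)
  show "sym (Restr r Q)"
    using equivE[OF assms(1)] by (auto intro!: symI dest: symD)
  show "trans (Restr r Q)"
    using equivE[OF assms(1)] by (auto intro!: transI dest: transD)
qed auto

lemma gset_homD:
  assumes "f \<in> gset_hom A B"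
  shows "x \<in> pts A \<Longrightarrow> f x \<in> pts B"
    and "g \<in> carrier (grp A) \<Longrightarrow> x \<in> pts A \<Longrightarrow> f (act A g x) = act B g (f x)"
  using assms by (auto simp: gset_hom_def)

text \<open>Membership is decided by legs and stabilizers, and an injective equivariant map over the
  base preserves both. Isomorphisms and the inclusions of summands are covered together.\<close>

lemma transport_pts_embedding:
  assumes "span B A V" "span B A W" and f: "f \<in> gset_hom (fst V) (fst W)"
    and inj: "inj_on f (pts (fst V))"
    and legs: "\<And>u. u \<in> pts (fst V) \<Longrightarrow> snd W (f u) = snd V u"
    and u: "u \<in> pts (fst V)"
  shows "f u \<in> transport_pts B A W s O' \<longleftrightarrow> u \<in> transport_pts B A V s O'"
proof -
  interpret V: span B A V by fact
  interpret W: span B A W by fact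
  have "act (fst W) c (f u) = f u \<longleftrightarrow> act (fst V) c u = u" if "c \<in> carrier (grp (fst V))" for c
    using gset_homD(2)[OF f that u] inj u V.V.act_closed[OF that u] by (metis inj_onD)
  then have "stab W (f u) = stab V u"
    by (auto simp: stab_def stabilizer_def V.grp_V W.grp_V)
  then show ?thesis
    using u legs gset_homD(1)[OF f u]
    by (cases s) (simp add: transport_pts_def transport_section_def)
qed

text \<open>The count is expressed on the image inside W, because this is the form in which the two
  halves of a disjoint union show up in \<open>card_quotient_fibers\<close>.\<close>

lemma coef_embedding:
  assumes V: "span B A V" and W: "span B A W" and f: "f \<in> gset_hom (fst V) (fst W)"
    and inj: "inj_on f (pts (fst V))"
    and legs: "\<And>u. u \<in> pts (fst V) \<Longrightarrow> snd W (f u) = snd V u"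
    and K: "group K" and s: "s \<in> sections K A"
  shows "coef B A V s O' = card (f ` transport_pts B A V s O' //
    Restr (transport_rel B A W s O') (f ` transport_pts B A V s O'))"
proof -
  interpret V: span B A V by fact
  interpret W: span B A W by fact
  let ?P = "transport_pts B A V s O'"
  note P = transport_pts_subset[of B A V s O']
  have sub: "f ` ?P \<subseteq> transport_pts B A W s O'"
    using transport_pts_embedding[OF V W f inj legs] P by blast
  then have R: "Restr (transport_rel B A W s O') (f ` ?P) =
      act_rel (carrier (grp B) \<times> snd (snd s)) (act (fst W)) (f ` ?P)"
    by (simp add: transport_rel_def Restr_act_rel)
  have C: "c \<in> carrier (grp (fst V))" if "c \<in> carrier (grp B) \<times> snd (snd s)" for c
    using that V.A.sectionsD[of "fst s" "fst (snd s)" "snd (snd s)" K] s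
    by (auto simp: V.grp_V)
  show ?thesis
    unfolding coef_def
  proof (rule card_quotient_eq[OF V.equiv_transport_rel[OF K s]])
    show "equiv (f ` ?P) (Restr (transport_rel B A W s O') (f ` ?P))"
      by (rule equiv_Restr[OF W.equiv_transport_rel[OF K s] sub])
    show "(u, u') \<in> transport_rel B A V s O' \<longleftrightarrow>
        (f u, f u') \<in> Restr (transport_rel B A W s O') (f ` ?P)"
      if u: "u \<in> ?P" "u' \<in> ?P" for u u'
    proof -
      have "act (fst W) c (f u) = f (act (fst V) c u)" "act (fst V) c u \<in> pts (fst V)"
        if "c \<in> carrier (grp B) \<times> snd (snd s)" for c
        using gset_homD(2)[OF f C[OF that]] V.V.act_closed[OF C[OF that]] u P by auto
      then show ?thesis
        using inj_on_eq_iff[OF inj] u P unfolding R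
        by (simp add: transport_rel_def act_rel_def subset_iff)
    qed
    fix q assume "q \<in> f ` ?P"
    then show "\<exists>p\<in>?P. (f p, q) \<in> Restr (transport_rel B A W s O') (f ` ?P)"
      using W.equiv_transport_rel[OF K s, of O'] sub by (auto simp: equiv_def refl_on_def)
  qed auto
qed

lemma coef_iso:
  assumes V: "span B A V" and W: "span B A W" and iso: "iso_over V W"
    and K: "group K" and s: "s \<in> sections K A"
  shows "coef B A V s O' = coef B A W s O'"
proof -
  obtain f where f: "f \<in> gset_hom (fst V) (fst W)" "bij_betw f (pts (fst V)) (pts (fst W))"
      "\<And>u. u \<in> pts (fst V) \<Longrightarrow> snd W (f u) = snd V u"
    using iso by (auto simp: iso_over_def)
  have inj: "inj_on f (pts (fst V))" using f(2) by (simp add: bij_betw_def)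
  have "f ` transport_pts B A V s O' = transport_pts B A W s O'"
  proof (intro equalityI subsetI)
    fix w assume w: "w \<in> transport_pts B A W s O'"
    then obtain u where "u \<in> pts (fst V)" "w = f u"
      using f(2) subsetD[OF transport_pts_subset w] by (auto simp: bij_betw_def)
    with w show "w \<in> f ` transport_pts B A V s O'"
      using transport_pts_embedding[OF V W f(1) inj f(3)] by blast
  next
    fix w assume "w \<in> f ` transport_pts B A V s O'"
    then show "w \<in> transport_pts B A W s O'"
      using transport_pts_embedding[OF V W f(1) inj f(3)] transport_pts_subset[of B A V] by blast
  qed
  moreover have "Restr (transport_rel B A W s O') (transport_pts B A W s O') = transport_rel B A W s O'"
    by (auto simp: transport_rel_def act_rel_def)
  ultimately show ?thesis
    using coef_embedding[OF V W f(1) inj f(3) K s, of O'] by (simp add: coef_def)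
qed

subsection \<open>Disjoint unions and identities\<close>

lemma gset_over_sum:
  assumes "gset_over Z S" "gset_over Z T"
  shows "gset_over Z (over_sum S T)"
proof -
  interpret S: fin_gset "fst S" using assms by unfold_locales (simp add: gset_over_def)
  interpret T: fin_gset "fst T" using assms by unfold_locales (simp add: gset_over_def)
  have grp: "grp (fst S) = grp Z" "grp (fst T) = grp Z"
    and hom: "snd S \<in> gset_hom (fst S) Z" "snd T \<in> gset_hom (fst T) Z"
    using assms by (auto simp: gset_over_def)
  have "finite_gset (fst (over_sum S T))"
    using S.act_one T.act_one S.act_mult T.act_mult S.act_closed T.act_closed
      S.grp.is_group S.finite_carrier S.finite_pts T.finite_pts
    by (intro fin_gsetI) (auto simp: over_sum_def grp)
  moreover have "snd (over_sum S T) \<in> gset_hom (fst (over_sum S T)) Z"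
    using gset_homD[OF hom(1)] gset_homD[OF hom(2)]
    by (auto simp: gset_hom_def over_sum_def grp)
  ultimately show ?thesis
    by (simp add: gset_over_def grp over_sum_def)
qed

lemma coef_sum:
  assumes V: "span B A V" and W: "span B A W"
    and K: "group K" and s: "s \<in> sections K A"
  shows "coef B A (over_sum V W) s O' = coef B A V s O' + coef B A W s O'"
proof -
  interpret V: span B A V by fact
  interpret W: span B A W by fact
  let ?Z = "over_sum V W"
  have Z: "span B A ?Z"
    using gset_over_sum[OF V.gset_over W.gset_over] V.B.fin_gset_axioms V.A.fin_gset_axioms
    by (simp add: span_def span_axioms_def)
  then interpret Z: span B A ?Z .
  let ?P = "transport_pts B A ?Z s O'" and ?r = "transport_rel B A ?Z s O'"
  have Inl: "Inl \<in> gset_hom (fst V) (fst ?Z)" and Inr: "Inr \<in> gset_hom (fst W) (fst ?Z)"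
    by (auto simp: gset_hom_def over_sum_def)
  have legs: "snd ?Z (Inl u) = snd V u" "snd ?Z (Inr w) = snd W w" for u w
    by (auto simp: over_sum_def)
  have pts: "pts (fst ?Z) = pts (fst V) <+> pts (fst W)"
    by (simp add: over_sum_def)
  have PZ: "x \<in> pts (fst V) <+> pts (fst W)" if "x \<in> ?P" for x
    using subsetD[OF transport_pts_subset that] pts by simp
  have V_pts: "{x\<in>?P. isl x \<in> {True}} = {Inl u | u. u \<in> pts (fst V) \<and> Inl u \<in> ?P}"
    using PZ by (auto simp: isl_def)
  have W_pts: "{x\<in>?P. isl x \<in> {False}} = {Inr w | w. w \<in> pts (fst W) \<and> Inr w \<in> ?P}"
  proof (intro equalityI subsetI)
    fix x assume "x \<in> {x\<in>?P. isl x \<in> {False}}"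
    then show "x \<in> {Inr w | w. w \<in> pts (fst W) \<and> Inr w \<in> ?P}"
      using PZ[of x] by (cases x) auto
  qed auto
  have "Inl u \<in> ?P \<longleftrightarrow> u \<in> transport_pts B A V s O'" if "u \<in> pts (fst V)" for u
    using transport_pts_embedding[OF V Z Inl _ legs(1) that] by simp
  then have L: "{x\<in>?P. isl x \<in> {True}} = Inl ` transport_pts B A V s O'"
    using transport_pts_subset[of B A V s O'] V_pts by blast
  have "Inr w \<in> ?P \<longleftrightarrow> w \<in> transport_pts B A W s O'" if "w \<in> pts (fst W)" for w
    using transport_pts_embedding[OF W Z Inr _ legs(2) that] by simp
  then have R: "{x\<in>?P. isl x \<in> {False}} = Inr ` transport_pts B A W s O'"
    using transport_pts_subset[of B A W s O'] W_pts by blast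
  \<comment> \<open>The group preserves the two summands, so \<open>isl\<close> is constant on
    orbits; with equality on bool as relation it separates the summands.\<close>
  have quot: "(UNIV :: bool set) // Id = {{True}, {False}}"
    by (auto simp: quotient_def UNIV_bool)
  have "card (?P // ?r) =
      (\<Sum>C\<in>UNIV // Id. card ({x\<in>?P. isl x \<in> C} // Restr ?r {x\<in>?P. isl x \<in> C}))"
  proof (rule card_quotient_fibers[OF Z.finite_transport_pts _ Z.equiv_transport_rel[OF K s]])
    show "(isl x, isl y) \<in> Id" if xy: "(x, y) \<in> ?r" for x y
    proof -
      obtain c where "x \<in> ?P" "y = act (fst ?Z) c x"
        using xy unfolding transport_rel_def by (rule act_relE)
      moreover from this(1) have "x \<in> pts (fst V) <+> pts (fst W)"
        by (rule PZ)
      ultimately show ?thesis by (auto simp: over_sum_def)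
    qed
  qed (auto simp: equiv_def refl_on_def sym_def trans_def)
  also have "\<dots> = card (Inl ` transport_pts B A V s O' // Restr ?r (Inl ` transport_pts B A V s O')) +
      card (Inr ` transport_pts B A W s O' // Restr ?r (Inr ` transport_pts B A W s O'))"
    unfolding quot using L R by simp
  also have "\<dots> = coef B A V s O' + coef B A W s O'"
    using coef_embedding[OF V Z Inl _ legs(1) K s] coef_embedding[OF W Z Inr _ legs(2) K s] by simp
  finally show ?thesis by (simp add: coef_def)
qed

context fin_gset
begin

lemma gset_over_id_span: "gset_over (prod_gset A A) (id_span A)"
proof -
  have "finite_gset (fst (id_span A))"
    by (rule fin_gsetI) (auto simp: id_span_def DirProd_group grp.is_group finite_carrier finite_pts
        act_mult grp.m_assoc grp.inv_mult_group)
  moreover have "snd (id_span A) \<in> gset_hom (fst (id_span A)) (prod_gset A A)"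
  proof -
    have "act A (inv\<^bsub>grp A\<^esub> (a \<otimes>\<^bsub>grp A\<^esub> g \<otimes>\<^bsub>grp A\<^esub> inv\<^bsub>grp A\<^esub> b)) (act A a x) =
        act A b (act A (inv\<^bsub>grp A\<^esub> g) x)"
      if "a \<in> carrier (grp A)" "b \<in> carrier (grp A)" "g \<in> carrier (grp A)" "x \<in> pts A" for a b g x
      using that by (simp add: grp.inv_mult_group act_mult)
    then show ?thesis
      by (auto simp: gset_hom_def id_span_def prod_gset_def)
  qed
  ultimately show ?thesis
    by (simp add: gset_over_def id_span_def prod_gset_def)
qed

text \<open>Over x the identity span consists of the points (g, g x), a single orbit of the left
  action through (1, x). The stabilizer of (1, x) is the diagonal of the stabilizer of x, and the
  diagonal carries every section at x to itself.\<close>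

lemma coef_id_span:
  assumes K: "group K" and s: "s \<in> sections K A" and O': "O' \<in> sections K A // section_rel K A"
  shows "coef A A (id_span A) s O' = (if s \<in> O' then 1 else 0)"
proof -
  interpret I: span A A "id_span A"
    by unfold_locales (rule gset_over_id_span)
  obtain x S N where s': "s = (x, S, N)" by (cases s)
  note sD = sectionsD[OF s[unfolded s']]
  let ?P = "transport_pts A A (id_span A) s O'" and ?r = "transport_rel A A (id_span A) s O'"
  let ?u = "(\<one>\<^bsub>grp A\<^esub>, x)"
  have u: "?u \<in> pts (fst (id_span A))" "snd (id_span A) ?u = (x, x)"
    using sD(1) by (auto simp: id_span_def)
  have eq: "a \<otimes>\<^bsub>grp A\<^esub> inv\<^bsub>grp A\<^esub> b = \<one>\<^bsub>grp A\<^esub> \<longleftrightarrow> a = b"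
    if "a \<in> carrier (grp A)" "b \<in> carrier (grp A)" for a b
    using that grp.inv_equality[of a "inv\<^bsub>grp A\<^esub> b"] by auto
  have stab: "(a, b) \<in> stab (id_span A) ?u \<longleftrightarrow> a = b \<and> a \<in> carrier (grp A) \<and> act A a x = x" for a b
    using sD(1) by (auto simp: I.stab_iff eq) (auto simp: id_span_def eq)
  have sec: "transport_section (id_span A) ?u s = s"
  proof -
    have "(stab (id_span A) ?u)\<inverse> `` M = M" if "M \<subseteq> S" for M
    proof (intro equalityI subsetI)
      fix a assume "a \<in> M"
      moreover from this have "(a, a) \<in> stab (id_span A) ?u"
        using that sD(4,5) by (auto simp: stab)
      ultimately show "a \<in> (stab (id_span A) ?u)\<inverse> `` M" by blast
    qed (auto simp: stab)
    then show ?thesis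
      using sD(3) by (simp add: transport_section_def s' u)
  qed
  have "transports (grp A) (grp A) (stab (id_span A) ?u) S N"
    using sD sections_kernel(1)[OF K s[unfolded s']]
    by (auto simp: transports_def stab subgroup.one_closed intro!: bexI[of _ "\<one>\<^bsub>grp A\<^esub>"])
  then have mem: "?u \<in> ?P \<longleftrightarrow> s \<in> O'"
    using u sec by (simp add: transport_pts_def s')
  have orb: "\<exists>g\<in>carrier (grp A). w = act (fst (id_span A)) (g, \<one>\<^bsub>grp A\<^esub>) ?u"
    if w: "w \<in> ?P" for w
  proof -
    obtain g y where gy: "w = (g, y)" "g \<in> carrier (grp A)" "y \<in> pts A" "act A (inv\<^bsub>grp A\<^esub> g) y = x"
      using w by (auto simp: transport_pts_def s' id_span_def)
    then have "act A g x = y" using act_act_inv by blast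
    with gy sD(1) show ?thesis
      by (intro bexI[of _ g]) (auto simp: id_span_def)
  qed
  \<comment> \<open>\<open>?P\<close> may be empty. Being stable under the left action, it contains
    (1, x) as soon as it contains any point, and then s lies in \<open>O'\<close>.\<close>
  have uP: "?u \<in> ?P" if w: "w \<in> ?P" for w
  proof -
    obtain g where g: "g \<in> carrier (grp A)" "w = act (fst (id_span A)) (g, \<one>\<^bsub>grp A\<^esub>) ?u"
      using orb[OF w] by blast
    then have "?u = act (fst (id_span A)) (inv\<^bsub>grp A\<^esub> g, \<one>\<^bsub>grp A\<^esub>) w"
      using u(1) by (simp add: I.act_mult')
    moreover have "act (fst (id_span A)) (inv\<^bsub>grp A\<^esub> g, \<one>\<^bsub>grp A\<^esub>) w \<in> ?P"
      using I.transport_pts_act[OF K s w _ _ _ O', of "inv\<^bsub>grp A\<^esub> g" "\<one>\<^bsub>grp A\<^esub>"]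
        conj_section_one[OF s] s g(1) by simp
    ultimately show ?thesis by simp
  qed
  show ?thesis
  proof (cases "s \<in> O'")
    case True
    have "?P // ?r = {?r `` {?u}}"
    proof -
      have cls: "?r `` {w} = ?r `` {?u}" if w: "w \<in> ?P" for w
      proof -
        obtain g where g: "g \<in> carrier (grp A)" "w = act (fst (id_span A)) (g, \<one>\<^bsub>grp A\<^esub>) ?u"
          using orb[OF w] by blast
        then have "(?u, w) \<in> ?r"
          unfolding transport_rel_def using mem True w sections_kernel(1)[OF K s[unfolded s']]
          by (intro act_relI[of _ _ _ "(g, \<one>\<^bsub>grp A\<^esub>)"]) (auto simp: s' subgroup.one_closed)
        then show ?thesis
          using equiv_class_eq[OF I.equiv_transport_rel[OF K s]] by blast
      qed
      have "?P // ?r = (\<lambda>w. ?r `` {w}) ` ?P"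
        unfolding quotient_def by blast
      also have "\<dots> = (\<lambda>w. ?r `` {?u}) ` ?P"
        using cls by (intro image_cong) blast+
      also have "\<dots> = {?r `` {?u}}"
        using mem True by blast
      finally show ?thesis .
    qed
    with True show ?thesis by (simp add: coef_def)
  next
    case False
    then have "?P = {}" using uP mem by blast
    with False show ?thesis by (simp add: coef_def)
  qed
qed

end

subsection \<open>Composition of spans\<close>

locale composable = V: span C B V + U: span B A U
  for C :: "('k, 'z) gset" and B :: "('h, 'y) gset" and A :: "('g, 'x) gset"
    and V :: "('k, 'h, 'v, 'z, 'y) span" and U :: "('h, 'g, 'u, 'y, 'x) span"
begin

abbreviation "W \<equiv> span_comp C B A V U"
abbreviation "orb v u \<equiv> span_orbit C B A V U (v, u)"
abbreviation "aV k h \<equiv> act (fst V) (k, h)"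
abbreviation "aU h g \<equiv> act (fst U) (h, g)"
abbreviation "oneC \<equiv> \<one>\<^bsub>grp C\<^esub>"
abbreviation "oneB \<equiv> \<one>\<^bsub>grp B\<^esub>"
abbreviation "oneA \<equiv> \<one>\<^bsub>grp A\<^esub>"

definition matched where
  "matched v u \<longleftrightarrow> v \<in> pts (fst V) \<and> u \<in> pts (fst U) \<and> snd (snd V v) = fst (snd U u)"

lemma matchedD:
  assumes "matched v u"
  shows "v \<in> pts (fst V)" "u \<in> pts (fst U)" "snd (snd V v) = fst (snd U u)"
  using assms by (auto simp: matched_def)

lemma matched_act:
  assumes "matched v u" "k \<in> carrier (grp C)" "h \<in> carrier (grp B)" "g \<in> carrier (grp A)"
  shows "matched (aV k h v) (aU h g u)"
  using assms V.leg_act[of v k h] U.leg_act[of u h g] by (simp add: matched_def)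

text \<open>The right action of h on pairs involves the inverse of h; reindexing by inversion turns
  it into a left action.\<close>

lemma orb_eq:
  "orb v u = (\<lambda>h. (aV oneC h v, aU h oneA u)) ` carrier (grp B)"
proof -
  have "orb v u = (\<lambda>h. (aV oneC h v, aU h oneA u)) ` (\<lambda>h. inv\<^bsub>grp B\<^esub> h) ` carrier (grp B)"
    by (auto simp: span_orbit_def image_image)
  also have "(\<lambda>h. inv\<^bsub>grp B\<^esub> h) ` carrier (grp B) = carrier (grp B)"
    using V.A.grp.inv_inv by (auto intro!: image_eqI[where x = "inv\<^bsub>grp B\<^esub> _"])
  finally show ?thesis .
qed

lemma orb_self: "matched v u \<Longrightarrow> (v, u) \<in> orb v u"
  unfolding orb_eq by (rule image_eqI[where x = oneB]) (auto simp: matched_def)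

lemma orb_shift:
  assumes m: "matched v u" and h: "h \<in> carrier (grp B)"
  shows "orb (aV oneC h v) (aU h oneA u) = orb v u"
proof -
  have *: "orb (aV oneC h v) (aU h oneA u) \<subseteq> orb v u"
    if m: "matched v u" and h: "h \<in> carrier (grp B)" for v u h
    using matchedD[OF m] h
    by (auto simp: orb_eq V.act_mult' U.act_mult' intro!: image_eqI[where x = "_ \<otimes>\<^bsub>grp B\<^esub> h"])
  let ?v = "aV oneC h v" and ?u = "aU h oneA u" and ?h = "inv\<^bsub>grp B\<^esub> h"
  have "aV oneC ?h ?v = v" "aU ?h oneA ?u = u"
    using matchedD[OF m] h by (auto simp: V.act_mult' U.act_mult')
  then have "orb v u \<subseteq> orb ?v ?u"
    using *[of ?v ?u ?h] matched_act[OF m _ h, of oneC oneA] h by simp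
  with *[OF m h] show ?thesis by blast
qed

lemma orb_eq_iff:
  assumes "matched v u" "matched v' u'"
  shows "orb v u = orb v' u' \<longleftrightarrow> (\<exists>h\<in>carrier (grp B). v' = aV oneC h v \<and> u' = aU h oneA u)"
proof
  assume "orb v u = orb v' u'"
  then have "(v', u') \<in> orb v u"
    using orb_self[OF assms(2)] by simp
  then show "\<exists>h\<in>carrier (grp B). v' = aV oneC h v \<and> u' = aU h oneA u"
    by (auto simp: orb_eq)
qed (use orb_shift[OF assms(1)] in auto)

lemma pts_W: "pts (fst W) = {orb v u | v u. matched v u}"
  by (auto simp: span_comp_def span_comp_pts_def matched_def)

lemma act_W:
  assumes m: "matched v u" and kg: "k \<in> carrier (grp C)" "g \<in> carrier (grp A)"
  shows "act (fst W) (k, g) (orb v u) = orb (aV k oneB v) (aU oneB g u)"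
proof -
  have "orb v u \<in> span_comp_pts C B A V U"
    using m by (auto simp: span_comp_pts_def matched_def)
  then have "act (fst W) (k, g) (orb v u) = (\<lambda>(v, u). (aV k oneB v, aU oneB g u)) ` orb v u"
    by (simp add: span_comp_def)
  also have "\<dots> = orb (aV k oneB v) (aU oneB g u)"
    unfolding orb_eq image_image using matchedD[OF m] kg
    by (intro image_cong) (auto simp: V.act_mult' U.act_mult')
  finally show ?thesis .
qed

lemma leg_W:
  assumes m: "matched v u"
  shows "snd W (orb v u) = (fst (snd V v), snd (snd U u))"
proof -
  have "(\<lambda>(v, u). (fst (snd V v), snd (snd U u))) ` orb v u = (\<lambda>h. (fst (snd V v), snd (snd U u))) ` carrier (grp B)"
    unfolding orb_eq image_image using matchedD[OF m] V.legs_closed(1)[of v] U.legs_closed(2)[of u]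
    by (intro image_cong) (auto simp: V.leg_act U.leg_act)
  also have "\<dots> = {(fst (snd V v), snd (snd U u))}"
    using V.A.grp.one_closed by blast
  finally show ?thesis by (simp add: span_comp_def)
qed

lemma gset_over_W: "gset_over (prod_gset C A) W"
proof -
  have grp_W: "grp (fst W) = grp C \<times>\<times> grp A"
    by (simp add: span_comp_def)
  have act: "act (fst W) (k, g) (orb v u) \<in> pts (fst W)"
    if "matched v u" "k \<in> carrier (grp C)" "g \<in> carrier (grp A)" for v u k g
    using act_W[OF that] matched_act[OF that(1), of oneC oneB g] matched_act[of v "aU oneB g u" k oneB oneA]
      matched_act[OF that(1), of k oneB g] that by (auto simp: pts_W)
  have "finite_gset (fst W)"
  proof (rule fin_gsetI)
    show "group (grp (fst W))" "finite (carrier (grp (fst W)))"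
      by (auto simp: grp_W DirProd_group V.B.grp.is_group U.A.grp.is_group V.B.finite_carrier
          U.A.finite_carrier)
    have "pts (fst W) \<subseteq> (\<lambda>(v, u). orb v u) ` (pts (fst V) \<times> pts (fst U))"
      by (auto simp: pts_W matched_def)
    then show "finite (pts (fst W))"
      using V.V.finite_pts U.V.finite_pts finite_subset by blast
    show "act (fst W) c \<in> extensional (pts (fst W))" for c
      by (simp add: span_comp_def case_prod_beta)
    fix w assume "w \<in> pts (fst W)"
    then obtain v u where w: "w = orb v u" and m: "matched v u" by (auto simp: pts_W)
    show "act (fst W) c w \<in> pts (fst W)" if "c \<in> carrier (grp (fst W))" for c
      using act[OF m] that by (auto simp: w grp_W)
    show "act (fst W) \<one>\<^bsub>grp (fst W)\<^esub> w = w"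
      using matchedD[OF m] by (simp add: w grp_W act_W[OF m])
    show "act (fst W) (c \<otimes>\<^bsub>grp (fst W)\<^esub> d) w = act (fst W) c (act (fst W) d w)"
      if cd: "c \<in> carrier (grp (fst W))" "d \<in> carrier (grp (fst W))" for c d
    proof -
      obtain k g k' g' where kg: "c = (k, g)" "d = (k', g')" "k \<in> carrier (grp C)"
          "k' \<in> carrier (grp C)" "g \<in> carrier (grp A)" "g' \<in> carrier (grp A)"
        using cd by (auto simp: grp_W)
      have "matched (aV k' oneB v) (aU oneB g' u)"
        using matched_act[OF m] kg by simp
      then show ?thesis
        using matchedD[OF m] kg m by (simp add: grp_W w act_W V.act_mult' U.act_mult')
    qed
  qed
  moreover have "snd W \<in> gset_hom (fst W) (prod_gset C A)"
    unfolding gset_hom_def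
  proof (intro CollectI conjI funcsetI ballI)
    fix w assume "w \<in> pts (fst W)"
    then obtain v u where w: "w = orb v u" and m: "matched v u" by (auto simp: pts_W)
    note vu = matchedD[OF m]
    show "snd W w \<in> pts (prod_gset C A)"
      using V.legs_closed(1)[OF vu(1)] U.legs_closed(2)[OF vu(2)] by (simp add: w leg_W[OF m] prod_gset_def)
    fix c assume "c \<in> carrier (grp (fst W))"
    then obtain k g where kg: "c = (k, g)" "k \<in> carrier (grp C)" "g \<in> carrier (grp A)"
      by (auto simp: grp_W)
    have "matched (aV k oneB v) (aU oneB g u)"
      using matched_act[OF m] kg by simp
    then show "snd W (act (fst W) c w) = act (prod_gset C A) c (snd W w)"
      using V.legs_closed(1)[OF vu(1)] U.legs_closed(2)[OF vu(2)] vu kg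
      by (simp add: w act_W[OF m] leg_W m prod_gset_def V.leg_act U.leg_act)
  qed
  ultimately show ?thesis
    by (simp add: gset_over_def grp_W prod_gset_def)
qed

sublocale W: span C A W
  by unfold_locales (rule gset_over_W)

text \<open>The pair (k, g) fixes the orbit of (v, u) exactly when the move to (k v, u g^-1) can be
  undone by some h of the middle group, that is, when (k, h) fixes v and (h, g) fixes u.\<close>

lemma stab_W:
  assumes m: "matched v u"
  shows "stab W (orb v u) = stab V v O stab U u"
proof -
  note vu = matchedD[OF m]
  have "(k, g) \<in> stab W (orb v u) \<longleftrightarrow> (k, g) \<in> stab V v O stab U u" for k g
  proof (cases "k \<in> carrier (grp C) \<and> g \<in> carrier (grp A)")
    case True
    then have kg: "k \<in> carrier (grp C)" "g \<in> carrier (grp A)" by auto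
    have m': "matched (aV k oneB v) (aU oneB g u)"
      using matched_act[OF m] kg by simp
    have "(k, g) \<in> stab W (orb v u) \<longleftrightarrow>
        (\<exists>h\<in>carrier (grp B). v = aV oneC h (aV k oneB v) \<and> u = aU h oneA (aU oneB g u))"
      using orb_eq_iff[OF m' m] kg by (simp add: W.stab_iff act_W[OF m])
    also have "\<dots> \<longleftrightarrow> (\<exists>h\<in>carrier (grp B). aV k h v = v \<and> aU h g u = u)"
      using vu kg by (intro bex_cong refl) (auto simp: V.act_mult' U.act_mult')
    also have "\<dots> \<longleftrightarrow> (k, g) \<in> stab V v O stab U u"
      using kg by (auto simp: V.stab_iff U.stab_iff relcomp_unfold)
    finally show ?thesis .
  qed (auto simp: W.stab_iff V.stab_iff U.stab_iff)
  then show ?thesis by auto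
qed

lemma transport_section_W:
  "matched v u \<Longrightarrow> transport_section W (orb v u) s = transport_section V v (transport_section U u s)"
  by (cases s) (simp add: transport_section_def stab_W leg_W converse_relcomp relcomp_Image)

lemma orb_in_transport_pts:
  assumes K: "group K" and s: "s \<in> sections K A" and m: "matched v u"
  shows "orb v u \<in> transport_pts C A W s O' \<longleftrightarrow>
    u \<in> transport_pts B A U s (sections K B) \<and> v \<in> transport_pts C B V (transport_section U u s) O'"
proof -
  obtain x S N where s': "s = (x, S, N)" by (cases s)
  note vu = matchedD[OF m]
  note sD = U.A.sectionsD[OF s[unfolded s']]
  interpret Du: group_rel "grp B" "grp A" "stab U u"
    by (rule U.group_rel_stab) fact
  have "orb v u \<in> pts (fst W)" using m by (auto simp: pts_W)
  moreover have "transport_section U u s = (fst (snd U u), (stab U u)\<inverse> `` S, (stab U u)\<inverse> `` N)"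
    by (simp add: s' transport_section_def)
  moreover have "transports (grp B) (grp A) (stab U u) S N \<Longrightarrow> transport_section U u s \<in> sections K B"
    using U.transport_section_in_sections[OF K s[unfolded s'] vu(2)] s' by simp
  ultimately show ?thesis
    using Du.transports_relcomp_iff[OF V.group_rel_stab[OF vu(1)] sD(2)
        U.A.sections_kernel(1)[OF K s[unfolded s']] sD(3)] vu
      transport_section_W[OF m, of s]
    by (auto simp: transport_pts_def s' leg_W[OF m] stab_W[OF m])
qed

section \<open>Counting orbits of matched pairs in two ways\<close>

definition pairs where
  "pairs s O' O'' = {(v, u). matched v u \<and> u \<in> transport_pts B A U s O' \<and>
     v \<in> transport_pts C B V (transport_section U u s) O''}"

text \<open>Points of the composite are orbits of pairs under the middle group. On the pairs
  themselves the group of C, the middle group and N act together, sending (v, u) to (k v h^-1, h u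
  g^-1), so all three can be divided out at once.\<close>

definition pair_rel where
  "pair_rel s P = act_rel (carrier (grp C) \<times> carrier (grp B) \<times> snd (snd s))
     (\<lambda>(k, h, g) (v, u). (aV k h v, aU h g u)) P"

lemma kernel_closed:
  assumes "s \<in> sections K A" "n \<in> snd (snd s)"
  shows "n \<in> fst (snd s)" "n \<in> carrier (grp A)"
  using U.A.sectionsD[of "fst s" "fst (snd s)" "snd (snd s)" K] assms by auto

lemma equiv_pair_rel:
  assumes K: "group K" and s: "s \<in> sections K A" and P: "\<And>v u. (v, u) \<in> P \<Longrightarrow> matched v u"
  shows "equiv P (pair_rel s P)"
  unfolding pair_rel_def
proof (rule equiv_act_rel[of "grp C \<times>\<times> (grp B \<times>\<times> grp A)"])
  show "group (grp C \<times>\<times> (grp B \<times>\<times> grp A))"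
    by (intro DirProd_group V.B.grp.is_group U.A.grp.is_group V.A.grp.is_group)
  have "subgroup (snd (snd s)) (grp A)"
    using U.A.sections_kernel(1)[OF K, of "fst s" "fst (snd s)" "snd (snd s)"] s by simp
  then show "subgroup (carrier (grp C) \<times> carrier (grp B) \<times> snd (snd s)) (grp C \<times>\<times> (grp B \<times>\<times> grp A))"
    by (intro DirProd_subgroups DirProd_group V.B.grp.is_group U.A.grp.is_group V.A.grp.is_group
        V.B.grp.subgroup_self V.A.grp.subgroup_self)
  show "(case \<one>\<^bsub>grp C \<times>\<times> (grp B \<times>\<times> grp A)\<^esub> of (k, h, g) \<Rightarrow> \<lambda>(v, u). (aV k h v, aU h g u)) x = x"
    if "x \<in> P" for x
    using that P matchedD by (cases x) fastforce
  show "(case c \<otimes>\<^bsub>grp C \<times>\<times> (grp B \<times>\<times> grp A)\<^esub> d of (k, h, g) \<Rightarrow> \<lambda>(v, u). (aV k h v, aU h g u)) x =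
      (case c of (k, h, g) \<Rightarrow> \<lambda>(v, u). (aV k h v, aU h g u))
        ((case d of (k, h, g) \<Rightarrow> \<lambda>(v, u). (aV k h v, aU h g u)) x)"
    if c: "c \<in> carrier (grp C) \<times> carrier (grp B) \<times> snd (snd s)"
      and d: "d \<in> carrier (grp C) \<times> carrier (grp B) \<times> snd (snd s)" and x: "x \<in> P" for c d x
  proof -
    obtain v u where vu: "x = (v, u)" "v \<in> pts (fst V)" "u \<in> pts (fst U)"
      using P matchedD x by (cases x) blast
    show ?thesis
      using c d kernel_closed(2)[OF s] vu by (auto simp: V.act_mult' U.act_mult')
  qed
qed

lemma finite_pairs: "finite (pairs s O' O'')"
proof (rule finite_subset)
  show "pairs s O' O'' \<subseteq> pts (fst V) \<times> pts (fst U)"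
    using matchedD by (auto simp: pairs_def)
qed (use V.V.finite_pts U.V.finite_pts in simp)

lemma pair_rel_cases:
  assumes "((v, u), (v', u')) \<in> pair_rel s P"
  obtains k h n where "k \<in> carrier (grp C)" "h \<in> carrier (grp B)" "n \<in> snd (snd s)"
    "v' = aV k h v" "u' = aU h n u" "(v, u) \<in> P" "(v', u') \<in> P"
  using assms by (auto simp: pair_rel_def act_rel_def)

lemma pair_relI:
  assumes "k \<in> carrier (grp C)" "h \<in> carrier (grp B)" "n \<in> snd (snd s)"
    "v' = aV k h v" "u' = aU h n u" "(v, u) \<in> P" "(v', u') \<in> P"
  shows "((v, u), (v', u')) \<in> pair_rel s P"
  unfolding pair_rel_def using assms by (intro act_relI[of _ _ _ "(k, h, n)"]) auto

lemma transport_relI: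
  assumes "u \<in> transport_pts B A U s O'" "u' \<in> transport_pts B A U s O'"
    "h \<in> carrier (grp B)" "n \<in> snd (snd s)" "u' = aU h n u"
  shows "(u, u') \<in> transport_rel B A U s O'"
  unfolding transport_rel_def using assms by (intro act_relI[of _ _ _ "(h, n)"]) auto

text \<open>Matched pairs give the same point of the composite exactly when the middle group relates
  them, so dividing the composite by the group of C and by N is dividing the pairs by all three
  groups. The middle class is unrestricted because the composite does not record it.\<close>

lemma coef_W_pairs:
  assumes K: "group K" and s: "s \<in> sections K A"
  shows "coef C A W s O'' =
    card (pairs s (sections K B) O'' // pair_rel s (pairs s (sections K B) O''))"
  unfolding coef_def
proof (rule card_quotient_eq[symmetric, OF equiv_pair_rel[OF K s] W.equiv_transport_rel[OF K s],
      of _ "\<lambda>(v, u). orb v u"])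
  let ?P = "pairs s (sections K B) O''"
  show "matched v u" if "(v, u) \<in> ?P" for v u
    using that by (simp add: pairs_def)
  have pairs: "(v, u) \<in> ?P \<longleftrightarrow> orb v u \<in> transport_pts C A W s O''" if "matched v u" for v u
    using orb_in_transport_pts[OF K s that] that by (simp add: pairs_def)
  then show "(\<lambda>(v, u). orb v u) \<in> ?P \<rightarrow> transport_pts C A W s O''"
    by (auto simp: pairs_def)
  show "\<exists>p\<in>?P. ((case p of (v, u) \<Rightarrow> orb v u), w) \<in> transport_rel C A W s O''"
    if w: "w \<in> transport_pts C A W s O''" for w
  proof -
    have "w \<in> pts (fst W)"
      using w transport_pts_subset by (rule subsetD[rotated])
    then obtain v u where vu: "w = orb v u" "matched v u" by (auto simp: pts_W)
    moreover have "(w, w) \<in> transport_rel C A W s O''"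
      using W.equiv_transport_rel[OF K s] w by (simp add: equiv_def refl_on_def)
    ultimately show ?thesis
      using pairs w by (intro bexI[of _ "(v, u)"]) auto
  qed
  fix p q assume p: "p \<in> ?P" and q: "q \<in> ?P"
  obtain v u v' u' where pq: "p = (v, u)" "q = (v', u')" by (cases p; cases q)
  have m: "matched v u" "matched v' u'"
    using p q by (auto simp: pq pairs_def)
  note vu = matchedD[OF m(1)]
  have "orb v' u' = act (fst W) (k, n) (orb v u) \<longleftrightarrow>
      (\<exists>h\<in>carrier (grp B). v' = aV k h v \<and> u' = aU h n u)"
    if kn: "k \<in> carrier (grp C)" "n \<in> snd (snd s)" for k n
  proof -
    have n: "n \<in> carrier (grp A)" by (rule kernel_closed[OF s kn(2)])
    have "matched (aV k oneB v) (aU oneB n u)"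
      using matched_act[OF m(1)] kn n by simp
    then have "orb v' u' = act (fst W) (k, n) (orb v u) \<longleftrightarrow>
        (\<exists>h\<in>carrier (grp B). v' = aV oneC h (aV k oneB v) \<and> u' = aU h oneA (aU oneB n u))"
      using orb_eq_iff[OF _ m(2)] by (simp add: act_W[OF m(1) kn(1) n] eq_commute[of "orb v' u'"])
    also have "\<dots> \<longleftrightarrow> (\<exists>h\<in>carrier (grp B). v' = aV k h v \<and> u' = aU h n u)"
      using vu kn n by (intro bex_cong refl) (simp add: V.act_mult' U.act_mult')
    finally show ?thesis .
  qed
  then show "(p, q) \<in> pair_rel s ?P \<longleftrightarrow>
      ((case p of (v, u) \<Rightarrow> orb v u), (case q of (v, u) \<Rightarrow> orb v u)) \<in> transport_rel C A W s O''"
    using p q pairs m by (auto simp: pq pair_rel_def transport_rel_def act_rel_def)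
qed

text \<open>Project the pairs to u. The orbits of u under the group of B and N give the first
  factor. Over a fixed u only those (h, n) remain that fix u, and their left components form exactly
  the normal subgroup of the section transported along u. The orbits of v are therefore counted by a
  coefficient of V at that section, which is the same for all sections in \<open>O'\<close>.\<close>

lemma card_pairs_over_class:
  assumes K: "group K" and s: "s \<in> sections K A" and O'': "O'' \<in> sections K C // section_rel K C"
    and O': "O' \<in> sections K B // section_rel K B" and t: "t \<in> O'"
  shows "card (pairs s O' O'' // pair_rel s (pairs s O' O'')) = coef B A U s O' * coef C B V t O''"
proof -
  let ?P = "pairs s O' O''" and ?Q = "transport_pts B A U s O'" and ?q = "transport_rel B A U s O'"
  have m: "matched v u" "u \<in> ?Q" if "(v, u) \<in> ?P" for v u
    using that by (auto simp: pairs_def)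
  have eP: "equiv ?P (pair_rel s ?P)"
    by (rule equiv_pair_rel[OF K s]) (rule m)
  have eQ: "equiv ?Q ?q"
    by (rule U.equiv_transport_rel[OF K s])
  have fixed: "conj_section A n s = s" if "n \<in> snd (snd s)" for n
    using U.A.conj_section_fixed[OF K, of "fst s" "fst (snd s)" "snd (snd s)" n]
      s kernel_closed(1)[OF s that] by simp
  have fiber: "card ({x\<in>?P. snd x \<in> D} // Restr (pair_rel s ?P) {x\<in>?P. snd x \<in> D}) = coef C B V t O''"
    if D: "D \<in> ?Q // ?q" for D
  proof -
    let ?F = "{x\<in>?P. snd x \<in> D}"
    obtain u where u: "u \<in> ?Q" "D = ?q `` {u}" using D by (rule quotientE)
    have uD: "u \<in> D" using equiv_class_self[OF eQ] u by simp
    have uU: "u \<in> pts (fst U)" using u(1) transport_pts_subset by (rule subsetD[rotated])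
    let ?t = "transport_section U u s"
    have tO': "?t \<in> O'" using u(1) by (cases s) (simp add: transport_pts_def)
    then have t_rel: "(?t, t) \<in> section_rel K B"
      using in_quotient_imp_in_rel[OF V.A.equiv_section_rel O'] t by blast
    then have tK: "?t \<in> sections K B" by (rule act_relE)
    have R: "Restr (pair_rel s ?P) ?F = pair_rel s ?F"
      unfolding pair_rel_def by (rule Restr_act_rel) blast
    have ker: "h \<in> snd (snd ?t) \<longleftrightarrow> (\<exists>n\<in>snd (snd s). (h, n) \<in> stab U u)" for h
      by (cases s) (auto simp: transport_section_def)
    have F: "(v, u) \<in> ?F \<longleftrightarrow> v \<in> transport_pts C B V ?t O''" for v
    proof -
      have "matched v u" if "v \<in> transport_pts C B V ?t O''"
        using that uU by (cases s) (auto simp: matched_def transport_pts_def transport_section_def)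
      then show ?thesis
        using u(1) uD by (auto simp: pairs_def)
    qed
    have "coef C B V ?t O'' = card (?F // pair_rel s ?F)"
      unfolding coef_def
    proof (rule card_quotient_eq[OF V.equiv_transport_rel[OF K tK], of _ _ "\<lambda>v. (v, u)"])
      show "equiv ?F (pair_rel s ?F)"
        using equiv_Restr[OF eP, of ?F] R by auto
      show "(\<lambda>v. (v, u)) \<in> transport_pts C B V ?t O'' \<rightarrow> ?F"
        using F by blast
      show "(v, v') \<in> transport_rel C B V ?t O'' \<longleftrightarrow> ((v, u), (v', u)) \<in> pair_rel s ?F"
        if v: "v \<in> transport_pts C B V ?t O''" "v' \<in> transport_pts C B V ?t O''" for v v'
      proof
        assume "(v, v') \<in> transport_rel C B V ?t O''"
        then obtain k h where kh: "k \<in> carrier (grp C)" "h \<in> snd (snd ?t)" "v' = aV k h v"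
          by (auto simp: transport_rel_def act_rel_def)
        then obtain n where "n \<in> snd (snd s)" "h \<in> carrier (grp B)" "aU h n u = u"
          by (auto simp: ker U.stab_iff)
        then show "((v, u), (v', u)) \<in> pair_rel s ?F"
          using kh v F by (intro pair_relI) auto
      next
        assume "((v, u), (v', u)) \<in> pair_rel s ?F"
        then obtain k h n where "k \<in> carrier (grp C)" "h \<in> carrier (grp B)" "n \<in> snd (snd s)"
            "v' = aV k h v" "u = aU h n u"
          by (rule pair_rel_cases)
        moreover from this have "h \<in> snd (snd ?t)"
          unfolding ker U.stab_iff using kernel_closed(2)[OF s] by (intro bexI[of _ n]) auto
        ultimately show "(v, v') \<in> transport_rel C B V ?t O''"
          unfolding transport_rel_def using v by (intro act_relI[of _ _ _ "(k, h)"]) auto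
      qed
      fix x assume x: "x \<in> ?F"
      obtain v' u' where x': "x = (v', u')" by (cases x)
      have v'u': "(v', u') \<in> ?P" "u' \<in> D" using x x' by auto
      have "(u, u') \<in> ?q" using v'u'(2) u(2) by simp
      then obtain h n where hn: "h \<in> carrier (grp B)" "n \<in> snd (snd s)" "u' = aU h n u"
        by (auto simp: transport_rel_def act_rel_def)
      have n: "n \<in> carrier (grp A)" by (rule kernel_closed[OF s hn(2)])
      let ?h = "inv\<^bsub>grp B\<^esub> h" and ?n = "inv\<^bsub>grp A\<^esub> n"
      have m': "matched v' u'" by (rule m) (rule v'u')
      note mv = matchedD[OF m']
      \<comment> \<open>A pair over the orbit of u is brought back onto u by (1, h^-1, n^-1). Since
        n fixes s, the section transported along u' becomes the one transported along u, and v'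
        moved by h^-1 is a transport point for it.\<close>
      have uu': "aU ?h ?n u' = u"
        using hn n uU by (simp add: U.act_mult')
      have "conj_section A ?n s = s"
        using U.A.conj_section_mult[OF s, of ?n n] U.A.conj_section_one[OF s] fixed[OF hn(2)] n by simp
      then have t': "conj_section B ?h (transport_section U u' s) = ?t"
        using U.transport_section_act[OF K, of "fst s" "fst (snd s)" "snd (snd s)" u' ?h ?n]
          s mv(2) hn(1) n uu' by simp
      have "transport_section U u' s \<in> O'"
        using m(2)[OF v'u'(1)] by (cases s) (simp add: transport_pts_def)
      then have t'K: "transport_section U u' s \<in> sections K B"
        using in_quotient_imp_subset[OF V.A.equiv_section_rel O'] by blast
      have "v' \<in> transport_pts C B V (transport_section U u' s) O''"
        using v'u'(1) by (simp add: pairs_def)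
      then have "aV oneC ?h v' \<in> transport_pts C B V ?t O''"
        using V.transport_pts_act[OF K t'K _ _ _ _ O'', of v' oneC ?h] t' tK hn(1) by simp
      moreover have "v' = aV oneC h (aV oneC ?h v')"
        using mv hn(1) by (simp add: V.act_mult')
      ultimately show "\<exists>v\<in>transport_pts C B V ?t O''. ((v, u), x) \<in> pair_rel s ?F"
        unfolding x' using x x' hn F by (intro bexI[of _ "aV oneC ?h v'"] pair_relI) auto
    qed
    moreover have "coef C B V ?t O'' = coef C B V t O''"
      by (rule V.coef_conj[OF K t_rel O''])
    ultimately show ?thesis using R by simp
  qed
  have "card (?P // pair_rel s ?P) =
      (\<Sum>D\<in>?Q // ?q. card ({x\<in>?P. snd x \<in> D} // Restr (pair_rel s ?P) {x\<in>?P. snd x \<in> D}))"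
  proof (rule card_quotient_fibers[OF finite_pairs U.finite_transport_pts eP eQ])
    show "snd \<in> ?P \<rightarrow> ?Q" using m by auto
    show "(snd x, snd y) \<in> ?q" if "(x, y) \<in> pair_rel s ?P" for x y
      using that m by (cases x; cases y) (auto elim!: pair_rel_cases intro: transport_relI)
  qed
  then show ?thesis using fiber by (simp add: coef_def)
qed

text \<open>A product of matrices: the pairs are sorted by the class of the section transported
  along u, and each class contributes a product of two entries. \<open>rep\<close> selects the row
  of V that belongs to a class.\<close>

lemma coef_comp:
  assumes K: "group K" and s: "s \<in> sections K A" and O'': "O'' \<in> sections K C // section_rel K C"
    and rep: "\<And>O'. O' \<in> sections K B // section_rel K B \<Longrightarrow> rep O' \<in> O'"
  shows "coef C A W s O'' =
    (\<Sum>O'\<in>sections K B // section_rel K B. coef B A U s O' * coef C B V (rep O') O'')"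
proof -
  let ?P = "pairs s (sections K B) O''"
  let ?f = "\<lambda>x. transport_section U (snd x) s"
  have m: "matched v u" "u \<in> transport_pts B A U s (sections K B)" if "(v, u) \<in> ?P" for v u
    using that by (auto simp: pairs_def)
  have eP: "equiv ?P (pair_rel s ?P)"
    by (rule equiv_pair_rel[OF K s]) (rule m)
  have ts: "u \<in> transport_pts B A U s T \<longleftrightarrow>
      u \<in> transport_pts B A U s (sections K B) \<and> transport_section U u s \<in> T" if "T \<subseteq> sections K B" for u T
    using that by (cases s) (auto simp: transport_pts_def)
  have "card (?P // pair_rel s ?P) = (\<Sum>O'\<in>sections K B // section_rel K B.
      card ({x\<in>?P. ?f x \<in> O'} // Restr (pair_rel s ?P) {x\<in>?P. ?f x \<in> O'}))"
  proof (rule card_quotient_fibers[OF finite_pairs V.A.finite_sections eP V.A.equiv_section_rel])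
    show "?f \<in> ?P \<rightarrow> sections K B"
    proof (rule funcsetI)
      fix x assume "x \<in> ?P"
      then show "?f x \<in> sections K B"
        using ts[OF order.refl, of "snd x"] m(2)[of "fst x" "snd x"] by simp
    qed
    show "(?f x, ?f y) \<in> section_rel K B" if "(x, y) \<in> pair_rel s ?P" for x y
    proof -
      have "(snd x, snd y) \<in> transport_rel B A U s (sections K B)"
        using that m by (cases x; cases y) (auto elim!: pair_rel_cases intro: transport_relI)
      then show ?thesis by (rule U.transport_section_rel[OF K s])
    qed
  qed
  also have "\<dots> = (\<Sum>O'\<in>sections K B // section_rel K B. coef B A U s O' * coef C B V (rep O') O'')"
  proof (rule sum.cong[OF refl])
    fix O' assume O': "O' \<in> sections K B // section_rel K B"
    have F: "{x\<in>?P. ?f x \<in> O'} = pairs s O' O''"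
    proof (rule Set.set_eqI)
      fix x
      show "x \<in> {x\<in>?P. ?f x \<in> O'} \<longleftrightarrow> x \<in> pairs s O' O''"
        using ts[OF in_quotient_imp_subset[OF V.A.equiv_section_rel O'], of "snd x"]
        by (cases x) (simp add: pairs_def, blast)
    qed
    have "pairs s O' O'' \<subseteq> ?P" using F by blast
    then have "Restr (pair_rel s ?P) (pairs s O' O'') = pair_rel s (pairs s O' O'')"
      unfolding pair_rel_def by (rule Restr_act_rel)
    then show "card ({x\<in>?P. ?f x \<in> O'} // Restr (pair_rel s ?P) {x\<in>?P. ?f x \<in> O'}) =
        coef B A U s O' * coef C B V (rep O') O''"
      using card_pairs_over_class[OF K s O'' O' rep[OF O']] F by simp
  qed
  finally show ?thesis using coef_W_pairs[OF K s] by simp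
qed

end

subsection \<open>Matrices of morphisms\<close>

lemma iso_over_trans:
  assumes "iso_over S T" "iso_over T U" "grp (fst T) = grp (fst S)"
  shows "iso_over S U"
proof -
  obtain f g where f: "f \<in> gset_hom (fst S) (fst T)" "bij_betw f (pts (fst S)) (pts (fst T))"
      "\<forall>s\<in>pts (fst S). snd T (f s) = snd S s"
    and g: "g \<in> gset_hom (fst T) (fst U)" "bij_betw g (pts (fst T)) (pts (fst U))"
      "\<forall>s\<in>pts (fst T). snd U (g s) = snd T s"
    using assms by (auto simp: iso_over_def)
  have "g \<circ> f \<in> gset_hom (fst S) (fst U)"
    using f g assms(3) by (auto simp: gset_hom_def Pi_iff)
  then show ?thesis
    using f g bij_betw_trans[OF f(2) g(2)] gset_homD(1)[OF f(1)]
    unfolding iso_over_def by (intro bexI[of _ "g \<circ> f"]) auto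
qed

lemma iso_over_sym:
  assumes iso: "iso_over S T" and S: "gset_over Z S" and T: "gset_over Z T"
  shows "iso_over T S"
proof -
  interpret S: fin_gset "fst S" using S by unfold_locales (simp add: gset_over_def)
  obtain f where f: "f \<in> gset_hom (fst S) (fst T)" "bij_betw f (pts (fst S)) (pts (fst T))"
      "\<And>s. s \<in> pts (fst S) \<Longrightarrow> snd T (f s) = snd S s"
    using iso by (auto simp: iso_over_def)
  let ?g = "inv_into (pts (fst S)) f"
  have g: "bij_betw ?g (pts (fst T)) (pts (fst S))"
    by (rule bij_betw_inv_into[OF f(2)])
  have fg: "f (?g t) = t" "?g t \<in> pts (fst S)" if "t \<in> pts (fst T)" for t
    using bij_betw_inv_into_right[OF f(2) that] g that by (auto simp: bij_betw_def)
  have grp: "grp (fst T) = grp (fst S)"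
    using S T by (simp add: gset_over_def)
  have "?g (act (fst T) c t) = act (fst S) c (?g t)"
    if "c \<in> carrier (grp (fst S))" "t \<in> pts (fst T)" for c t
    using gset_homD(2)[OF f(1) that(1) fg(2)[OF that(2)]] fg[OF that(2)]
      bij_betw_inv_into_left[OF f(2) S.act_closed[OF that(1) fg(2)[OF that(2)]]] by simp
  then have "?g \<in> gset_hom (fst T) (fst S)"
    using fg by (auto simp: gset_hom_def grp)
  moreover have "snd S (?g t) = snd T t" if "t \<in> pts (fst T)" for t
    using f(3)[OF fg(2)[OF that]] fg(1)[OF that] by simp
  ultimately show ?thesis
    using g unfolding iso_over_def by blast
qed

text \<open>Classes consist of spans on sets of natural numbers, while sums, composites and the
  identity span live over other types. Copying along an injection into the natural numbers makes
  their classes nonempty and turns them into generators.\<close>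

lemma ex_nat_copy:
  assumes S: "gset_over Z S"
  shows "\<exists>T :: ('g, nat, 'z) gset_over. gset_over Z T \<and> iso_over S T"
proof -
  interpret S: fin_gset "fst S" using S by unfold_locales (simp add: gset_over_def)
  obtain e :: "_ \<Rightarrow> nat" where e: "inj_on e (pts (fst S))"
    using finite_imp_inj_to_nat_seg[OF S.finite_pts] by blast
  let ?i = "inv_into (pts (fst S)) e"
  let ?P = "e ` pts (fst S)"
  define T :: "('g, nat, 'z) gset_over" where
    "T = (\<lparr>grp = grp Z, pts = ?P, act = (\<lambda>g. \<lambda>k\<in>?P. e (act (fst S) g (?i k)))\<rparr>, snd S \<circ> ?i)"
  have grp: "grp (fst S) = grp Z" using S by (simp add: gset_over_def)
  have hom: "snd S \<in> gset_hom (fst S) Z" using S by (simp add: gset_over_def)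
  have "finite_gset (fst T)"
    by (rule fin_gsetI) (use S.grp.is_group S.finite_carrier S.finite_pts in
      \<open>auto simp: T_def e S.act_mult inj_on_eq_iff[OF e] simp flip: grp\<close>)
  moreover have "snd T \<in> gset_hom (fst T) Z"
    using gset_homD[OF hom] by (auto simp: gset_hom_def T_def e simp flip: grp)
  ultimately have "gset_over Z T"
    by (simp add: gset_over_def T_def)
  moreover have "iso_over S T"
    unfolding iso_over_def
  proof (intro bexI[of _ e] conjI ballI)
    show "bij_betw e (pts (fst S)) (pts (fst T))"
      using e by (simp add: T_def inj_on_imp_bij_betw)
  qed (auto simp: T_def gset_hom_def e)
  ultimately show ?thesis by blast
qed

lemma over_class_nonempty: "gset_over Z S \<Longrightarrow> over_class Z S \<noteq> {}"
  using ex_nat_copy[of Z S] by (auto simp: over_class_def)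

lemma over_class_in_over_classes:
  assumes S: "gset_over Z S"
  shows "over_class Z S \<in> over_classes Z"
proof -
  obtain T :: "('a, nat, 'b) gset_over" where T: "gset_over Z T" "iso_over S T"
    using ex_nat_copy[OF S] by blast
  have grp: "grp (fst S) = grp (fst T)"
    using S T by (simp add: gset_over_def)
  have "over_class Z S = over_class Z T"
    using iso_over_trans[OF T(2)] iso_over_trans[OF iso_over_sym[OF T(2) S T(1)]] grp
    by (auto simp: over_class_def)
  then show ?thesis using T by (auto simp: over_classes_def)
qed

lemma keys_frag_relation:
  "a \<in> S \<Longrightarrow> b \<in> S \<Longrightarrow> c \<in> S \<Longrightarrow> Poly_Mapping.keys (frag_of a - frag_of b - frag_of c) \<subseteq> S"
  using keys_diff[of "frag_of a - frag_of b" "frag_of c"] keys_diff[of "frag_of a" "frag_of b"]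
  by (auto simp: keys_frag_of)

interpretation burnside: presentation "over_classes Z" "burnside_rels Z" for Z :: "('g, 'z) gset"
proof
  show "burnside_rels Z \<subseteq> carrier (free_Abelian_group (over_classes Z))"
  proof
    fix q assume "q \<in> burnside_rels Z"
    then obtain S T :: "('g, nat, 'z) gset_over" where
      "q = frag_of (over_class Z (over_sum S T)) - frag_of (over_class Z S) - frag_of (over_class Z T)"
      "gset_over Z S" "gset_over Z T"
      unfolding burnside_rels_def by blast
    then show "q \<in> carrier (free_Abelian_group (over_classes Z))"
      by (simp add: keys_frag_relation over_class_in_over_classes gset_over_sum)
  qed
qed

lemma tensor_presentation:
  assumes "group G"
  shows "presentation (tensor_gens G) (tensor_rels G)"
proof
  interpret group G by fact
  show "tensor_rels G \<subseteq> carrier (free_Abelian_group (tensor_gens G))"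
    unfolding tensor_rels_def
    by (rule subsetI, elim UnE CollectE exE conjE) (simp_all add: keys_frag_relation tensor_gens_def)
qed

interpretation tensor: presentation "tensor_gens (burnside_group Z)" "tensor_rels (burnside_group Z)"
  for Z :: "('g, 'z) gset"
  by (rule tensor_presentation) (simp add: burnside_group_def burnside.group_presented)

section \<open>Coefficients of classes, Burnside elements and morphisms\<close>

definition class_coef where
  "class_coef B A s O' c = of_nat (coef B A (SOME V. V \<in> c) s O')"

definition burnside_coef where
  "burnside_coef B A s O' b = frag_eval (class_coef B A s O') (SOME p. p \<in> b)"

text \<open>Hom groups are built in three layers: isomorphism classes, formal sums and tensors. At
  each layer the coefficient is read off from an arbitrary member, and independence of this choice
  is shown afterwards. A tensor of r and b gets r times the coefficient of b.\<close>

definition mor_coef ::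
    "('h, 'y) gset \<Rightarrow> ('g, 'x) gset \<Rightarrow> 'x \<times> 'g set \<times> 'g set \<Rightarrow> ('y \<times> 'h set \<times> 'h set) set \<Rightarrow>
     ('r::comm_ring_1, 'h, 'g, 'y, 'x) mor \<Rightarrow> 'r" where
  "mor_coef B A s O' \<phi> = frag_eval (\<lambda>(r, b). r * burnside_coef B A s O' b) (SOME p. p \<in> \<phi>)"

locale coef_setting = B: fin_gset B + A: fin_gset A + K: group K
  for K :: "'k monoid" and B :: "('h, 'y) gset" and A :: "('g, 'x) gset" +
  fixes s :: "'x \<times> 'g set \<times> 'g set"
  assumes s: "s \<in> sections K A"
begin

lemma spanI: "gset_over (prod_gset B A) V \<Longrightarrow> span B A V"
  by unfold_locales

lemma coef_over_class:
  assumes S: "gset_over (prod_gset B A) S" and V: "V \<in> over_class (prod_gset B A) S"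
  shows "coef B A V s O' = coef B A S s O'"
  using V coef_iso[OF spanI[OF S] spanI _ K.is_group s, of V O'] by (auto simp: over_class_def)

lemma class_coef_over_class:
  assumes S: "gset_over (prod_gset B A) S"
  shows "class_coef B A s O' (over_class (prod_gset B A) S) = of_nat (coef B A S s O')"
proof -
  have "(SOME V. V \<in> over_class (prod_gset B A) S) \<in> over_class (prod_gset B A) S"
    using over_class_nonempty[OF S] some_in_eq by blast
  then show ?thesis
    using coef_over_class[OF S] by (simp add: class_coef_def)
qed

lemma class_coef_rels:
  assumes "q \<in> burnside_rels (prod_gset B A)"
  shows "frag_eval (class_coef B A s O') q = 0"
proof -
  obtain S T :: "('h, 'g, nat, 'y, 'x) span" where
    q: "q = frag_of (over_class (prod_gset B A) (over_sum S T)) - frag_of (over_class (prod_gset B A) S) -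
      frag_of (over_class (prod_gset B A) T)" and ST: "gset_over (prod_gset B A) S" "gset_over (prod_gset B A) T"
    using assms by (auto simp: burnside_rels_def)
  show ?thesis
    using gset_over_sum[OF ST] ST coef_sum[OF spanI[OF ST(1)] spanI[OF ST(2)] K.is_group s]
    by (simp add: q class_coef_over_class)
qed

lemma burnside_coef_eq:
  assumes "b \<in> carrier (burnside_group (prod_gset B A))" "p \<in> b"
  shows "burnside_coef B A s O' b = frag_eval (class_coef B A s O') p"
proof -
  have "(SOME p. p \<in> b) \<in> b" using assms(2) by (rule someI)
  then show ?thesis
    unfolding burnside_coef_def using assms class_coef_rels
    by (intro burnside.frag_eval_carrier_presented) (auto simp: burnside_group_def)
qed

lemma burnside_coef_class:
  assumes "Poly_Mapping.keys x \<subseteq> over_classes (prod_gset B A)"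
  shows "burnside_coef B A s O' (burnside_class (prod_gset B A) x) = frag_eval (class_coef B A s O') x"
  using assms by (intro burnside_coef_eq)
    (auto simp: burnside_group_def burnside_class_def burnside.carrier_presented burnside.presented_class_self)

text \<open>The relations in the ring variable hold by distributivity, those in the Burnside
  variable because each member of a product of cosets is a sum of members.\<close>

lemma mor_coef_rels:
  fixes q :: "'r::comm_ring_1 \<times> ('h, 'g, 'y, 'x) burnside_elt \<Rightarrow>\<^sub>0 int"
  assumes "q \<in> tensor_rels (burnside_group (prod_gset B A))"
  shows "frag_eval (\<lambda>(r, b). r * burnside_coef B A s O' b) q = 0"
proof -
  have "burnside_coef B A s O' (b \<otimes>\<^bsub>burnside_group (prod_gset B A)\<^esub> c) =
      (burnside_coef B A s O' b + burnside_coef B A s O' c :: 'r)"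
    if bc: "b \<in> carrier (burnside_group (prod_gset B A))" "c \<in> carrier (burnside_group (prod_gset B A))" for b c
  proof -
    interpret group "burnside_group (prod_gset B A)"
      by (simp add: burnside_group_def burnside.group_presented)
    have m: "b \<otimes>\<^bsub>burnside_group (prod_gset B A)\<^esub> c \<in> carrier (burnside_group (prod_gset B A))"
      using bc by simp
    then obtain z where z: "z \<in> b \<otimes>\<^bsub>burnside_group (prod_gset B A)\<^esub> c"
      using burnside.carrier_presented_nonempty unfolding burnside_group_def by blast
    obtain x y where xy: "x \<in> b" "y \<in> c" "z = x + y"
      using z burnside.in_mult_presented unfolding burnside_group_def by blast
    show ?thesis
      by (simp add: burnside_coef_eq[OF m z] burnside_coef_eq[OF bc(1) xy(1)]
          burnside_coef_eq[OF bc(2) xy(2)] xy(3))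
  qed
  then show ?thesis
    using assms unfolding tensor_rels_def
    by (elim UnE CollectE exE conjE) (simp_all add: distrib_left distrib_right)
qed

lemma mor_coef_eq:
  assumes "\<phi> \<in> Hom_CR A B" "p \<in> \<phi>"
  shows "mor_coef B A s O' \<phi> = frag_eval (\<lambda>(r, b). r * burnside_coef B A s O' b) p"
proof -
  have "(SOME p. p \<in> \<phi>) \<in> \<phi>" using assms(2) by (rule someI)
  then show ?thesis
    unfolding mor_coef_def using assms mor_coef_rels
    by (intro tensor.frag_eval_carrier_presented) (auto simp: Hom_CR_def tensor_group_def)
qed

end

lemma mor_coef_id:
  fixes A :: "('g, 'x) gset" and K :: "'k monoid"
  assumes A: "finite_gset A" and K: "group K" and s: "s \<in> sections K A"
    and O': "O' \<in> sections K A // section_rel K A"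
  shows "mor_coef A A s O' (id_CR A) = (if s \<in> O' then 1 else 0 :: 'r::comm_ring_1)"
proof -
  interpret A: fin_gset A by standard fact
  interpret coef_setting K A A s
    using K s by (simp add: coef_setting_def coef_setting_axioms_def A.fin_gset_axioms)
  let ?c = "over_class (prod_gset A A) (id_span A)"
  let ?b = "burnside_class (prod_gset A A) (frag_of ?c)"
  let ?p = "frag_of (1 :: 'r, ?b)"
  have c: "Poly_Mapping.keys (frag_of ?c) \<subseteq> over_classes (prod_gset A A)"
    using over_class_in_over_classes[OF A.gset_over_id_span] by (simp add: keys_frag_of)
  then have "?b \<in> carrier (burnside_group (prod_gset A A))"
    by (auto simp: burnside_group_def burnside_class_def burnside.carrier_presented)
  then have p: "Poly_Mapping.keys ?p \<subseteq> tensor_gens (burnside_group (prod_gset A A))"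
    by (simp add: keys_frag_of tensor_gens_def)
  have id: "id_CR A = tensor_class (burnside_group (prod_gset A A)) ?p"
    by (simp add: id_CR_def)
  have "(id_CR A :: ('r, 'g, 'g, 'x, 'x) mor) \<in> Hom_CR A A" "?p \<in> id_CR A"
    using p tensor.presented_class_self
    by (auto simp: id Hom_CR_def tensor_group_def tensor_class_def tensor.carrier_presented)
  then have "mor_coef A A s O' (id_CR A :: ('r, 'g, 'g, 'x, 'x) mor) = burnside_coef A A s O' ?b"
    by (simp add: mor_coef_eq[of _ ?p])
  also have "\<dots> = of_nat (coef A A (id_span A) s O')"
    by (simp add: burnside_coef_class[OF c] class_coef_over_class[OF A.gset_over_id_span])
  also have "\<dots> = (if s \<in> O' then 1 else 0)"
    by (simp add: A.coef_id_span[OF K s O'])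
  finally show ?thesis .
qed

section \<open>Composition of morphisms as multiplication of matrices\<close>

locale comp_setting = C: fin_gset C + BA: coef_setting K B A s
  for K :: "'k monoid" and C :: "('l, 'z) gset" and B :: "('h, 'y) gset" and A :: "('g, 'x) gset" and s +
  fixes rep :: "('y \<times> 'h set \<times> 'h set) set \<Rightarrow> 'y \<times> 'h set \<times> 'h set"
    and O'' :: "('z \<times> 'l set \<times> 'l set) set"
  assumes rep: "\<And>O'. O' \<in> sections K B // section_rel K B \<Longrightarrow> rep O' \<in> O'"
    and O'': "O'' \<in> sections K C // section_rel K C"
begin

abbreviation "J \<equiv> sections K B // section_rel K B"

lemma rep_sections: "j \<in> J \<Longrightarrow> rep j \<in> sections K B"
  using rep in_quotient_imp_subset[OF BA.B.equiv_section_rel] by blast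

lemma CB: "j \<in> J \<Longrightarrow> coef_setting K C B (rep j)"
  using rep_sections by (intro coef_setting.intro coef_setting_axioms.intro
      C.fin_gset_axioms BA.B.fin_gset_axioms BA.K.is_group)

sublocale CA: coef_setting K C A s
  by (intro coef_setting.intro coef_setting_axioms.intro C.fin_gset_axioms BA.A.fin_gset_axioms
      BA.K.is_group BA.s)

text \<open>The composite of two classes is a union over all choices of representatives. Each of its
  elements is isomorphic to a composite of representatives, whose coefficients are those of the
  fixed spans \<open>S\<close> and \<open>T\<close>, so the formula holds for whichever element is
  picked.\<close>

lemma class_coef_comp:
  assumes c: "c \<in> over_classes (prod_gset C B)" and d: "d \<in> over_classes (prod_gset B A)"
  shows "class_coef C A s O'' (span_class_comp C B A c d) =
    (\<Sum>j\<in>J. class_coef C B (rep j) O'' c * class_coef B A s j d :: 'r::comm_ring_1)"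
proof -
  obtain S :: "('l, 'h, nat, 'z, 'y) span" where S: "gset_over (prod_gset C B) S" "c = over_class (prod_gset C B) S"
    using c unfolding over_classes_def by blast
  obtain T :: "('h, 'g, nat, 'y, 'x) span" where T: "gset_over (prod_gset B A) T" "d = over_class (prod_gset B A) T"
    using d unfolding over_classes_def by blast
  have comp: "composable C B A V U" if "V \<in> c" "U \<in> d" for V U
    using that S T
    by (auto simp: over_class_def composable_def span_def span_axioms_def C.fin_gset_axioms
        BA.B.fin_gset_axioms BA.A.fin_gset_axioms)
  have Z: "of_nat (coef C A Z s O'') = (\<Sum>j\<in>J. class_coef C B (rep j) O'' c * class_coef B A s j d :: 'r)"
    if Z: "Z \<in> span_class_comp C B A c d" for Z
  proof -
    obtain V U where VU: "V \<in> c" "U \<in> d" "Z \<in> over_class (prod_gset C A) (span_comp C B A V U)"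
      using Z by (auto simp: span_class_comp_def)
    interpret composable C B A V U by (rule comp) (use VU in auto)
    have "coef C B V (rep j) O'' = coef C B S (rep j) O''" if "j \<in> J" for j
      using coef_setting.coef_over_class[OF CB[OF that] S(1), of V] VU(1) S(2) by simp
    moreover have "coef B A U s j = coef B A T s j" for j
      using BA.coef_over_class[OF T(1), of U] VU(2) T(2) by simp
    ultimately have "coef C A (span_comp C B A V U) s O'' = (\<Sum>j\<in>J. coef B A T s j * coef C B S (rep j) O'')"
      using coef_comp[OF BA.K.is_group BA.s O'' rep] by simp
    then show ?thesis
      by (simp add: CA.coef_over_class[OF gset_over_W VU(3)] S(2) T(2) mult.commute
          coef_setting.class_coef_over_class[OF CB S(1)] BA.class_coef_over_class[OF T(1)])
  qed
  obtain V U where VU: "V \<in> c" "U \<in> d"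
    using over_class_nonempty[OF S(1)] over_class_nonempty[OF T(1)] S(2) T(2) by blast
  interpret composable C B A V U by (rule comp) fact+
  have "span_class_comp C B A c d \<noteq> {}"
    using VU over_class_nonempty[OF gset_over_W] by (auto simp: span_class_comp_def)
  then have "(SOME Z. Z \<in> span_class_comp C B A c d) \<in> span_class_comp C B A c d"
    using some_in_eq by blast
  then show ?thesis by (simp add: class_coef_def Z)
qed

lemma burnside_coef_comp:
  assumes b: "b \<in> carrier (burnside_group (prod_gset C B))" and c: "c \<in> carrier (burnside_group (prod_gset B A))"
  shows "burnside_coef C A s O'' (burnside_comp C B A b c) =
    (\<Sum>j\<in>J. burnside_coef C B (rep j) O'' b * burnside_coef B A s j c :: 'r::comm_ring_1)"
proof -
  let ?F = "\<lambda>C1 C2. frag_of (span_class_comp C B A C1 C2)"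
  let ?S = "\<Sum>j\<in>J. burnside_coef C B (rep j) O'' b * burnside_coef B A s j c :: 'r"
  \<comment> \<open>The formula is checked on every element of the union that defines the composite;
    the element chosen by \<open>burnside_coef\<close> is one of them since the union is
    nonempty.\<close>
  have z: "frag_eval (class_coef C A s O'') z = ?S" if zc: "z \<in> burnside_comp C B A b c" for z
  proof -
    obtain p q where pq: "p \<in> b" "q \<in> c" "z \<in> burnside_class (prod_gset C A) (biextend ?F p q)"
      using zc unfolding burnside_comp_def by blast
    have "frag_eval (class_coef C A s O'') z = frag_eval (class_coef C A s O'') (biextend ?F p q)"
      using pq(3) unfolding burnside_class_def
      by (intro burnside.frag_eval_presented_class[OF CA.class_coef_rels])
    also have "\<dots> = (\<Sum>j\<in>J. frag_eval (class_coef C B (rep j) O'') p * frag_eval (class_coef B A s j) q)"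
    proof (rule frag_eval_biextend)
      show "Poly_Mapping.keys p \<subseteq> over_classes (prod_gset C B)"
        using burnside.carrier_presented_keys b pq(1) unfolding burnside_group_def by blast
      show "Poly_Mapping.keys q \<subseteq> over_classes (prod_gset B A)"
        using burnside.carrier_presented_keys c pq(2) unfolding burnside_group_def by blast
    qed (simp add: class_coef_comp)
    also have "\<dots> = ?S"
      by (simp add: coef_setting.burnside_coef_eq[OF CB b pq(1)] BA.burnside_coef_eq[OF c pq(2)])
    finally show ?thesis .
  qed
  obtain p q where pq: "p \<in> b" "q \<in> c"
    using burnside.carrier_presented_nonempty[OF b[unfolded burnside_group_def]]
      burnside.carrier_presented_nonempty[OF c[unfolded burnside_group_def]] by blast
  have "biextend ?F p q \<in> burnside_comp C B A b c"
    unfolding burnside_comp_def burnside_class_def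
    by (rule UN_I[OF pq(1)], rule UN_I[OF pq(2)]) (rule burnside.presented_class_self)
  then have "(SOME z. z \<in> burnside_comp C B A b c) \<in> burnside_comp C B A b c"
    by (rule someI)
  then show ?thesis by (simp add: burnside_coef_def z)
qed

lemma mor_coef_comp:
  assumes \<psi>: "\<psi> \<in> Hom_CR B C" and \<phi>: "\<phi> \<in> Hom_CR A B"
  shows "mor_coef C A s O'' (comp_CR C B A \<psi> \<phi>) =
    (\<Sum>j\<in>J. mor_coef C B (rep j) O'' \<psi> * mor_coef B A s j \<phi> :: 'r::comm_ring_1)"
proof -
  let ?F = "\<lambda>(r, b) (s, c). frag_of (r * s, burnside_comp C B A b c)"
  let ?f = "\<lambda>(r :: 'r, b). r * burnside_coef C A s O'' b"
  let ?S = "\<Sum>j\<in>J. mor_coef C B (rep j) O'' \<psi> * mor_coef B A s j \<phi>"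
  have z: "frag_eval ?f z = ?S" if zc: "z \<in> comp_CR C B A \<psi> \<phi>" for z
  proof -
    obtain p q where pq: "p \<in> \<psi>" "q \<in> \<phi>"
        "z \<in> tensor_class (burnside_group (prod_gset C A)) (biextend ?F p q)"
      using zc unfolding comp_CR_def by blast
    have "frag_eval ?f z = frag_eval ?f (biextend ?F p q)"
      using pq(3) unfolding tensor_class_def
      by (intro tensor.frag_eval_presented_class[OF CA.mor_coef_rels])
    also have "\<dots> = (\<Sum>j\<in>J. frag_eval (\<lambda>(r, b). r * burnside_coef C B (rep j) O'' b) p *
        frag_eval (\<lambda>(r, b). r * burnside_coef B A s j b) q)"
    proof (rule frag_eval_biextend)
      show "Poly_Mapping.keys p \<subseteq> tensor_gens (burnside_group (prod_gset C B))"
        using tensor.carrier_presented_keys \<psi> pq(1) unfolding Hom_CR_def tensor_group_def by blast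
      show "Poly_Mapping.keys q \<subseteq> tensor_gens (burnside_group (prod_gset B A))"
        using tensor.carrier_presented_keys \<phi> pq(2) unfolding Hom_CR_def tensor_group_def by blast
    qed (auto simp: tensor_gens_def burnside_coef_comp sum_distrib_left mult_ac)
    also have "\<dots> = ?S"
      by (simp add: coef_setting.mor_coef_eq[OF CB \<psi> pq(1)] BA.mor_coef_eq[OF \<phi> pq(2)])
    finally show ?thesis .
  qed
  obtain p q where pq: "p \<in> \<psi>" "q \<in> \<phi>"
    using tensor.carrier_presented_nonempty[OF \<psi>[unfolded Hom_CR_def tensor_group_def]]
      tensor.carrier_presented_nonempty[OF \<phi>[unfolded Hom_CR_def tensor_group_def]] by blast
  have "biextend ?F p q \<in> comp_CR C B A \<psi> \<phi>"
    unfolding comp_CR_def tensor_class_def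
    by (rule UN_I[OF pq(1)], rule UN_I[OF pq(2)]) (rule tensor.presented_class_self)
  then have "(SOME z. z \<in> comp_CR C B A \<psi> \<phi>) \<in> comp_CR C B A \<psi> \<phi>"
    by (rule someI)
  then show ?thesis by (simp add: mor_coef_def z)
qed

end

lemma comp_settingI:
  assumes "finite_gset C" "finite_gset B" "finite_gset A" "group K" "s \<in> sections K A"
    and "\<And>O'. O' \<in> sections K B // section_rel K B \<Longrightarrow> rep O' \<in> O'"
    and "O'' \<in> sections K C // section_rel K C"
  shows "comp_setting K C B A s rep O''"
  using assms by (simp add: comp_setting_def comp_setting_axioms_def coef_setting_def
      coef_setting_axioms_def fin_gset_def)

text \<open>The matrices of mutually inverse morphisms are inverse to each other. The row of a class
  is taken at a chosen representative, which lies in no other class, so that identities give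
  identity matrices.\<close>

lemma isomorphic_CR_card_section_classes:
  fixes A :: "('g, 'x) gset" and B :: "('h, 'y) gset" and K :: "'k monoid"
  assumes iso: "isomorphic_CR TYPE('r::comm_ring_1) A B"
    and fin: "finite_gset A" "finite_gset B" and K: "group K"
  shows "card (sections K A // section_rel K A) = card (sections K B // section_rel K B)"
proof -
  interpret A: fin_gset A by standard fact
  interpret B: fin_gset B by standard fact
  let ?I = "sections K A // section_rel K A" and ?J = "sections K B // section_rel K B"
  obtain \<phi> :: "('r, 'h, 'g, 'y, 'x) mor" and \<psi> :: "('r, 'g, 'h, 'x, 'y) mor" where
    hom: "\<phi> \<in> Hom_CR A B" "\<psi> \<in> Hom_CR B A"
    and inv: "comp_CR A B A \<psi> \<phi> = id_CR A" "comp_CR B A B \<phi> \<psi> = id_CR B"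
    using iso by (auto simp: isomorphic_CR_def)
  define rA where "rA i = (SOME s. s \<in> i)" for i :: "('x \<times> 'g set \<times> 'g set) set"
  define rB where "rB i = (SOME s. s \<in> i)" for i :: "('y \<times> 'h set \<times> 'h set) set"
  have rA: "rA i \<in> i" if "i \<in> ?I" for i
    using in_quotient_imp_non_empty[OF A.equiv_section_rel that] some_in_eq unfolding rA_def by blast
  have rB: "rB i \<in> i" if "i \<in> ?J" for i
    using in_quotient_imp_non_empty[OF B.equiv_section_rel that] some_in_eq unfolding rB_def by blast
  have sA: "rA i \<in> sections K A" if "i \<in> ?I" for i
    using rA[OF that] in_quotient_imp_subset[OF A.equiv_section_rel that] by blast
  have sB: "rB i \<in> sections K B" if "i \<in> ?J" for i
    using rB[OF that] in_quotient_imp_subset[OF B.equiv_section_rel that] by blast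
  have memA: "rA i \<in> k \<longleftrightarrow> i = k" if "i \<in> ?I" "k \<in> ?I" for i k
    using rA[OF that(1)] quotient_disj[OF A.equiv_section_rel that] by blast
  have memB: "rB i \<in> k \<longleftrightarrow> i = k" if "i \<in> ?J" "k \<in> ?J" for i k
    using rB[OF that(1)] quotient_disj[OF B.equiv_section_rel that] by blast
  show ?thesis
  proof (rule card_eq_of_inverse_matrices[where P = "\<lambda>i j. mor_coef B A (rA i) j \<phi>"
        and Q = "\<lambda>j k. mor_coef A B (rB j) k \<psi>"])
    show "finite ?I" "finite ?J"
      using finite_quotient[OF A.finite_sections equiv_type[OF A.equiv_section_rel]]
        finite_quotient[OF B.finite_sections equiv_type[OF B.equiv_section_rel]] by blast+
    show "(\<Sum>j\<in>?J. mor_coef B A (rA i) j \<phi> * mor_coef A B (rB j) k \<psi>) = (if i = k then 1 else 0)"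
      if ik: "i \<in> ?I" "k \<in> ?I" for i k
    proof -
      interpret comp_setting K A B A "rA i" rB k
        by (rule comp_settingI) (use fin K sA rB ik in auto)
      have "mor_coef A A (rA i) k (id_CR A :: ('r, 'g, 'g, 'x, 'x) mor) = (if i = k then 1 else 0)"
        by (simp add: mor_coef_id[OF fin(1) K sA[OF ik(1)] ik(2)] memA[OF ik])
      then show ?thesis
        using mor_coef_comp[OF hom(2,1)] by (simp add: inv mult.commute)
    qed
    show "(\<Sum>j\<in>?I. mor_coef A B (rB i) j \<psi> * mor_coef B A (rA j) k \<phi>) = (if i = k then 1 else 0)"
      if ik: "i \<in> ?J" "k \<in> ?J" for i k
    proof -
      interpret comp_setting K B A B "rB i" rA k
        by (rule comp_settingI) (use fin K sB rA ik in auto)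
      have "mor_coef B B (rB i) k (id_CR B :: ('r, 'h, 'h, 'y, 'y) mor) = (if i = k then 1 else 0)"
        by (simp add: mor_coef_id[OF fin(2) K sB[OF ik(1)] ik(2)] memB[OF ik])
      then show ?thesis
        using mor_coef_comp[OF hom] by (simp add: inv mult.commute)
    qed
  qed
qed

subsection \<open>Classes of sections of a group\<close>

text \<open>The reversed graph of h is a subgroup of M x L that transports every section of L, and
  its converse image is the image under h. So \<open>preimage_quotient\<close> applies; conjugations
  and isomorphisms between groups are both treated this way.\<close>

lemma iso_section:
  assumes grp: "group L" "group M" and h: "h \<in> iso L M" and K: "group K"
    and S: "subgroup S L" and \<theta>: "\<exists>\<theta>\<in>hom (L\<lparr>carrier := S\<rparr>) K. \<theta> ` S = carrier K \<and> N = {s\<in>S. \<theta> s = \<one>\<^bsub>K\<^esub>}"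
  shows "subgroup (h ` S) M"
    and "\<exists>\<theta>\<in>hom (M\<lparr>carrier := h ` S\<rparr>) K. \<theta> ` h ` S = carrier K \<and>
      h ` N = {s\<in>h ` S. \<theta> s = \<one>\<^bsub>K\<^esub>}"
proof -
  let ?D = "{(h a, a) | a. a \<in> carrier L}"
  interpret h: group_hom L M h
    using grp h by (auto simp: group_hom_def group_hom_axioms_def iso_def)
  have inj: "inj_on h (carrier L)"
    using h by (auto simp: iso_def bij_betw_def)
  have "subgroup ?D (M \<times>\<times> L)"
  proof (rule group.subgroupI)
    show "group (M \<times>\<times> L)"
      by (intro DirProd_group grp)
    show "inv\<^bsub>M \<times>\<times> L\<^esub> x \<in> ?D" if "x \<in> ?D" for x
      using that grp by auto
    show "x \<otimes>\<^bsub>M \<times>\<times> L\<^esub> y \<in> ?D" if "x \<in> ?D" "y \<in> ?D" for x y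
      using that by auto
  qed auto
  then interpret D: group_rel M L ?D
    using grp by (simp add: group_rel_def group_rel_axioms_def)
  have SL: "S \<subseteq> carrier L" using S by (rule subgroup.subset)
  have pre: "?D\<inverse> `` T = h ` T" if "T \<subseteq> carrier L" for T
    using that by auto
  obtain \<theta> where \<theta>': "\<theta> \<in> hom (L\<lparr>carrier := S\<rparr>) K" "\<theta> ` S = carrier K" "N = {s\<in>S. \<theta> s = \<one>\<^bsub>K\<^esub>}"
    using \<theta> by blast
  have NS: "N \<subseteq> S" using \<theta>' by blast
  have one: "\<one>\<^bsub>L\<^esub> \<in> N"
  proof -
    have "group_hom (L\<lparr>carrier := S\<rparr>) K \<theta>"
      using group.subgroup_imp_group[OF grp(1) S] K \<theta>'(1) by (simp add: group_hom_def group_hom_axioms_def)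
    then show ?thesis
      using group_hom.hom_one subgroup.one_closed[OF S] by (fastforce simp: \<theta>'(3))
  qed
  have "transports M L ?D S N"
    unfolding transports_def
  proof (intro conjI ballI impI)
    fix g assume g: "g \<in> S"
    show "\<exists>a. \<exists>n\<in>N. (a, g \<otimes>\<^bsub>L\<^esub> n) \<in> ?D"
      using g SL one by (intro exI[of _ "h g"] bexI[of _ "\<one>\<^bsub>L\<^esub>"]) auto
    assume "(\<one>\<^bsub>M\<^esub>, g) \<in> ?D"
    then have "h g = h \<one>\<^bsub>L\<^esub>" "g \<in> carrier L" by auto
    then have "g = \<one>\<^bsub>L\<^esub>"
      using inj_onD[OF inj, of g "\<one>\<^bsub>L\<^esub>"] by blast
    then show "g \<in> N" using one by simp
  qed
  then show "\<exists>\<theta>\<in>hom (M\<lparr>carrier := h ` S\<rparr>) K. \<theta> ` h ` S = carrier K \<and>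
      h ` N = {s\<in>h ` S. \<theta> s = \<one>\<^bsub>K\<^esub>}"
    using D.preimage_quotient[OF S K \<theta>'] pre[OF SL] pre[OF subset_trans[OF NS SL]] by simp
  show "subgroup (h ` S) M"
    using D.subgroup_preimage[OF S] pre[OF SL] by simp
qed

lemma (in group) conj_by_iso: "g \<in> carrier G \<Longrightarrow> conj_by G g \<in> iso G G"
  by (rule isoI) (auto simp: conj_by_hom intro!: homI bij_betw_byWitness[where f' = "conj_by G (inv g)"])

lemma (in fin_gset) conj_section_in_sections:
  assumes K: "group K" and s: "s \<in> sections K A" and g: "g \<in> carrier (grp A)"
  shows "conj_section A g s \<in> sections K A"
proof -
  obtain x S N where s': "s = (x, S, N)" by (cases s)
  note D = sectionsD[OF s[unfolded s']]
  have "act A (conj_by (grp A) g t) (act A g x) = act A g x" if "t \<in> S" for t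
  proof -
    have "act A (conj_by (grp A) g t) (act A g x) = act A (g \<otimes>\<^bsub>grp A\<^esub> t) x"
      using D that g by (simp add: conj_by_def grp.m_assoc flip: act_mult)
    then show ?thesis using D that g by (simp add: act_mult)
  qed
  then have "conj_by (grp A) g ` S \<subseteq> stabilizer (grp A) (act A) (act A g x)"
    using D g by (auto simp: stabilizer_def)
  moreover note iso_section[OF grp.is_group grp.is_group grp.conj_by_iso[OF g] K D(2), of N]
  ultimately show ?thesis
    using s D(1) g by (simp add: s' sections_def conj_section_def)
qed

section \<open>Counting the sections of a group\<close>

definition one_point :: "'g monoid \<Rightarrow> ('g, unit) gset" where
  "one_point L = \<lparr>grp = L, pts = {()}, act = (\<lambda>_. \<lambda>_\<in>{()}. ())\<rparr>"

text \<open>For L acting on a point, the classes of sections are the conjugacy classes of pairs (S,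
  N) in L with quotient K. The detour through a point makes the results on finite sets with action
  available for groups.\<close>

definition section_count :: "'k monoid \<Rightarrow> 'g monoid \<Rightarrow> nat" where
  "section_count K L = card (sections K (one_point L) // section_rel K (one_point L))"

lemma grp_one_point [simp]: "grp (one_point L) = L"
  by (simp add: one_point_def)

lemma finite_gset_one_point:
  "group L \<Longrightarrow> finite (carrier L) \<Longrightarrow> finite_gset (one_point L)"
  by (rule fin_gsetI) (auto simp: one_point_def)

lemma sections_one_point:
  "(x, S, N) \<in> sections K (one_point L) \<longleftrightarrow> subgroup S L \<and>
    (\<exists>\<theta>\<in>hom (L\<lparr>carrier := S\<rparr>) K. \<theta> ` S = carrier K \<and> N = {s\<in>S. \<theta> s = \<one>\<^bsub>K\<^esub>})"
  using subgroup.subset by (fastforce simp: sections_def one_point_def stabilizer_def)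

lemma iso_section_one_point:
  assumes "group L" "group M" "h \<in> iso L M" "group K" "(x, S, N) \<in> sections K (one_point L)"
  shows "(y, h ` S, h ` N) \<in> sections K (one_point M)"
  using iso_section[OF assms(1-4), of S N] assms(5) unfolding sections_one_point by blast

lemma conj_section_one_point:
  "conj_section (one_point L) g (x, S, N) = ((), conj_by L g ` S, conj_by L g ` N)"
  by (simp add: conj_section_def one_point_def)

lemma section_count_iso:
  fixes L :: "'g monoid" and M :: "'h monoid" and K :: "'k monoid"
  assumes L: "group L" "finite (carrier L)" and M: "group M" "finite (carrier M)"
    and "L \<cong> M" and K: "group K"
  shows "section_count K L = section_count K M"
proof -
  obtain h where h: "h \<in> iso L M" using \<open>L \<cong> M\<close> by (auto simp: is_iso_def)
  interpret oL: fin_gset "one_point L" by standard (rule finite_gset_one_point[OF L])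
  interpret oM: fin_gset "one_point M" by standard (rule finite_gset_one_point[OF M])
  interpret L: group L by fact
  interpret M: group M by fact
  interpret h: group_hom L M h
    using h by unfold_locales (simp add: iso_def)
  have bij: "bij_betw h (carrier L) (carrier M)" using h by (simp add: iso_def)
  let ?k = "inv_into (carrier L) h"
  have k: "?k \<in> iso M L" by (rule L.iso_set_sym[OF h])
  have hk: "h (?k y) = y" if "y \<in> carrier M" for y
    using bij_betw_inv_into_right[OF bij that] .
  have sub: "S \<subseteq> carrier L" "N \<subseteq> S" if "(x, S, N) \<in> sections K (one_point L)" for x S N
    using that subgroup.subset by (auto simp: sections_one_point)
  have hconj: "h (conj_by L g x) = conj_by M (h g) (h x)" if "g \<in> carrier L" "x \<in> carrier L" for g x
    using that by (simp add: conj_by_def)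
  let ?f = "\<lambda>(x :: unit, S, N). (x, h ` S, h ` N)"
  show ?thesis
    unfolding section_count_def
  proof (rule card_quotient_eq[OF oL.equiv_section_rel oM.equiv_section_rel])
    show f: "?f \<in> sections K (one_point L) \<rightarrow> sections K (one_point M)"
      using iso_section_one_point[OF L(1) M(1) h K] by (auto simp del: image_image)
    show "(s, t) \<in> section_rel K (one_point L) \<longleftrightarrow> (?f s, ?f t) \<in> section_rel K (one_point M)"
      if s: "s \<in> sections K (one_point L)" and t: "t \<in> sections K (one_point L)" for s t
    proof -
      obtain S N S' N' where st: "s = ((), S, N)" "t = ((), S', N')"
        by (cases s; cases t) auto
      note subs = sub[OF s[unfolded st]] sub[OF t[unfolded st]]
      have img: "h ` conj_by L g ` T = conj_by M (h g) ` h ` T" if "g \<in> carrier L" "T \<subseteq> S" for g T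
        unfolding image_image using that subs hconj by (intro image_cong) auto
      have eq: "h ` T = h ` T' \<longleftrightarrow> T = T'" if "T \<subseteq> carrier L" "T' \<subseteq> carrier L" for T T'
        using inj_on_image_eq_iff[OF bij_betw_imp_inj_on[OF bij] that] .
      have conj_sub: "conj_by L g ` T \<subseteq> carrier L" if "g \<in> carrier L" "T \<subseteq> S" for g T
        using that subs by auto
      have "(\<exists>g\<in>carrier L. S' = conj_by L g ` S \<and> N' = conj_by L g ` N) \<longleftrightarrow>
          (\<exists>g\<in>carrier L. h ` S' = conj_by M (h g) ` h ` S \<and> h ` N' = conj_by M (h g) ` h ` N)"
      proof (rule bex_cong[OF refl])
        fix g assume g: "g \<in> carrier L"
        show "(S' = conj_by L g ` S \<and> N' = conj_by L g ` N) \<longleftrightarrow>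
            (h ` S' = conj_by M (h g) ` h ` S \<and> h ` N' = conj_by M (h g) ` h ` N)"
          using eq[OF subs(3) conj_sub[OF g order.refl]] eq[OF subset_trans[OF subs(4,3)] conj_sub[OF g subs(2)]]
            img[OF g order.refl] img[OF g subs(2)] by simp
      qed
      \<comment> \<open>Conjugations by the elements h g are all the conjugations of M, because h is
        onto.\<close>
      also have "\<dots> \<longleftrightarrow> (\<exists>g\<in>carrier M. h ` S' = conj_by M g ` h ` S \<and> h ` N' = conj_by M g ` h ` N)"
        by (simp add: bij_betw_imp_surj_on[OF bij, symmetric])
      finally show ?thesis
        using s t funcset_mem[OF f s] funcset_mem[OF f t]
        by (simp add: st act_rel_def conj_section_one_point)
    qed
    show "\<exists>p\<in>sections K (one_point L). (?f p, q) \<in> section_rel K (one_point M)"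
      if q: "q \<in> sections K (one_point M)" for q
    proof -
      obtain S N where q': "q = ((), S, N)" by (cases q) auto
      have SN: "S \<subseteq> carrier M" "N \<subseteq> S"
        using q subgroup.subset by (auto simp: q' sections_one_point)
      have p: "((), ?k ` S, ?k ` N) \<in> sections K (one_point L)"
        using q iso_section_one_point[OF M(1) L(1) k K] unfolding q' by blast
      have "h ` ?k ` T = T" if "T \<subseteq> S" for T
        unfolding image_image using that SN hk by (subst image_cong[where g = id]) auto
      then have "?f ((), ?k ` S, ?k ` N) = q"
        using SN by (simp add: q')
      moreover have "(q, q) \<in> section_rel K (one_point M)"
        using oM.equiv_section_rel[of K] q by (simp add: equiv_def refl_on_def)
      ultimately show ?thesis
        using p by (intro bexI[of _ "((), ?k ` S, ?k ` N)"]) auto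
    qed
  qed
qed

lemma section_count_self:
  assumes K: "group K" "finite (carrier K)"
  shows "section_count K K > 0"
proof -
  interpret fin_gset "one_point K" by standard (rule finite_gset_one_point[OF K])
  interpret K: group K by fact
  \<comment> \<open>The whole group over its trivial subgroup, with the identity as the
    surjection.\<close>
  have "((), carrier K, {\<one>\<^bsub>K\<^esub>}) \<in> sections K (one_point K)"
    using K.subgroup_self by (auto simp: sections_one_point hom_def intro!: bexI[of _ id])
  then have "sections K (one_point K) // section_rel K (one_point K) \<noteq> {}"
    by (auto simp: quotient_def)
  moreover have "finite (sections K (one_point K) // section_rel K (one_point K))"
    by (rule finite_quotient[OF finite_sections equiv_type[OF equiv_section_rel]])
  ultimately show ?thesis by (simp add: section_count_def card_gt_0_iff)
qed

text \<open>The chain |K| \<le> |S| \<le> |L| \<le> |K| forces S = L and makes the surjection from S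
  to K injective.\<close>

lemma section_count_pos_iso:
  assumes K: "group K" and L: "group L" "finite (carrier L)"
    and pos: "section_count K L > 0" and le: "card (carrier L) \<le> card (carrier K)"
  shows "L \<cong> K"
proof -
  obtain s where "s \<in> sections K (one_point L)"
    using pos by (auto simp: section_count_def card_gt_0_iff quotient_def)
  then obtain S \<theta> where S: "subgroup S L" and \<theta>: "\<theta> \<in> hom (L\<lparr>carrier := S\<rparr>) K" "\<theta> ` S = carrier K"
    by (cases s) (auto simp: sections_one_point)
  have SL: "S \<subseteq> carrier L" using S by (rule subgroup.subset)
  have fin: "finite S" using SL L(2) by (rule finite_subset)
  have "card (carrier K) \<le> card S"
    using card_image_le[OF fin, of \<theta>] \<theta>(2) by simp
  moreover have "card S \<le> card (carrier L)"
    using card_mono[OF L(2) SL] .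
  ultimately have "S = carrier L" "card (\<theta> ` S) = card S"
    using card_subset_eq[OF L(2) SL] le \<theta>(2) by auto
  moreover from this have "inj_on \<theta> S" using fin by (simp add: eq_card_imp_inj_on)
  ultimately have "\<theta> \<in> iso L K"
    using \<theta> by (auto simp: iso_def bij_betw_def)
  then show ?thesis by (rule is_isoI)
qed

text \<open>Testing with groups of the families themselves produces an isomorphic pair. Its two
  members contribute equally to every count, so the hypotheses survive their removal. The two
  families may live over different types, hence the hypothesis for test groups over both.\<close>

lemma isomorphic_families:
  fixes L :: "'i \<Rightarrow> 'g monoid" and M :: "'j \<Rightarrow> 'h monoid"
  assumes "finite I" "finite J"
    and L: "\<And>i. i \<in> I \<Longrightarrow> group (L i) \<and> finite (carrier (L i))"
    and M: "\<And>j. j \<in> J \<Longrightarrow> group (M j) \<and> finite (carrier (M j))"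
    and "\<And>K :: 'g monoid. group K \<Longrightarrow> (\<Sum>i\<in>I. section_count K (L i)) = (\<Sum>j\<in>J. section_count K (M j))"
    and "\<And>K :: 'h monoid. group K \<Longrightarrow> (\<Sum>i\<in>I. section_count K (L i)) = (\<Sum>j\<in>J. section_count K (M j))"
  shows "\<exists>f. bij_betw f I J \<and> (\<forall>i\<in>I. L i \<cong> M (f i))"
  using assms
proof (induction "card I" arbitrary: I J)
  case 0
  then have "I = {}" by simp
  have "J = {}"
  proof (rule ccontr)
    assume "J \<noteq> {}"
    then obtain j where j: "j \<in> J" by blast
    have "(\<Sum>j'\<in>J. section_count (M j) (M j')) = 0"
      using "0.prems"(6)[of "M j"] "0.prems"(4)[OF j] \<open>I = {}\<close> by simp
    then show False
      using section_count_self[of "M j"] "0.prems"(2,4) j by auto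
  qed
  with \<open>I = {}\<close> show ?case by (auto simp: bij_betw_def)
next
  case (Suc n)
  note L = Suc.prems(3) and M = Suc.prems(4)
  have "I \<noteq> {}" using Suc.hyps(2) by auto
  define c where "c = Max ((\<lambda>i. card (carrier (L i))) ` I)"
  have c: "card (carrier (L i)) \<le> c" if "i \<in> I" for i
    unfolding c_def using that Suc.prems(1) by simp
  have "c \<in> (\<lambda>i. card (carrier (L i))) ` I"
    unfolding c_def using \<open>I \<noteq> {}\<close> Suc.prems(1) by (intro Max_in) auto
  then obtain i1 where i1: "i1 \<in> I" "card (carrier (L i1)) = c" by auto
  have "\<exists>i\<in>I. \<exists>j\<in>J. L i \<cong> M j"
  proof (cases "\<forall>j\<in>J. card (carrier (M j)) \<le> c")
    case True
    \<comment> \<open>Here \<open>L i1\<close> is at least as large as every group of both families.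
      It has itself as a quotient, so by equality of the counts some \<open>M j\<close> has a
      section with quotient \<open>L i1\<close> and, not being larger, is isomorphic to it.\<close>
    have "section_count (L i1) (L i1) \<le> (\<Sum>i\<in>I. section_count (L i1) (L i))"
      using Suc.prems(1) i1(1) by (intro member_le_sum) auto
    then have "(\<Sum>j\<in>J. section_count (L i1) (M j)) > 0"
      using Suc.prems(5)[of "L i1"] L[OF i1(1)] section_count_self[of "L i1"] by simp
    then obtain j where j: "j \<in> J" "section_count (L i1) (M j) > 0"
      by (auto simp: sum_eq_0_iff[OF Suc.prems(2)] simp flip: neq0_conv)
    then have "M j \<cong> L i1"
      using True i1 L M by (intro section_count_pos_iso) auto
    then show ?thesis
      using group.iso_sym M[OF j(1)] j(1) i1(1) by blast
  next
    case False
    then obtain j where j: "j \<in> J" "c < card (carrier (M j))" by force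
    \<comment> \<open>\<open>M j\<close> need not be largest in its own family, as only groups of
      the first family are compared with it. The isomorphism found in this case contradicts the
      orders, but it already has the form that is asked for.\<close>
    have "section_count (M j) (M j) \<le> (\<Sum>j'\<in>J. section_count (M j) (M j'))"
      using Suc.prems(2) j(1) by (intro member_le_sum) auto
    then have "(\<Sum>i\<in>I. section_count (M j) (L i)) > 0"
      using Suc.prems(6)[of "M j"] M[OF j(1)] section_count_self[of "M j"] by simp
    then obtain i where i: "i \<in> I" "section_count (M j) (L i) > 0"
      by (auto simp: sum_eq_0_iff[OF Suc.prems(1)] simp flip: neq0_conv)
    have "card (carrier (L i)) \<le> card (carrier (M j))"
      using c[OF i(1)] j(2) by simp
    then have "L i \<cong> M j"
      using i j L M by (intro section_count_pos_iso) auto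
    then show ?thesis using i(1) j(1) by blast
  qed
  then obtain i j where ij: "i \<in> I" "j \<in> J" "L i \<cong> M j" by blast
  \<comment> \<open>K gets a type of its own, because the cancelled identity is needed for the test
    groups over both types.\<close>
  have rest: "(\<Sum>i\<in>I - {i}. section_count K (L i)) = (\<Sum>j\<in>J - {j}. section_count K (M j))"
    if "(\<Sum>i\<in>I. section_count K (L i)) = (\<Sum>j\<in>J. section_count K (M j))" "group K" for K :: "'k monoid"
    using that ij L M Suc.prems(1,2) section_count_iso[of "L i" "M j" K]
    by (simp add: sum.remove[of I i] sum.remove[of J j])
  have "\<exists>f. bij_betw f (I - {i}) (J - {j}) \<and> (\<forall>i'\<in>I - {i}. L i' \<cong> M (f i'))"
    using Suc.hyps(2) Suc.prems ij
    by (intro Suc.hyps(1)) (auto intro!: rest)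
  then obtain f where f: "bij_betw f (I - {i}) (J - {j})" "\<forall>i'\<in>I - {i}. L i' \<cong> M (f i')" by blast
  have "bij_betw (f(i := j)) I J"
  proof -
    have "bij_betw (f(i := j)) (I - {i}) (J - {j})"
      using f(1) by (subst bij_betw_cong[where g = f]) auto
    moreover have "bij_betw (f(i := j)) {i} {j}" by (simp add: bij_betw_def)
    ultimately have "bij_betw (f(i := j)) (I - {i} \<union> {i}) (J - {j} \<union> {j})"
      by (rule bij_betw_combine) auto
    then show ?thesis using ij by (simp add: insert_absorb)
  qed
  moreover have "\<forall>i'\<in>I. L i' \<cong> M ((f(i := j)) i')"
    using f(2) ij(3) by auto
  ultimately show ?case by blast
qed

section \<open>Sections over the orbits of a finite set\<close>

context fin_gset
begin

text \<open>Every section over the orbit is conjugate to one at x, and a group element that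
  conjugates one section at x into another fixes x. So the classes over the orbit are the conjugacy
  classes of sections of the stabilizer.\<close>

lemma card_section_classes_over_orbit:
  assumes K: "group K" and orb: "orb \<in> orbits (grp A) (pts A) (act A)" and x: "x \<in> orb"
  shows "card ({s\<in>sections K A. fst s \<in> orb} // Restr (section_rel K A) {s\<in>sections K A. fst s \<in> orb}) =
    section_count K (grp A\<lparr>carrier := stabilizer (grp A) (act A) x\<rparr>)"
proof -
  define S0 where "S0 = stabilizer (grp A) (act A) x"
  let ?L = "grp A\<lparr>carrier := S0\<rparr>"
  let ?P = "{s\<in>sections K A. fst s \<in> orb}"
  have closed: "y \<in> pts A \<and> (\<exists>g\<in>carrier (grp A). y = act A g x)" if y: "y \<in> orb" for y
  proof -
    obtain z where z: "z \<in> pts A" "orb = orbit (grp A) (act A) z"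
      using orb by (auto simp: orbits_def)
    obtain g where g: "g \<in> carrier (grp A)" "x = act A g z"
      using x z by (auto simp: orbit_def)
    obtain h where h: "h \<in> carrier (grp A)" "y = act A h z"
      using y z by (auto simp: orbit_def)
    have "y = act A (h \<otimes>\<^bsub>grp A\<^esub> inv\<^bsub>grp A\<^esub> g) x"
      using z(1) g h by (simp add: act_mult)
    then show ?thesis using z(1) g h by auto
  qed
  have xA: "x \<in> pts A" using closed[OF x] by blast
  have S0: "subgroup S0 (grp A)"
    unfolding S0_def by (rule stabilizer_subgroup[OF xA])
  have S0A: "S0 \<subseteq> carrier (grp A)" using S0 by (rule subgroup.subset)
  have L: "group ?L" by (rule grp.subgroup_imp_group[OF S0])
  interpret oL: fin_gset "one_point ?L"
    by standard (rule finite_gset_one_point[OF L], use finite_subset[OF S0A finite_carrier] in simp)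
  have sub: "subgroup S ?L \<longleftrightarrow> subgroup S (grp A) \<and> S \<subseteq> S0" for S
    using grp.subgroup_incl[OF _ S0] grp.incl_subgroup[OF S0] subgroup.subset[of S ?L] by auto
  have sec: "(x, S, N) \<in> sections K A \<longleftrightarrow> ((), S, N) \<in> sections K (one_point ?L)" for S N
    using xA unfolding sections_one_point sub by (auto simp: sections_def simp flip: S0_def)
  have R: "Restr (section_rel K A) ?P = act_rel (carrier (grp A)) (conj_section A) ?P"
    by (rule Restr_act_rel) blast
  have eP: "equiv ?P (Restr (section_rel K A) ?P)"
    by (rule equiv_Restr[OF equiv_section_rel]) blast
  have cj: "conj_by ?L g ` T = conj_by (grp A) g ` T" if "g \<in> S0" for g T
    using that by (simp add: conj_by_def grp.m_inv_consistent[OF S0])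
  have "card (sections K (one_point ?L) // section_rel K (one_point ?L)) = card (?P // Restr (section_rel K A) ?P)"
  proof (rule card_quotient_eq[OF oL.equiv_section_rel eP, of "\<lambda>(_, S, N). (x, S, N)"])
    show "(\<lambda>(_, S, N). (x, S, N)) \<in> sections K (one_point ?L) \<rightarrow> ?P"
      using sec x by auto
    show "(s, t) \<in> section_rel K (one_point ?L) \<longleftrightarrow>
        ((case s of (_, S, N) \<Rightarrow> (x, S, N)), (case t of (_, S, N) \<Rightarrow> (x, S, N))) \<in> Restr (section_rel K A) ?P"
      if st: "s \<in> sections K (one_point ?L)" "t \<in> sections K (one_point ?L)" for s t
    proof -
      obtain S N S' N' where s: "s = ((), S, N)" and t: "t = ((), S', N')"
        by (cases s; cases t) auto
      have P: "(x, S, N) \<in> ?P" "(x, S', N') \<in> ?P"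
        using st sec x by (auto simp: s t)
      have "(\<exists>g\<in>S0. S' = conj_by ?L g ` S \<and> N' = conj_by ?L g ` N) \<longleftrightarrow>
          (\<exists>g\<in>S0. S' = conj_by (grp A) g ` S \<and> N' = conj_by (grp A) g ` N)"
        by (rule bex_cong[OF refl]) (simp add: cj)
      also have "\<dots> \<longleftrightarrow> (\<exists>g\<in>carrier (grp A). x = act A g x \<and> S' = conj_by (grp A) g ` S \<and> N' = conj_by (grp A) g ` N)"
        unfolding S0_def stabilizer_def by (auto simp: eq_commute[of _ x])
      finally show ?thesis
        unfolding R using st P by (simp add: s t act_rel_def conj_section_one_point conj_section_def)
    qed
    fix q assume q: "q \<in> ?P"
    obtain y S N where q': "q = (y, S, N)" by (cases q)
    obtain g where g: "g \<in> carrier (grp A)" "y = act A g x"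
      using closed[of y] q q' by auto
    \<comment> \<open>Undoing an element that carries x to y brings a section at y back to
      x.\<close>
    let ?p = "conj_section A (inv\<^bsub>grp A\<^esub> g) q"
    obtain S' N' where p: "?p = (x, S', N')"
      using g xA by (simp add: q' conj_section_def)
    have pA: "?p \<in> sections K A"
      using conj_section_in_sections[OF K] q g(1) by simp
    have "conj_section A g ?p = q"
      using conj_section_mult[of q K g "inv\<^bsub>grp A\<^esub> g"] conj_section_one[of q K] q g(1) by simp
    then have "((x, S', N'), q) \<in> Restr (section_rel K A) ?P"
      unfolding R using q pA p x g(1) by (intro act_relI[of _ _ _ g]) auto
    then show "\<exists>p\<in>sections K (one_point ?L).
        ((case p of (_, S, N) \<Rightarrow> (x, S, N)), q) \<in> Restr (section_rel K A) ?P"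
      using pA p sec by (intro bexI[of _ "((), S', N')"]) auto
  qed
  then show ?thesis
    by (simp add: section_count_def S0_def)
qed

lemma card_section_classes:
  assumes K: "group K" and "finite I"
    and orb: "\<And>i. i \<in> I \<Longrightarrow> Orb i \<in> orbits (grp A) (pts A) (act A)"
    and disj: "disjoint_family_on Orb I" and cover: "pts A = (\<Union>i\<in>I. Orb i)"
    and Stab: "\<And>i. i \<in> I \<Longrightarrow> \<exists>x\<in>Orb i. Stab i = stabilizer (grp A) (act A) x"
  shows "card (sections K A // section_rel K A) =
    (\<Sum>i\<in>I. section_count K (grp A\<lparr>carrier := Stab i\<rparr>))"
proof -
  \<comment> \<open>Orbits are recast as classes of a relation, so that sections can be counted over
    them through their base points.\<close>
  let ?r = "act_rel (carrier (grp A)) (act A) (pts A)"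
  have r: "equiv (pts A) ?r"
    by (rule equiv_act_rel[OF grp.is_group grp.subgroup_self]) (auto simp: act_mult)
  have "?r `` {x} = orbit (grp A) (act A) x" if "x \<in> pts A" for x
    using that by (auto simp: act_rel_def orbit_def)
  then have quot: "pts A // ?r = orbits (grp A) (pts A) (act A)"
    by (force simp: quotient_def orbits_def)
  \<comment> \<open>The point whose stabilizer is \<open>Stab i\<close> shows that the orbit is
    nonempty. With disjointness this makes \<open>Orb\<close> injective, so no orbit is counted
    twice.\<close>
  have ne: "Orb i \<noteq> {}" if "i \<in> I" for i
    using Stab[OF that] by blast
  have Orb: "Orb ` I = pts A // ?r"
  proof (intro equalityI subsetI)
    fix c assume c: "c \<in> pts A // ?r"
    then obtain x where "x \<in> c" "x \<in> pts A"
      using in_quotient_imp_non_empty[OF r c] in_quotient_imp_subset[OF r c] by blast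
    moreover from this obtain i where "i \<in> I" "x \<in> Orb i" using cover by blast
    ultimately show "c \<in> Orb ` I"
      using quotient_disj[OF r c, of "Orb i"] orb[of i] quot by blast
  qed (use orb quot in blast)
  have inj: "inj_on Orb I"
    using disj ne unfolding inj_on_def disjoint_family_on_def by (metis Int_absorb)
  have "card (sections K A // section_rel K A) = (\<Sum>c\<in>pts A // ?r.
      card ({s\<in>sections K A. fst s \<in> c} // Restr (section_rel K A) {s\<in>sections K A. fst s \<in> c}))"
  proof (rule card_quotient_fibers[OF finite_sections finite_pts equiv_section_rel r])
    show "fst \<in> sections K A \<rightarrow> pts A"
      using sectionsD(1) by auto
    show "(fst s, fst t) \<in> ?r" if "(s, t) \<in> section_rel K A" for s t
      using that sectionsD(1) by (cases s; cases t) (auto simp: act_rel_def conj_section_def)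
  qed
  also have "\<dots> = (\<Sum>i\<in>I. card ({s\<in>sections K A. fst s \<in> Orb i} //
      Restr (section_rel K A) {s\<in>sections K A. fst s \<in> Orb i}))"
    unfolding Orb[symmetric] by (rule sum.reindex_cong[OF inj refl refl])
  also have "\<dots> = (\<Sum>i\<in>I. section_count K (grp A\<lparr>carrier := Stab i\<rparr>))"
  proof (rule sum.cong[OF refl])
    fix i assume i: "i \<in> I"
    obtain x where "x \<in> Orb i" "Stab i = stabilizer (grp A) (act A) x" using Stab[OF i] by blast
    then show "card ({s\<in>sections K A. fst s \<in> Orb i} //
        Restr (section_rel K A) {s\<in>sections K A. fst s \<in> Orb i}) = section_count K (grp A\<lparr>carrier := Stab i\<rparr>)"
      using card_section_classes_over_orbit[OF K orb[OF i]] by simp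
  qed
  finally show ?thesis .
qed

lemma stabilizer_group:
  assumes "orb \<in> orbits (grp A) (pts A) (act A)" "\<exists>x\<in>orb. S = stabilizer (grp A) (act A) x"
  shows "group (grp A\<lparr>carrier := S\<rparr>)" "finite (carrier (grp A\<lparr>carrier := S\<rparr>))"
proof -
  obtain x where x: "x \<in> orb" "S = stabilizer (grp A) (act A) x" using assms(2) by blast
  have "x \<in> pts A"
    using assms(1) x(1) by (auto simp: orbits_def orbit_def)
  then have S: "subgroup S (grp A)"
    unfolding x(2) by (rule stabilizer_subgroup)
  then show "group (grp A\<lparr>carrier := S\<rparr>)" "finite (carrier (grp A\<lparr>carrier := S\<rparr>))"
    using grp.subgroup_imp_group finite_subset[OF subgroup.subset[OF S] finite_carrier] by auto
qed

end

theorem theorem3p7: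
  fixes G :: "'g monoid" and Xs :: "'x set" and \<phi> :: "'g \<Rightarrow> 'x \<Rightarrow> 'x"
    and H :: "'h monoid" and Ys :: "'y set" and \<psi> :: "'h \<Rightarrow> 'y \<Rightarrow> 'y"
    and n m :: nat
    and Orb :: "nat \<Rightarrow> 'x set" and Stab :: "nat \<Rightarrow> 'g set"
    and Orb' :: "nat \<Rightarrow> 'y set" and Stab' :: "nat \<Rightarrow> 'h set"
  assumes "group G" and "finite (carrier G)" and "finite Xs" and "group_action G Xs \<phi>"
    and "group H" and "finite (carrier H)" and "finite Ys" and "group_action H Ys \<psi>"
    and "\<And>i. i \<in> {1..n} \<Longrightarrow> Orb i \<in> orbits G Xs \<phi>"
    and "disjoint_family_on Orb {1..n}" and "Xs = (\<Union>i\<in>{1..n}. Orb i)"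
    and "\<And>i. i \<in> {1..n} \<Longrightarrow> \<exists>x\<in>Orb i. Stab i = stabilizer G \<phi> x"
    and "\<And>j. j \<in> {1..m} \<Longrightarrow> Orb' j \<in> orbits H Ys \<psi>"
    and "disjoint_family_on Orb' {1..m}" and "Ys = (\<Union>j\<in>{1..m}. Orb' j)"
    and "\<And>j. j \<in> {1..m} \<Longrightarrow> \<exists>y\<in>Orb' j. Stab' j = stabilizer H \<psi> y"
    and "isomorphic_CR TYPE('r::comm_ring_1)
           \<lparr>grp = G, pts = Xs, act = \<phi>\<rparr> \<lparr>grp = H, pts = Ys, act = \<psi>\<rparr>"
  shows "n = m \<and> (\<exists>\<sigma>. \<sigma> permutes {1..n} \<and>
           (\<forall>i\<in>{1..n}. G\<lparr>carrier := Stab i\<rparr> \<cong> H\<lparr>carrier := Stab' (\<sigma> i)\<rparr>))"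
proof -
  let ?A = "\<lparr>grp = G, pts = Xs, act = \<phi>\<rparr>" and ?B = "\<lparr>grp = H, pts = Ys, act = \<psi>\<rparr>"
  have fin: "finite_gset ?A" "finite_gset ?B"
    using assms(2-4,6-8) by (simp_all add: finite_gset_def)
  interpret A: fin_gset ?A by standard (rule fin)
  interpret B: fin_gset ?B by standard (rule fin)
  have decomp: "card (sections K ?A // section_rel K ?A) =
        (\<Sum>i\<in>{1..n}. section_count K (G\<lparr>carrier := Stab i\<rparr>))"
      "card (sections K ?B // section_rel K ?B) =
        (\<Sum>j\<in>{1..m}. section_count K (H\<lparr>carrier := Stab' j\<rparr>))"
    if "group K" for K :: "'k monoid"
    using A.card_section_classes[OF that, of "{1..n}" Orb Stab]
      B.card_section_classes[OF that, of "{1..m}" Orb' Stab'] assms(9-16) by simp_all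
  \<comment> \<open>Kept general in the type of K: stabilizers in G and stabilizers in H both serve
    as test groups.\<close>
  have sums: "(\<Sum>i\<in>{1..n}. section_count K (G\<lparr>carrier := Stab i\<rparr>)) =
      (\<Sum>j\<in>{1..m}. section_count K (H\<lparr>carrier := Stab' j\<rparr>))" if "group K" for K :: "'l monoid"
    using isomorphic_CR_card_section_classes[OF assms(17) fin that] decomp[OF that] by simp
  have "group (G\<lparr>carrier := Stab i\<rparr>) \<and> finite (carrier (G\<lparr>carrier := Stab i\<rparr>))" if "i \<in> {1..n}" for i
    using A.stabilizer_group[of "Orb i" "Stab i"] assms(9,12)[OF that] by simp
  moreover have "group (H\<lparr>carrier := Stab' j\<rparr>) \<and> finite (carrier (H\<lparr>carrier := Stab' j\<rparr>))" if "j \<in> {1..m}" for j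
    using B.stabilizer_group[of "Orb' j" "Stab' j"] assms(13,16)[OF that] by simp
  ultimately have "\<exists>f. bij_betw f {1..n} {1..m} \<and>
      (\<forall>i\<in>{1..n}. G\<lparr>carrier := Stab i\<rparr> \<cong> H\<lparr>carrier := Stab' (f i)\<rparr>)"
    by (intro isomorphic_families sums) auto
  then obtain f where f: "bij_betw f {1..n} {1..m}"
      "\<forall>i\<in>{1..n}. G\<lparr>carrier := Stab i\<rparr> \<cong> H\<lparr>carrier := Stab' (f i)\<rparr>" by blast
  have nm: "n = m" using bij_betw_same_card[OF f(1)] by simp
  \<comment> \<open>A permutation of a subset is a total map that fixes everything outside, so f is
    continued by the identity.\<close>
  let ?\<sigma> = "\<lambda>i. if i \<in> {1..n} then f i else i"
  have "bij_betw ?\<sigma> {1..n} {1..n}"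
    using f(1) nm by (subst bij_betw_cong[where g = f]) auto
  then have "?\<sigma> permutes {1..n}"
    by (rule bij_imp_permutes) auto
  with f(2) nm show ?thesis
    by (intro conjI exI[of _ ?\<sigma>]) auto
qed

end
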